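(* Let $n\ge 1$, $1\le r\le n$, and let $f(\boldsymbol{z})=\sum_{\boldsymbol{\alpha}\in A}a_{\boldsymbol{\alpha}}\boldsymbol{z}^{\boldsymbol{\alpha}}$ be a Laurent polynomial in $\boldsymbol{z}=(z_1,\ldots,z_n)$, with $A\subset\mathbb{Z}^n$ finite and all $a_{\boldsymbol{\alpha}}\neq 0$, which is nondegenerate for its Newton polyhedron $\Delta_f$. Let $g$ be a Laurent polynomial coprime with $f$. Let $E$ be a connected component of the complement $\mathbb{R}^n\setminus\mathcal{A}_f$ of the amoeba of $f$, and let $F(\boldsymbol{z})=\sum_{\boldsymbol{\alpha}\in\mathbb{Z}^n}c_{\boldsymbol{\alpha}}\boldsymbol{z}^{\boldsymbol{\alpha}}$ be the Laurent expansion of $g/f$ centered at $\boldsymbol{0}$ that converges absolutely in $\Lambda^{-1}(E)$. Let $\boldsymbol{Q}=(\boldsymbol{q}_1,\ldots,\boldsymbol{q}_r)$ be an $r$-tuple of vectors in $\mathbb{Z}^n$ generating an $r$-dimensional saturated sublattice of $\mathbb{Z}^n$, and let $$d_{\boldsymbol{Q}}(\boldsymbol{t})=\sum_{\boldsymbol{k}\in\mathbb{Z}^r}c_{\boldsymbol{q}_1k_1+\cdots+\boldsymbol{q}_rk_r}\,\boldsymbol{t}^{\boldsymbol{k}},\qquad \boldsymbol{t}=(t_1,\ldots,t_r),$$ be the complete $\boldsymbol{Q}$-diagonal of $F$, and let $\mathfrak{T}\subset T^r_{\boldsymbol{t}}$ be its (nonempty, logarithmically convex) domain of convergence. Let $L\subset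 T^r_{\boldsymbol{t}}$ be the set defined below. Then $d_{\boldsymbol{Q}}$ can be analytically continued along any path in $T^r_{\boldsymbol{t}}\setminus L$ starting at a point $\boldsymbol{t}_0\in\mathfrak{T}$.
   Context: $T^m_{\boldsymbol{z}}=(\mathbb{C}\setminus\{0\})^m$ denotes the complex torus, $\boldsymbol{z}^{\boldsymbol{\alpha}}=z_1^{\alpha_1}\cdots z_n^{\alpha_n}$, and $Z^\times(h)$ denotes the zero set of a Laurent polynomial $h$ in the torus. The Newton polyhedron $\Delta_f$ is the convex hull of $A$ in $\mathbb{R}^n$. For a face $\delta$ of $\Delta_f$ (including $\Delta_f$ itself), the truncation $f_\delta$ is $\sum_{\boldsymbol{\alpha}\in A\cap\delta}a_{\boldsymbol{\alpha}}\boldsymbol{z}^{\boldsymbol{\alpha}}$. The polynomial $f$ is nondegenerate for $\Delta_f$ if for every face $\delta$ of $\Delta_f$ the gradient $(\partial f_\delta/\partial z_1,\ldots,\partial f_\delta/\partial z_n)$ does not vanish at any point of $Z^\times(f_\delta)$. The map $\Lambda:T^n_{\boldsymbol{z}}\to\mathbb{R}^n$ is $\Lambda(\boldsymbol{z})=(\log|z_1|,\ldots,\log|z_n|)$, and the amoeba of $f$ is $\mathcal{A}_f=\Lambda(Z^\times(f))$; the connected components $E$ of $\mathbb{R}^n\setminus\mathcal{A}_f$ are convex and correspond bijectively to the Laurent expansions of $g/f$ centered at $\boldsymbol{0}$, $\Lambda^{-1}(E)$ being the domain of absolute convergence of the corresponding expansion. Definition of $L$: write $\boldsymbol{q}_j=(q_j^1,\ldots,q_j^n)$.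 For each face $\delta$ of $\Delta_f$ let $M_\delta(\boldsymbol{z})$ be the $(r+1)\times n$ matrix whose first row is $\left(z_1\frac{\partial f_\delta}{\partial z_1},\ldots,z_n\frac{\partial f_\delta}{\partial z_n}\right)$ and whose $(j+1)$-st row is $(q_j^1,\ldots,q_j^n)$, $j=1,\ldots,r$. Let $L_\delta\subset T^r_{\boldsymbol{t}}$ be the image under the monomial map $\boldsymbol{z}\mapsto(\boldsymbol{z}^{\boldsymbol{q}_1},\ldots,\boldsymbol{z}^{\boldsymbol{q}_r})$ of the set of points $\boldsymbol{p}\in Z^\times(f_\delta)$ at which $\operatorname{rank}M_\delta(\boldsymbol{p})<r+1$. Then $L$ is the union of the sets $L_\delta$ over all faces $\delta$ of $\Delta_f$. *)

theory Defs
  imports "HOL-Analysis.Analysis"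
begin

type_synonym 'n lpoly = "int^'n \<Rightarrow> complex"

definition lsupp :: "'n::finite lpoly \<Rightarrow> (int^'n) set" where
  "lsupp a = {\<alpha>. a \<alpha> \<noteq> 0}"

definition is_lpoly :: "'n::finite lpoly \<Rightarrow> bool" where
  "is_lpoly a \<longleftrightarrow> finite (lsupp a)"

definition lmono :: "complex^'n \<Rightarrow> int^'n \<Rightarrow> complex" where
  "lmono z \<alpha> = (\<Prod>i\<in>UNIV. (z$i) powi (\<alpha>$i))"

definition leval :: "'n::finite lpoly \<Rightarrow> complex^'n \<Rightarrow> complex" where
  "leval a z = (\<Sum>\<alpha>\<in>lsupp a. a \<alpha> * lmono z \<alpha>)"

definition torus :: "(complex^'n) set" where
  "torus = {z. \<forall>i. z$i \<noteq> 0}"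

definition Ztor :: "'n::finite lpoly \<Rightarrow> (complex^'n) set" where
  "Ztor h = {z \<in> torus. leval h z = 0}"

definition int_to_real :: "int^'n \<Rightarrow> real^'n" where
  "int_to_real \<alpha> = (\<chi> i. real_of_int (\<alpha>$i))"

definition newton :: "'n::finite lpoly \<Rightarrow> (real^'n) set" where
  "newton a = convex hull (int_to_real ` lsupp a)"

definition trunc :: "'n::finite lpoly \<Rightarrow> (real^'n) set \<Rightarrow> 'n lpoly" where
  "trunc a \<delta> = (\<lambda>\<alpha>. if int_to_real \<alpha> \<in> \<delta> then a \<alpha> else 0)"

definition faces :: "'n::finite lpoly \<Rightarrow> (real^'n) set set" where
  "faces a = {\<delta>. \<delta> face_of newton a \<and> \<delta> \<noteq> {}}"

definition lpderiv :: "'n::finite \<Rightarrow> 'n lpoly \<Rightarrow> 'n lpoly" where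
  "lpderiv j a = (\<lambda>\<beta>. of_int ((\<beta> + axis j 1)$j) * a (\<beta> + axis j 1))"

definition nondegenerate :: "'n::finite lpoly \<Rightarrow> bool" where
  "nondegenerate f \<longleftrightarrow>
     (\<forall>\<delta>\<in>faces f. \<forall>p\<in>Ztor (trunc f \<delta>). \<exists>j. leval (lpderiv j (trunc f \<delta>)) p \<noteq> 0)"

definition lmult :: "'n::finite lpoly \<Rightarrow> 'n lpoly \<Rightarrow> 'n lpoly" where
  "lmult a b = (\<lambda>\<gamma>. \<Sum>\<alpha>\<in>lsupp a. a \<alpha> * b (\<gamma> - \<alpha>))"

definition lone :: "'n::finite lpoly" where
  "lone = (\<lambda>\<alpha>. if \<alpha> = 0 then 1 else 0)"

definition ldvd :: "'n::finite lpoly \<Rightarrow> 'n lpoly \<Rightarrow> bool" where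
  "ldvd h f \<longleftrightarrow> (\<exists>k. is_lpoly k \<and> f = lmult h k)"

definition lunit :: "'n::finite lpoly \<Rightarrow> bool" where
  "lunit h \<longleftrightarrow> ldvd h lone"

definition lcoprime :: "'n::finite lpoly \<Rightarrow> 'n lpoly \<Rightarrow> bool" where
  "lcoprime f g \<longleftrightarrow> (\<forall>h. is_lpoly h \<longrightarrow> ldvd h f \<longrightarrow> ldvd h g \<longrightarrow> lunit h)"

definition LogMap :: "complex^'n \<Rightarrow> real^'n" where
  "LogMap z = (\<chi> i. ln (cmod (z$i)))"

definition amoeba :: "'n::finite lpoly \<Rightarrow> (real^'n) set" where
  "amoeba f = LogMap ` Ztor f"

definition laurent_expansion_on ::
  "(int^'n \<Rightarrow> complex) \<Rightarrow> 'n::finite lpoly \<Rightarrow> 'n lpoly \<Rightarrow> (real^'n) set \<Rightarrow> bool" where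
  "laurent_expansion_on c g f E \<longleftrightarrow>
     (\<forall>z\<in>torus. LogMap z \<in> E \<longrightarrow>
        (\<lambda>\<alpha>. norm (c \<alpha> * lmono z \<alpha>)) summable_on UNIV \<and>
        ((\<lambda>\<alpha>. c \<alpha> * lmono z \<alpha>) has_sum (leval g z / leval f z)) UNIV)"

definition lat_comb :: "('r::finite \<Rightarrow> int^'n) \<Rightarrow> int^'r \<Rightarrow> int^'n" where
  "lat_comb q k = (\<Sum>j\<in>UNIV. (k$j) *s q j)"

definition saturated_rank :: "('r::finite \<Rightarrow> int^'n::finite) \<Rightarrow> bool" where
  "saturated_rank q \<longleftrightarrow>
     (\<forall>x::real^'r. (\<Sum>j\<in>UNIV. (x$j) *\<^sub>R int_to_real (q j)) = 0 \<longrightarrow> x = 0) \<and>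
     (\<forall>v::int^'n. int_to_real v \<in> span (range (\<lambda>j. int_to_real (q j)))
        \<longrightarrow> (\<exists>k. v = lat_comb q k))"

definition diag_coef :: "(int^'n \<Rightarrow> complex) \<Rightarrow> ('r::finite \<Rightarrow> int^'n) \<Rightarrow> int^'r \<Rightarrow> complex" where
  "diag_coef c q k = c (lat_comb q k)"

definition diag :: "(int^'n \<Rightarrow> complex) \<Rightarrow> ('r::finite \<Rightarrow> int^'n) \<Rightarrow> complex^'r \<Rightarrow> complex" where
  "diag c q t = infsum (\<lambda>k. diag_coef c q k * lmono t k) UNIV"

definition conv_domain :: "(int^'r::finite \<Rightarrow> complex) \<Rightarrow> (complex^'r) set" where
  "conv_domain d = interior {t \<in> torus. (\<lambda>k. norm (d k * lmono t k)) summable_on UNIV}"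

text \<open>The set L.  rank M_delta(p) < r+1 is written out as linear dependence of
  the r+1 rows of M_delta(p) over C.\<close>
definition rank_deficient :: "'n::finite lpoly \<Rightarrow> ('r::finite \<Rightarrow> int^'n) \<Rightarrow> complex^'n \<Rightarrow> bool" where
  "rank_deficient h q p \<longleftrightarrow>
     (\<exists>(\<mu>0::complex) (\<mu>::'r \<Rightarrow> complex). (\<mu>0 \<noteq> 0 \<or> (\<exists>j. \<mu> j \<noteq> 0)) \<and>
        (\<forall>i. \<mu>0 * (p$i * leval (lpderiv i h) p) + (\<Sum>j\<in>UNIV. \<mu> j * of_int (q j $ i)) = 0))"

definition monomap :: "('r::finite \<Rightarrow> int^'n::finite) \<Rightarrow> complex^'n \<Rightarrow> complex^'r" where
  "monomap q z = (\<chi> j. lmono z (q j))"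

definition Lset :: "'n::finite lpoly \<Rightarrow> ('r::finite \<Rightarrow> int^'n) \<Rightarrow> (complex^'r) set" where
  "Lset f q = (\<Union>\<delta>\<in>faces f. monomap q ` {p \<in> Ztor (trunc f \<delta>). rank_deficient (trunc f \<delta>) q p})"

definition holo_on :: "(complex^'r::finite) set \<Rightarrow> (complex^'r \<Rightarrow> complex) \<Rightarrow> bool" where
  "holo_on U \<phi> \<longleftrightarrow> (\<forall>z\<in>U. \<exists>D. (\<phi> has_derivative D) (at z) \<and> (\<forall>c w. D (c *s w) = c * D w))"

definition continues_along ::
  "(complex^'r::finite \<Rightarrow> complex) \<Rightarrow> (real \<Rightarrow> complex^'r) \<Rightarrow> bool" where
  "continues_along F \<gamma> \<longleftrightarrow>
     (\<exists>U \<phi>. (\<forall>s\<in>{0..1}. open (U s) \<and> \<gamma> s \<in> U s \<and> holo_on (U s) (\<phi> s)) \<and>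
        eventually (\<lambda>t. \<phi> 0 t = F t) (nhds (\<gamma> 0)) \<and>
        (\<forall>s\<in>{0..1}. \<exists>e>0. \<forall>s'\<in>{0..1}. \<bar>s' - s\<bar> < e \<longrightarrow>
            \<gamma> s' \<in> U s \<and> eventually (\<lambda>w. \<phi> s' w = \<phi> s w) (nhds (\<gamma> s'))))"

end

theory Submission imports Defs "HOL-Complex_Analysis.Complex_Analysis"
    "HOL-Library.Poly_Mapping"
    "HOL-Computational_Algebra.Fundamental_Theorem_Algebra" begin

unbundle no fps_syntax

text \<open>The argument is algebraic, in the spirit of Picard and Fuchs. Consider together all diagonals
  \<open>P m\<close> and \<open>R m\<close> of \<open>z^m / f\<close> and \<open>z^m / f^2\<close>. Near a point over the component \<open>E\<close> they are averages over a
  compact torus, and integration by parts shows that they satisfy linear relations in which every derivative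
  of a \<open>P m\<close> is a combination of a \<open>P m\<close> and finitely many \<open>R m\<close>. If \<open>t1\<close> is not in \<open>L\<close>, then for every exponent
  \<open>b\<close> of \<open>f\<close> the functions \<open>z^(-b) f\<close>, \<open>z^(-b) \<theta> f\<close> (\<open>\<theta>\<close> a logarithmic derivation along the fibres) and
  \<open>z^(q j) - t1 j\<close> generate the unit ideal of the algebra of the monoid generated by the \<open>a - b\<close> and the \<open>\<plusminus> q j\<close>:
  a character annihilating them would be supported on a face of the Newton polyhedron and would give a point
  over \<open>t1\<close> at which the rank drops. This allows one to eliminate the \<open>R m\<close> near \<open>t1\<close>, so that finitely many of the
  \<open>P m\<close> solve a linear Pfaffian system which is holomorphic near \<open>t1\<close>, and the family extends to a ball whose
  radius depends only on \<open>t1\<close>.\<close>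

section \<open>Holomorphic functions of several variables\<close>

text \<open>The elimination has to stay within finitely many shifts, which is why the ideal lives in
  a monoid algebra and not in the group algebra of the lattice. Sums of exponents of
  \<open>f\<close> are graded by the number of summands, and a unit relation for every base
  \<open>b\<close> rewrites all \<open>R (g + x)\<close> with \<open>x\<close> of one fixed length
  through shifts of that same length. The price is that a character may vanish at some
  \<open>a - b\<close>; such characters are points at infinity, and they account for the proper
  faces in \<open>Lset\<close>. For \<open>t\<close> near \<open>t1\<close> the relations hold up to
  multiples of \<open>t $ j - t1 $ j\<close>, so elimination inverts a matrix that is the identity
  at \<open>t1\<close>. This matrix must be the same for the infinitely many base exponents
  \<open>g\<close>; otherwise the radii of the balls could shrink to zero. A separate obstacle is
  the start: the averages make sense only over \<open>E\<close>, while the domain of convergence of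
  the diagonal can be larger. The family is therefore built over \<open>E\<close> and carried to
  \<open>t0\<close> inside the domain of convergence, keeping the identity that expresses the
  diagonal through the \<open>P m\<close>.\<close>

abbreviation dderiv :: "(complex^'r::finite \<Rightarrow> complex) \<Rightarrow> complex^'r \<Rightarrow> complex^'r \<Rightarrow> complex" where
  "dderiv \<phi> t \<equiv> frechet_derivative \<phi> (at t)"

lemma norm_cscale: "norm (c *s (x::complex^'r::finite)) = cmod c * norm x"
proof -
  have "norm (c *s x) = L2_set (\<lambda>i. cmod c * norm (x$i)) UNIV"
    by (simp add: norm_vec_def norm_mult)
  also have "\<dots> = cmod c * norm x" by (simp add: norm_vec_def L2_set_right_distrib)
  finally show ?thesis .
qed

lemma bounded_linear_cscale: "bounded_linear (\<lambda>c. c *s (x::complex^'r::finite))"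
proof (rule bounded_linear_intro[where K="norm x"])
  show "(r *\<^sub>R c) *s x = r *\<^sub>R (c *s x)" for r c by (simp add: vec_eq_iff)
qed (simp_all add: vector_sadd_rdistrib norm_cscale)

lemma continuous_on_cscale [continuous_intros]:
  assumes "continuous_on S f" "continuous_on S g"
  shows "continuous_on S (\<lambda>x. f x *s (g x :: complex^'r::finite))"
proof -
  have "continuous_on S (\<lambda>x. \<chi> i. f x * g x $ i)"
    by (intro continuous_intros assms)
  then show ?thesis by (simp add: vector_scalar_mult_def)
qed

lemma holo_on_subset: "holo_on U \<phi> \<Longrightarrow> V \<subseteq> U \<Longrightarrow> holo_on V \<phi>"
  by (auto simp: holo_on_def)

lemma
  assumes "holo_on U \<phi>" "t \<in> U"
  shows holo_on_has_derivative: "(\<phi> has_derivative dderiv \<phi> t) (at t)"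
    and holo_on_dderiv_cscale: "dderiv \<phi> t (c *s x) = c * dderiv \<phi> t x"
proof -
  obtain D where D: "(\<phi> has_derivative D) (at t)" "\<forall>c w. D (c *s w) = c * D w"
    using assms by (auto simp: holo_on_def)
  have "dderiv \<phi> t = D" using frechet_derivative_at[OF D(1)] by simp
  with D show "(\<phi> has_derivative dderiv \<phi> t) (at t)" "dderiv \<phi> t (c *s x) = c * dderiv \<phi> t x" by auto
qed

lemma dderiv_eqI: "(\<phi> has_derivative D) (at t) \<Longrightarrow> dderiv \<phi> t = D"
  using frechet_derivative_at by metis

lemma holo_onI:
  assumes "\<And>t. t \<in> U \<Longrightarrow> (\<phi> has_derivative D t) (at t)" "\<And>t c w. t \<in> U \<Longrightarrow> D t (c *s w) = c * D t w"
  shows "holo_on U \<phi>"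
  using assms unfolding holo_on_def by blast

lemma holo_on_continuous: "holo_on U \<phi> \<Longrightarrow> continuous_on U \<phi>"
  by (meson continuous_at_imp_continuous_on has_derivative_continuous holo_on_has_derivative)

lemma
  assumes "holo_on U \<phi>" "open U" "\<And>t. t \<in> U \<Longrightarrow> \<psi> t = \<phi> t"
  shows holo_on_cong: "holo_on U \<psi>" and dderiv_cong: "t \<in> U \<Longrightarrow> dderiv \<psi> t = dderiv \<phi> t"
proof -
  have *: "(\<psi> has_derivative dderiv \<phi> t) (at t)" if "t \<in> U" for t
    using has_derivative_transform_within_open[OF holo_on_has_derivative[OF assms(1) that] assms(2) that]
      assms(3) by simp
  show "holo_on U \<psi>" by (rule holo_onI[OF *]) (auto simp: holo_on_dderiv_cscale[OF assms(1)])
  show "t \<in> U \<Longrightarrow> dderiv \<psi> t = dderiv \<phi> t" using dderiv_eqI[OF *] .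
qed

lemma holo_on_locally:
  assumes "\<And>t. t \<in> U \<Longrightarrow> \<exists>V. t \<in> V \<and> holo_on V \<phi>"
  shows "holo_on U \<phi>"
  using assms unfolding holo_on_def by blast

lemma holo_on_const [simp]: "holo_on U (\<lambda>t. c)"
  by (rule holo_onI[where D="\<lambda>t x. 0"]) auto

lemma holo_on_coord [simp]: "holo_on U (\<lambda>t. t$i)"
  by (rule holo_onI[where D="\<lambda>t x. x$i"]) (auto intro!: bounded_linear_imp_has_derivative bounded_linear_vec_nth)

lemma holo_on_add [intro]:
  assumes "holo_on U \<phi>" "holo_on U \<psi>" shows "holo_on U (\<lambda>t. \<phi> t + \<psi> t)"
  by (rule holo_onI[OF has_derivative_add[OF assms[THEN holo_on_has_derivative]]])
     (auto simp: assms[THEN holo_on_dderiv_cscale] algebra_simps)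

lemma holo_on_mult [intro]:
  assumes "holo_on U \<phi>" "holo_on U \<psi>" shows "holo_on U (\<lambda>t. \<phi> t * \<psi> t)"
  by (rule holo_onI[OF has_derivative_mult[OF assms[THEN holo_on_has_derivative]]])
     (auto simp: assms[THEN holo_on_dderiv_cscale] algebra_simps)

lemma holo_on_diff [intro]:
  assumes "holo_on U \<phi>" "holo_on U \<psi>" shows "holo_on U (\<lambda>t. \<phi> t - \<psi> t)"
  using holo_on_add[OF assms(1) holo_on_mult[OF holo_on_const[of _ "-1"] assms(2)]] by simp

lemma holo_on_sum [intro]:
  assumes "\<And>i. i \<in> I \<Longrightarrow> holo_on U (\<phi> i)" shows "holo_on U (\<lambda>t. \<Sum>i\<in>I. \<phi> i t)"
  using assms by (induction I rule: infinite_finite_induct) auto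

lemma holo_on_prod [intro]:
  assumes "\<And>i. i \<in> I \<Longrightarrow> holo_on U (\<phi> i)" shows "holo_on U (\<lambda>t. \<Prod>i\<in>I. \<phi> i t)"
  using assms by (induction I rule: infinite_finite_induct) auto

lemma has_derivative_compose_field:
  assumes "(\<phi> has_derivative D) (at t)" "(h has_field_derivative h') (at (\<phi> t))"
  shows "((\<lambda>t. h (\<phi> t)) has_derivative (\<lambda>x. h' * D x)) (at t)"
  using has_derivative_compose[OF assms(1) assms(2)[unfolded has_field_derivative_def]] by simp

lemma holo_on_compose_field:
  assumes "holo_on U \<phi>" "\<And>t. t \<in> U \<Longrightarrow> h field_differentiable (at (\<phi> t))"
  shows "holo_on U (\<lambda>t. h (\<phi> t))"
proof (rule holo_onI)
  fix t assume "t \<in> U"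
  then show "((\<lambda>t. h (\<phi> t)) has_derivative (\<lambda>x. deriv h (\<phi> t) * dderiv \<phi> t x)) (at t)"
    using has_derivative_compose_field[OF holo_on_has_derivative[OF assms(1)] field_differentiable_derivI[OF assms(2)]] by simp
next
  fix t c w assume "t \<in> U"
  then show "deriv h (\<phi> t) * dderiv \<phi> t (c *s w) = c * (deriv h (\<phi> t) * dderiv \<phi> t w)"
    by (simp add: holo_on_dderiv_cscale[OF assms(1)])
qed

lemma holo_on_inverse:
  assumes "holo_on U \<phi>" "\<And>t. t \<in> U \<Longrightarrow> \<phi> t \<noteq> 0" shows "holo_on U (\<lambda>t. inverse (\<phi> t))"
  by (rule holo_on_compose_field[OF assms(1)])
     (use assms(2) in \<open>auto intro!: field_differentiable_inverse simp: field_differentiable_ident\<close>)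

lemma holo_on_divide:
  assumes "holo_on U \<phi>" "holo_on U \<psi>" "\<And>t. t \<in> U \<Longrightarrow> \<psi> t \<noteq> 0" shows "holo_on U (\<lambda>t. \<phi> t / \<psi> t)"
  unfolding divide_inverse using assms by (intro holo_on_mult holo_on_inverse) auto

lemma holo_on_powi:
  assumes "holo_on U \<phi>" "\<And>t. t \<in> U \<Longrightarrow> \<phi> t \<noteq> 0" shows "holo_on U (\<lambda>t. \<phi> t powi k)"
proof (rule holo_on_compose_field[OF assms(1)])
  fix t assume "t \<in> U"
  then show "(\<lambda>z. z powi k) field_differentiable at (\<phi> t)"
    using assms(2) by (auto simp: field_differentiable_def intro!: exI derivative_eq_intros)
qed

lemma holo_on_lmono: "holo_on torus (\<lambda>t. lmono t \<alpha>)"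
  unfolding lmono_def by (intro holo_on_prod holo_on_powi) (auto simp: torus_def)

lemma
  assumes "holo_on U \<phi>" "bounded_linear A" "\<And>c x. A (c *s x) = c *s A x" "\<And>t. t \<in> V \<Longrightarrow> A t + b \<in> U"
  shows holo_on_affine: "holo_on V (\<lambda>t. \<phi> (A t + b))"
    and dderiv_affine: "t \<in> V \<Longrightarrow> dderiv (\<lambda>t. \<phi> (A t + b)) t x = dderiv \<phi> (A t + b) (A x)"
proof -
  have *: "((\<lambda>t. \<phi> (A t + b)) has_derivative (\<lambda>x. dderiv \<phi> (A t + b) (A x))) (at t)" if "t \<in> V" for t
  proof -
    have "((\<lambda>t. A t + b) has_derivative A) (at t)"
      using has_derivative_add[OF bounded_linear_imp_has_derivative[OF assms(2)] has_derivative_const[of b]] by simp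
    from has_derivative_compose[OF this holo_on_has_derivative[OF assms(1) assms(4)[OF that]]]
    show ?thesis by simp
  qed
  show "holo_on V (\<lambda>t. \<phi> (A t + b))"
    by (rule holo_onI[OF *]) (auto simp: assms(3) holo_on_dderiv_cscale[OF assms(1) assms(4)])
  show "t \<in> V \<Longrightarrow> dderiv (\<lambda>t. \<phi> (A t + b)) t x = dderiv \<phi> (A t + b) (A x)"
    by (simp add: dderiv_eqI[OF *])
qed

lemma holo_on_line:
  assumes "holo_on U \<phi>" "t + z *s x \<in> U"
  shows "((\<lambda>z. \<phi> (t + z *s x)) has_field_derivative dderiv \<phi> (t + z *s x) x) (at z)"
proof -
  have "((\<lambda>z. t + z *s x) has_derivative (\<lambda>z. z *s x)) (at z)"
    using has_derivative_add[OF has_derivative_const[of t] bounded_linear_imp_has_derivative[OF bounded_linear_cscale]] by simp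
  from has_derivative_compose[OF this holo_on_has_derivative[OF assms]]
  show ?thesis by (simp add: has_field_derivative_def holo_on_dderiv_cscale[OF assms] mult.commute[of _ "dderiv _ _ _"] cong: if_cong)
qed

section \<open>Cauchy's formula, integrals with a parameter, and uniform limits\<close>

text \<open>Cauchy's formula on the unit circle, written as an integral over \<open>{0..1}\<close>.
  The derivative becomes an average of values of the function, so that continuity, holomorphy in a
  parameter and uniform convergence pass to derivatives by estimating integrals.\<close>

lemma deriv_circle_mean:
  assumes "\<And>z. cmod z \<le> 1 \<Longrightarrow> g field_differentiable (at z)"
  shows "deriv g 0 = integral {0..1} (\<lambda>s. g (cis (2*pi * s)) * cis (-(2*pi * s)))"
proof -
  have c: "continuous_on (cball 0 1) g"
    by (intro continuous_at_imp_continuous_on ballI field_differentiable_imp_continuous_at assms) auto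
  have h: "g holomorphic_on ball 0 1"
    by (auto simp: holomorphic_on_def intro!: field_differentiable_at_within assms)
  have "(g has_field_derivative (1 / (2 * of_real pi * \<i>) * contour_integral(circlepath 0 1) (\<lambda>u. g u / (u-0)^2))) (at 0)"
    by (rule Cauchy_derivative_integral_circlepath[OF c h]) auto
  then have "deriv g 0 = 1 / (2 * of_real pi * \<i>) * contour_integral(circlepath 0 1) (\<lambda>u. g u / u^2)"
    by (simp add: DERIV_imp_deriv)
  also have "contour_integral(circlepath 0 1) (\<lambda>u. g u / u^2) =
      integral {0..1} (\<lambda>s. (2 * of_real pi * \<i>) * (g (cis (2*pi * s)) * cis (-(2*pi * s))))"
    unfolding contour_integral_integral
  proof (rule integral_cong)
    fix s :: real
    have e: "exp (2 * of_real pi * \<i> * of_real s) = cis (2*pi * s)" by (simp add: cis_conv_exp mult_ac)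
    have c: "cis (2*pi * s) * cis (-(2*pi * s)) = 1" by (simp add: cis_mult)
    have *: "x / C\<^sup>2 * (y * C) = y * (x * C')" if "C * C' = 1" for x y C C' :: complex
    proof -
      have "C \<noteq> 0" "C' = inverse C" using that by (auto intro: inverse_unique[symmetric])
      then show ?thesis by (simp add: power2_eq_square divide_inverse)
    qed
    show "g (circlepath 0 1 s) / (circlepath 0 1 s)\<^sup>2 * vector_derivative (circlepath 0 1) (at s) =
        (2 * of_real pi * \<i>) * (g (cis (2*pi * s)) * cis (-(2*pi * s)))"
      unfolding vector_derivative_circlepath unfolding circlepath e
      using *[OF c, of "g (cis (2*pi * s))" "2 * of_real pi * \<i>"] by simp
  qed
  finally show ?thesis by simp
qed

lemma dderiv_circle_mean:
  assumes "holo_on U \<phi>" "\<And>z. cmod z \<le> 1 \<Longrightarrow> t + z *s x \<in> U"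
  shows "dderiv \<phi> t x = integral {0..1} (\<lambda>s. \<phi> (t + cis (2*pi * s) *s x) * cis (-(2*pi * s)))"
proof -
  have "deriv (\<lambda>z. \<phi> (t + z *s x)) 0 = dderiv \<phi> t x"
    using DERIV_imp_deriv[OF holo_on_line[OF assms(1), of t 0 x]] assms(2)[of 0] by simp
  moreover have "(\<lambda>z. \<phi> (t + z *s x)) field_differentiable (at z)" if "cmod z \<le> 1" for z
    using holo_on_line[OF assms(1) assms(2)[OF that]] by (auto simp: field_differentiable_def)
  ultimately show ?thesis using deriv_circle_mean[of "\<lambda>z. \<phi> (t + z *s x)"] by simp
qed

lemma circle_in_cball: "t + z *s x \<in> cball t0 (2*\<rho>)"
  if a: "cmod z \<le> 1" "dist t0 t < \<rho>" "norm (x::complex^'r::finite) \<le> \<rho>"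
proof -
  have "dist t0 (t + z *s x) \<le> dist t0 t + norm (z *s x)"
    by (metis add_diff_cancel_left' dist_commute dist_norm dist_triangle)
  also have "norm (z *s x) \<le> norm x" using a(1) by (simp add: norm_cscale mult_left_le_one_le)
  finally show ?thesis using a by simp
qed

text \<open>Complex homogeneity of the derivative lets \<open>x\<close> be shrunk by the factor
  \<open>k\<close> until the circle around \<open>t\<close> fits into
  \<open>cball t0 (2*\<rho>)\<close>; every direction is thus reached with one fixed
  neighbourhood.\<close>

lemma dderiv_circle_mean_scaled:
  assumes "holo_on U \<phi>" "cball t0 (2*\<rho>) \<subseteq> U" "dist t0 t < \<rho>" "norm x \<le> k * \<rho>" "k > 0"
  shows "dderiv \<phi> t x = of_real k * integral {0..1} (\<lambda>s. \<phi> (t + cis (2*pi * s) *s (of_real (1/k) *s x)) * cis (-(2*pi * s)))"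
proof -
  have n: "norm (of_real (1/k) *s x) \<le> \<rho>" unfolding norm_cscale norm_of_real using assms by (simp add: field_simps)
  have "dist t0 t \<le> 2*\<rho>" using assms(3) zero_le_dist[of t0 t] by linarith
  then have "t \<in> U" using assms(2) by auto
  then have "dderiv \<phi> t x = of_real k * dderiv \<phi> t (of_real (1/k) *s x)"
    using assms(5) by (subst holo_on_dderiv_cscale[OF assms(1)]) auto
  also have "dderiv \<phi> t (of_real (1/k) *s x) = integral {0..1} (\<lambda>s. \<phi> (t + cis (2*pi * s) *s (of_real (1/k) *s x)) * cis (-(2*pi * s)))"
    using circle_in_cball[OF _ assms(3) n] assms(2) by (intro dderiv_circle_mean[OF assms(1)]) blast
  finally show ?thesis .
qed

lemma exists_scale_le:
  assumes "\<rho> > (0::real)" obtains k where "k > 0" "norm x \<le> k * \<rho>"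
proof
  show "norm x / \<rho> + 1 > 0" using assms by (simp add: add_nonneg_pos)
  show "norm x \<le> (norm x / \<rho> + 1) * \<rho>" using assms by (simp add: field_simps)
qed

text \<open>The derivative is a circle mean of values of \<open>F\<close> and inherits their joint
  continuity in \<open>(t,s)\<close>. This is what differentiation under the integral sign asks
  for.\<close>

lemma continuous_on_dderiv_param:
  fixes F :: "complex^'r::finite \<Rightarrow> real \<Rightarrow> complex"
  assumes U: "cball t0 (2*\<rho>) \<subseteq> U" "\<rho> > 0" and h: "\<And>s. s \<in> {a..b} \<Longrightarrow> holo_on U (\<lambda>t. F t s)"
    and c: "continuous_on (U \<times> {a..b}) (\<lambda>(t,s). F t s)"
  shows "continuous_on (ball t0 \<rho> \<times> {a..b}) (\<lambda>(t,s). dderiv (\<lambda>t. F t s) t x)"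
proof -
  obtain k where k: "k > 0" "norm x \<le> k * \<rho>" using exists_scale_le[OF U(2)] .
  define X where "X = of_real (1/k) *s x"
  have n: "norm X \<le> \<rho>" unfolding X_def norm_cscale norm_of_real using k by (simp add: field_simps)
  have "continuous_on ((ball t0 \<rho> \<times> {a..b}) \<times> cbox 0 (1::real))
      (\<lambda>y. (\<lambda>(t,s). F t s) (fst (fst y) + cis (2*pi * snd y) *s X, snd (fst y)) * cis (-(2*pi * snd y)))"
  proof (intro continuous_on_mult continuous_on_compose2[OF c])
    show "(\<lambda>y. (fst (fst y) + cis (2 * pi * snd y) *s X, snd (fst y))) ` ((ball t0 \<rho> \<times> {a..b}) \<times> cbox 0 1) \<subseteq> U \<times> {a..b}"
      using circle_in_cball[OF _ _ n] U(1) by fastforce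
  qed (auto intro!: continuous_intros simp: cis_conv_exp)
  then have "continuous_on (ball t0 \<rho> \<times> {a..b}) (\<lambda>y. of_real k * integral (cbox 0 1) ((\<lambda>(t,s) \<alpha>. F (t + cis (2*pi*\<alpha>) *s X) s * cis (-(2*pi*\<alpha>))) y))"
    by (intro continuous_intros integral_continuous_on_param) (simp add: case_prod_beta)
  then show ?thesis
    by (rule continuous_on_eq)
       (auto simp: dderiv_circle_mean_scaled[OF h U(1) _ k(2,1)] X_def)
qed

lemma
  fixes F :: "complex^'r::finite \<Rightarrow> real \<Rightarrow> complex"
  assumes U: "open U" and h: "\<And>s. s \<in> {a..b} \<Longrightarrow> holo_on U (\<lambda>t. F t s)"
    and c: "continuous_on (U \<times> {a..b}) (\<lambda>(t,s). F t s)"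
  shows holo_param_integral: "holo_on U (\<lambda>t. integral {a..b} (F t))"
    and dderiv_param_integral: "t \<in> U \<Longrightarrow> dderiv (\<lambda>t. integral {a..b} (F t)) t x = integral {a..b} (\<lambda>s. dderiv (\<lambda>t. F t s) t x)"
proof -
  have D: "((\<lambda>t. integral {a..b} (F t)) has_derivative (\<lambda>x. integral {a..b} (\<lambda>s. dderiv (\<lambda>t. F t s) t x))) (at t)"
    if t: "t \<in> U" for t
  proof -
    obtain e where e: "e > 0" "cball t e \<subseteq> U" using U t open_contains_cball by blast
    define \<rho> where "\<rho> = e/2"
    have \<rho>: "\<rho> > 0" "cball t (2*\<rho>) \<subseteq> U" using e by (auto simp: \<rho>_def)
    have bU: "ball t \<rho> \<subseteq> U" using \<rho> by (auto simp: subset_eq)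
    let ?f = "\<lambda>t s. Blinfun (dderiv (\<lambda>t. F t s) t)"
    have bl: "bounded_linear (dderiv (\<lambda>t. F t s) t)" if "t \<in> U" "s \<in> {a..b}" for t s
      using holo_on_has_derivative[OF h[OF that(2)] that(1)] by (rule has_derivative_bounded_linear)
    have ap: "blinfun_apply (?f t s) = dderiv (\<lambda>t. F t s) t" if "t \<in> U" "s \<in> {a..b}" for t s
      using bl[OF that] by (rule bounded_linear_Blinfun_apply)
    \<comment> \<open>The Leibniz rule wants a derivative that is jointly continuous in operator
      norm; in finite dimension it suffices to check each basis vector.\<close>
    have cont: "continuous_on (ball t \<rho> \<times> cbox a b) (\<lambda>(t,s). ?f t s)"
    proof (rule continuous_on_blinfun_componentwise)
      fix i :: "complex^'r" assume "i \<in> Basis"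
      have "continuous_on (ball t \<rho> \<times> {a..b}) (\<lambda>(t,s). dderiv (\<lambda>t. F t s) t i)"
        using continuous_on_dderiv_param[OF \<rho>(2,1) h c] .
      then show "continuous_on (ball t \<rho> \<times> cbox a b) (\<lambda>x. blinfun_apply (case x of (t, s) \<Rightarrow> ?f t s) i)"
        unfolding cbox_interval
        by (rule continuous_on_eq) (use bU in \<open>auto simp: ap subset_eq\<close>)
    qed
    have "((\<lambda>t. integral (cbox a b) (F t)) has_derivative integral (cbox a b) (?f t)) (at t within ball t \<rho>)"
    proof (rule leibniz_rule[OF _ _ cont])
      fix x s assume xs: "x \<in> ball t \<rho>" "s \<in> cbox a b"
      then have "x \<in> U" "s \<in> {a..b}" using bU by auto
      then show "((\<lambda>x. F x s) has_derivative blinfun_apply (Blinfun (dderiv (\<lambda>t. F t s) x))) (at x within ball t \<rho>)"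
        using holo_on_has_derivative[OF h, of s x] ap[of x s] by (auto intro: has_derivative_at_withinI)
    next
      fix x assume x: "x \<in> ball t \<rho>"
      have "continuous_on (cbox a b) (\<lambda>s. (\<lambda>(t,s). F t s) (x,s))"
        by (rule continuous_on_compose2[OF c]) (use x bU in \<open>auto intro!: continuous_intros\<close>)
      then show "F x integrable_on cbox a b" by (intro integrable_continuous) simp
    qed (use \<rho> in auto)
    then have 1: "((\<lambda>t. integral {a..b} (F t)) has_derivative integral {a..b} (?f t)) (at t)"
      using \<rho> by (simp add: at_within_open[of t "ball t \<rho>"])
    have "continuous_on {a..b} (\<lambda>s. (\<lambda>(t,s). ?f t s) (t,s))"
      by (rule continuous_on_compose2[OF cont]) (use \<rho> in \<open>auto intro!: continuous_intros\<close>)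
    then have "?f t integrable_on {a..b}" by (intro integrable_continuous_interval) simp
    then have "blinfun_apply (integral {a..b} (?f t)) x = integral {a..b} (\<lambda>s. dderiv (\<lambda>t. F t s) t x)" for x
      by (subst blinfun_apply_integral) (auto intro!: integral_cong simp: ap[OF t])
    then have "blinfun_apply (integral {a..b} (?f t)) = (\<lambda>x. integral {a..b} (\<lambda>s. dderiv (\<lambda>t. F t s) t x))" by auto
    with 1 show ?thesis by simp
  qed
  show "holo_on U (\<lambda>t. integral {a..b} (F t))"
  proof (rule holo_onI[OF D])
    fix t c w assume t: "t \<in> U"
    have "integral {a..b} (\<lambda>s. dderiv (\<lambda>t. F t s) t (c *s w)) = integral {a..b} (\<lambda>s. c * dderiv (\<lambda>t. F t s) t w)"
      by (rule integral_cong) (simp add: holo_on_dderiv_cscale[OF h t])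
    then show "integral {a..b} (\<lambda>s. dderiv (\<lambda>t. F t s) t (c *s w)) = c * integral {a..b} (\<lambda>s. dderiv (\<lambda>t. F t s) t w)"
      by simp
  qed
  show "t \<in> U \<Longrightarrow> dderiv (\<lambda>t. integral {a..b} (F t)) t x = integral {a..b} (\<lambda>s. dderiv (\<lambda>t. F t s) t x)"
    using dderiv_eqI[OF D] by simp
qed

text \<open>The circle mean exhibits the directional derivative locally as an integral of translates
  of \<open>\<phi>\<close>, each holomorphic in \<open>t\<close>.\<close>

lemma holo_on_dderiv:
  assumes U: "open U" and h: "holo_on U \<phi>"
  shows "holo_on U (\<lambda>t. dderiv \<phi> t x)"
proof (rule holo_on_locally)
  fix t assume "t \<in> U"
  then obtain e where e: "e > 0" "cball t e \<subseteq> U" using U open_contains_cball by blast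
  define \<rho> where "\<rho> = e/2"
  have \<rho>: "\<rho> > 0" "cball t (2*\<rho>) \<subseteq> U" using e by (auto simp: \<rho>_def)
  obtain k where k: "k > 0" "norm x \<le> k * \<rho>" using exists_scale_le[OF \<rho>(1)] .
  define X where "X = of_real (1/k) *s x"
  have n: "norm X \<le> \<rho>" unfolding X_def norm_cscale norm_of_real using k by (simp add: field_simps)
  let ?F = "\<lambda>t s. \<phi> (t + cis (2*pi * s) *s X) * cis (-(2*pi * s))"
  have inU: "u + cis (2*pi * s) *s X \<in> U" if "u \<in> ball t \<rho>" for u s
    using circle_in_cball[OF _ _ n, of "cis (2*pi * s)" t u] that \<rho> by auto
  have "holo_on (ball t \<rho>) (\<lambda>t. integral {0..1} (?F t))"
  proof (rule holo_param_integral)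
    fix s show "holo_on (ball t \<rho>) (\<lambda>t. ?F t s)"
      by (intro holo_on_mult holo_on_const holo_on_affine[OF h bounded_linear_ident _ inU]) auto
  next
    have "continuous_on (ball t \<rho> \<times> {0..1}) (\<lambda>y. \<phi> (fst y + cis (2*pi * snd y) *s X) * cis (-(2*pi * snd y)))"
      by (intro continuous_on_mult continuous_on_compose2[OF holo_on_continuous[OF h]])
         (use inU in \<open>auto intro!: continuous_intros simp: cis_conv_exp\<close>)
    then show "continuous_on (ball t \<rho> \<times> {0..1}) (\<lambda>(t,s). ?F t s)" by (simp add: case_prod_beta)
  qed auto
  then have "holo_on (ball t \<rho>) (\<lambda>t. of_real k * integral {0..1} (?F t))" by auto
  then have "holo_on (ball t \<rho>) (\<lambda>t. dderiv \<phi> t x)"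
    by (rule holo_on_cong) (auto simp: dderiv_circle_mean_scaled[OF h \<rho>(2) _ k(2,1)] X_def)
  then show "\<exists>V. t \<in> V \<and> holo_on V (\<lambda>t. dderiv \<phi> t x)" using \<rho> by (intro exI[of _ "ball t \<rho>"]) auto
qed

text \<open>Weierstrass' theorem. By the circle mean, uniform closeness of the functions gives
  closeness of the derivatives with an error linear in \<open>norm x\<close>, which is the
  convergence required for differentiating a limit.\<close>

lemma holo_uniform_limit:
  fixes \<phi> :: "nat \<Rightarrow> complex^'r::finite \<Rightarrow> complex"
  assumes U: "open U" and h: "\<And>n. holo_on U (\<phi> n)" and lim: "uniform_limit U \<phi> \<psi> sequentially"
  shows "holo_on U \<psi>"
proof (rule holo_on_locally)
  fix t0 assume t0: "t0 \<in> U"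
  then obtain e where e: "e > 0" "cball t0 e \<subseteq> U" using U open_contains_cball by blast
  define \<rho> where "\<rho> = e/2"
  have \<rho>: "\<rho> > 0" "cball t0 (2*\<rho>) \<subseteq> U" using e by (auto simp: \<rho>_def)
  have c\<psi>: "continuous_on U \<psi>"
    by (rule uniform_limit_theorem[OF always_eventually lim]) (simp_all add: holo_on_continuous[OF h])
  \<comment> \<open>The direction is rescaled to length \<rho>, so that the circle stays in
    \<open>U\<close> and the factor \<open>norm x / \<rho>\<close> in \<open>I\<close> makes errors
    proportional to \<open>norm x\<close>. For \<open>x = 0\<close> division by zero yields 0
    throughout, which is the right value.\<close>
  define p where "p = (\<lambda>t (x::complex^'r) s. t + cis (2*pi * s) *s (of_real (1/(norm x / \<rho>)) *s x))"
  define I where "I = (\<lambda>\<phi> t (x::complex^'r). of_real (norm x / \<rho>) * integral {0..1} (\<lambda>s. \<phi> (p t x s) * cis (-(2*pi * s))) :: complex)"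
  have inU: "p t x s \<in> U" if "t \<in> ball t0 \<rho>" for t x s
  proof -
    have "norm (of_real (1/(norm x / \<rho>)) *s x) \<le> \<rho>" unfolding norm_cscale norm_of_real using \<rho>(1) by (cases "x = 0") auto
    from circle_in_cball[OF _ _ this, of "cis (2*pi * s)" t0 t] show ?thesis
      using that \<rho>(2) unfolding p_def by (auto simp del: vector_smult_assoc)
  qed
  have cp: "continuous_on {0..1} (p t x)" for t x
  proof -
    have "continuous_on {0..1} (\<lambda>s. t + cis (2*pi * s) *s y)" for y
      unfolding cis_conv_exp by (intro continuous_intros)
    then show ?thesis unfolding p_def .
  qed
  have f': "dderiv (\<phi> n) t x = I (\<phi> n) t x" if "t \<in> ball t0 \<rho>" for n t x
  proof (cases "x = 0")
    case True
    have "dderiv (\<phi> n) t (0 *s 0) = 0 * dderiv (\<phi> n) t 0"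
      by (rule holo_on_dderiv_cscale[OF h]) (use that \<rho> in \<open>auto simp: subset_eq\<close>)
    with True show ?thesis by (simp add: I_def)
  next
    case False
    then show ?thesis using that \<rho>(1) unfolding I_def p_def by (intro dderiv_circle_mean_scaled[OF h \<rho>(2)]) auto
  qed
  have cont: "continuous_on {0..1} (\<lambda>s. \<phi> (p t x s) * cis (-(2*pi * s)))"
    if "continuous_on U \<phi>" "t \<in> ball t0 \<rho>" for \<phi> :: "complex^'r \<Rightarrow> complex" and t x
    by (intro continuous_on_mult continuous_on_compose2[OF that(1) cp])
       (use inU[OF that(2)] in \<open>auto intro!: continuous_intros simp: cis_conv_exp\<close>)
  have near: "\<forall>\<^sub>F n in sequentially. \<forall>t\<in>ball t0 \<rho>. \<forall>x. norm (dderiv (\<phi> n) t x - I \<psi> t x) \<le> \<epsilon> * norm x"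
    if "\<epsilon> > 0" for \<epsilon>
  proof -
    have "\<epsilon> * \<rho> > 0" using that \<rho> by simp
    with lim have "\<forall>\<^sub>F n in sequentially. \<forall>t\<in>U. dist (\<phi> n t) (\<psi> t) < \<epsilon> * \<rho>" by (simp add: uniform_limit_iff)
    then show ?thesis
    proof eventually_elim
      case (elim n)
      show ?case
      proof (intro ballI allI)
        fix t x assume t: "t \<in> ball t0 \<rho>"
        let ?J = "\<lambda>\<phi>. integral {0..1} (\<lambda>s. \<phi> (p t x s) * cis (-(2*pi * s)))"
        note c1 = cont[OF holo_on_continuous[OF h] t] and c2 = cont[OF c\<psi> t]
        have "norm (?J (\<phi> n) - ?J \<psi>)
          = norm (integral {0..1} (\<lambda>s. \<phi> n (p t x s) * cis (-(2*pi * s)) - \<psi> (p t x s) * cis (-(2*pi * s))))"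
          by (subst integral_diff) (auto intro!: integrable_continuous_interval c1 c2)
        also have "\<dots> \<le> (\<epsilon> * \<rho>) * (1 - 0)"
        proof (rule integral_bound)
          show "continuous_on {0..1} (\<lambda>s. \<phi> n (p t x s) * cis (-(2*pi * s)) - \<psi> (p t x s) * cis (-(2*pi * s)))"
            by (intro continuous_on_diff c1 c2)
          fix s :: real
          have "norm ((\<phi> n (p t x s) - \<psi> (p t x s)) * cis (-(2*pi * s))) < \<epsilon> * \<rho>"
            using elim inU[OF t] by (simp add: norm_mult dist_norm)
          then show "norm (\<phi> n (p t x s) * cis (-(2*pi * s)) - \<psi> (p t x s) * cis (-(2*pi * s))) \<le> \<epsilon> * \<rho>"
            by (simp add: algebra_simps)
        qed simp
        finally have *: "norm (?J (\<phi> n) - ?J \<psi>) \<le> \<epsilon> * \<rho>" by simp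
        have "norm (dderiv (\<phi> n) t x - I \<psi> t x) = norm (of_real (norm x / \<rho>) * (?J (\<phi> n) - ?J \<psi>))"
          unfolding f'[OF t] I_def by (simp only: right_diff_distrib)
        also have "\<dots> \<le> norm x / \<rho> * (\<epsilon> * \<rho>)" unfolding norm_mult norm_of_real using \<rho>(1) * by (intro mult_mono) auto
        finally show "norm (dderiv (\<phi> n) t x - I \<psi> t x) \<le> \<epsilon> * norm x" using \<rho>(1) by (simp add: field_simps)
      qed
    qed
  qed
  have bU: "ball t0 \<rho> \<subseteq> U" using \<rho> by (auto simp: subset_eq)
  have pt: "(\<lambda>n. \<phi> n t) \<longlonglongrightarrow> \<psi> t" if "t \<in> U" for t using tendsto_uniform_limitI[OF lim that] .
  have "\<exists>g. \<forall>t\<in>ball t0 \<rho>. (\<lambda>n. \<phi> n t) \<longlonglongrightarrow> g t \<and> (g has_derivative I \<psi> t) (at t within ball t0 \<rho>)"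
  proof (rule has_derivative_sequence)
    show "\<And>n t. t \<in> ball t0 \<rho> \<Longrightarrow> (\<phi> n has_derivative dderiv (\<phi> n) t) (at t within ball t0 \<rho>)"
      by (rule has_derivative_at_withinI[OF holo_on_has_derivative[OF h subsetD[OF bU]]])
    show "(\<lambda>n. \<phi> n t0) \<longlonglongrightarrow> \<psi> t0" using pt t0 by simp
    show "t0 \<in> ball t0 \<rho>" using \<rho> by simp
  qed (rule convex_ball, rule near)
  then obtain g where g: "\<And>t. t \<in> ball t0 \<rho> \<Longrightarrow> (\<lambda>n. \<phi> n t) \<longlonglongrightarrow> g t"
    "\<And>t. t \<in> ball t0 \<rho> \<Longrightarrow> (g has_derivative I \<psi> t) (at t within ball t0 \<rho>)" by blast
  have eq: "g t = \<psi> t" if "t \<in> ball t0 \<rho>" for t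
    using LIMSEQ_unique[OF g(1)[OF that] pt] that bU by auto
  have D: "(\<psi> has_derivative I \<psi> t) (at t)" if t: "t \<in> ball t0 \<rho>" for t
  proof -
    have "(g has_derivative I \<psi> t) (at t)" using g(2)[OF t] t by (simp add: at_within_open[of t "ball t0 \<rho>"])
    then show ?thesis by (rule has_derivative_transform_within_open[OF _ open_ball t eq])
  qed
  \<comment> \<open>Because of the factor \<open>norm x\<close>, complex homogeneity cannot be read
    off from \<open>I\<close>; it is inherited in the limit from the derivatives of the
    approximants.\<close>
  have L: "I \<psi> t (c *s x) = c * I \<psi> t x" if t: "t \<in> ball t0 \<rho>" for t c x
  proof -
    have conv: "(\<lambda>n. dderiv (\<phi> n) t x) \<longlonglongrightarrow> I \<psi> t x" for x
    proof (rule LIMSEQ_I)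
      fix r :: real assume r: "r > 0"
      have p: "norm x + 1 > 0" by (simp add: add_nonneg_pos)
      have "r / (norm x + 1) * norm x < r" using r p by (simp add: field_simps)
      moreover have "r / (norm x + 1) > 0" using r p by simp
      ultimately show "\<exists>no. \<forall>n\<ge>no. norm (dderiv (\<phi> n) t x - I \<psi> t x) < r"
        using near[of "r / (norm x + 1)"] t unfolding eventually_sequentially by (meson le_less_trans)
    qed
    have "t \<in> U" using t bU by auto
    then have "(\<lambda>n. dderiv (\<phi> n) t (c *s x)) \<longlonglongrightarrow> c * I \<psi> t x"
      using tendsto_mult_left[OF conv, of c x] holo_on_dderiv_cscale[OF h] by auto
    with conv show ?thesis using LIMSEQ_unique by blast
  qed
  have "holo_on (ball t0 \<rho>) \<psi>" by (rule holo_onI[OF D L])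
  then show "\<exists>V. t0 \<in> V \<and> holo_on V \<psi>" using \<rho>(1) by (intro exI[of _ "ball t0 \<rho>"]) auto
qed

text \<open>Restriction to the complex line through \<open>t0\<close> and \<open>t\<close> reduces
  the claim to the identity theorem in one variable; convexity of \<open>U\<close> keeps the slice
  connected.\<close>

lemma holo_eq_on_convex:
  assumes U: "open U" "convex U" and h: "holo_on U \<phi>" "holo_on U \<psi>"
    and t0: "t0 \<in> U" "\<forall>\<^sub>F t in nhds t0. \<phi> t = \<psi> t" and t: "t \<in> U"
  shows "\<phi> t = \<psi> t"
proof -
  let ?l = "\<lambda>z. t0 + z *s (t - t0)"
  define S where "S = {z. ?l z \<in> U}"
  have cl: "continuous_on UNIV ?l" by (intro continuous_intros)
  have oS: "open S" unfolding S_def using open_vimage[OF U(1) cl] by (simp only: vimage_def)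
  have "convex S"
    unfolding convex_def
  proof (intro ballI allI impI)
    fix x y and u v :: real assume xy: "x \<in> S" "y \<in> S" "0 \<le> u" "0 \<le> v" "u + v = 1"
    have "u *\<^sub>R ?l x + v *\<^sub>R ?l y \<in> U"
      by (rule convexD[OF U(2)]) (use xy in \<open>auto simp only: S_def mem_Collect_eq\<close>)
    moreover have "u *\<^sub>R ?l x + v *\<^sub>R ?l y = (u+v) *\<^sub>R t0 + (u *\<^sub>R x + v *\<^sub>R y) *s (t - t0)"
    proof -
      have "u *\<^sub>R (a + x * w) + v *\<^sub>R (a + y * w) = (u+v) *\<^sub>R a + (u *\<^sub>R x + v *\<^sub>R y) * w" for a w :: complex
        by (simp add: algebra_simps)
      then show ?thesis
        by (simp only: vec_eq_iff vector_add_component vector_scaleR_component vector_smult_component simp_thms)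
    qed
    ultimately show "u *\<^sub>R x + v *\<^sub>R y \<in> S" by (simp only: xy(5) S_def mem_Collect_eq scaleR_one)
  qed
  then have S: "open S" "connected S" using oS convex_connected by auto
  let ?f = "\<lambda>z. \<phi> (?l z) - \<psi> (?l z)"
  have hol: "?f holomorphic_on S"
    unfolding holomorphic_on_def
  proof
    fix z assume "z \<in> S"
    then have "?l z \<in> U" by (simp add: S_def)
    note l = holo_on_line[OF h(1) this] holo_on_line[OF h(2) this]
    have "(?f has_field_derivative (dderiv \<phi> (?l z) (t - t0) - dderiv \<psi> (?l z) (t - t0))) (at z within S)"
      by (rule DERIV_diff[OF l[THEN has_field_derivative_at_within]])
    then show "?f field_differentiable at z within S" unfolding field_differentiable_def by blast
  qed
  obtain T where T: "open T" "t0 \<in> T" "\<And>t. t \<in> T \<Longrightarrow> \<phi> t = \<psi> t"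
    using t0(2) by (auto simp: eventually_nhds)
  define V where "V = S \<inter> {z. ?l z \<in> T}"
  have "open {z. ?l z \<in> T}" using open_vimage[OF T(1) cl] by (simp only: vimage_def)
  with oS have oV: "open V" unfolding V_def by (rule open_Int)
  have 0: "0 \<in> V" using T t0 by (simp add: V_def S_def)
  have "?f 1 = 0"
  proof (rule analytic_continuation[OF hol S])
    show "V \<subseteq> S" "0 \<in> S" using 0 by (auto simp: V_def)
    show "0 islimpt V" using oV 0 by (simp add: interior_limit_point interior_open)
    show "1 \<in> S" using t by (simp add: S_def)
  qed (auto simp: V_def T(3))
  then show ?thesis by simp
qed

section \<open>Linear Pfaffian systems and continuation along paths\<close>

lemma integral_power_01: "integral {0..1} (\<lambda>s::real. s ^ k) = 1 / real (Suc k)"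
proof -
  have "((\<lambda>s::real. s ^ k) has_integral (1 ^ Suc k / real (Suc k) - 0 ^ Suc k / real (Suc k))) {0..1}"
  proof (rule fundamental_theorem_of_calculus)
    fix x :: real
    have "((\<lambda>s::real. s ^ Suc k / real (Suc k)) has_field_derivative real (Suc k) * x ^ k / real (Suc k)) (at x within {0..1})"
      using DERIV_cdivide[OF DERIV_pow[of "Suc k" x "{0..1}"], of "real (Suc k)"] by simp
    then show "((\<lambda>s::real. s ^ Suc k / real (Suc k)) has_vector_derivative x ^ k) (at x within {0..1})"
      unfolding has_real_derivative_iff_has_vector_derivative by simp
  qed simp
  then show ?thesis by (simp add: integral_unique)
qed

text \<open>The operator of Picard iteration for the system
  \<open>dy i = \<Sum> A i j l * y j * dt l\<close>, integrated along the segment from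
  \<open>t2\<close> to \<open>t\<close>. Integration is radial only, so the iteration makes sense
  for every holomorphic \<open>A\<close>; that the differential equations persist on the larger ball
  is obtained later from the identity theorem.\<close>

definition pfaff_op :: "'i set \<Rightarrow> ('i \<Rightarrow> 'i \<Rightarrow> 'r \<Rightarrow> complex^'r \<Rightarrow> complex) \<Rightarrow> complex^'r::finite
    \<Rightarrow> ('i \<Rightarrow> complex^'r \<Rightarrow> complex) \<Rightarrow> 'i \<Rightarrow> complex^'r \<Rightarrow> complex" where
  "pfaff_op I A t2 u i t = integral {0..1} (\<lambda>s. \<Sum>l\<in>UNIV. \<Sum>j\<in>I.
      (t - t2) $ l * A i j l (s *\<^sub>R (t - t2) + t2) * u j (s *\<^sub>R (t - t2) + t2))"

lemma segment_in_convex: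
  assumes "convex W" "t2 \<in> W" "t \<in> W" "s \<in> {0..1}"
  shows "s *\<^sub>R (t - t2) + t2 \<in> W"
proof -
  have "(1 - s) *\<^sub>R t2 + s *\<^sub>R t \<in> W" using assms by (intro convexD_alt) auto
  then show ?thesis by (simp add: algebra_simps)
qed

lemma continuous_on_pfaff_integrand:
  assumes W: "convex W" "t2 \<in> W" "t \<in> W"
    and A: "\<And>i j l. i \<in> I \<Longrightarrow> j \<in> I \<Longrightarrow> continuous_on W (A i j l)"
    and u: "\<And>j. j \<in> I \<Longrightarrow> continuous_on W (u j)" and i: "i \<in> I"
  shows "continuous_on {0..1} (\<lambda>s. \<Sum>l\<in>UNIV. \<Sum>j\<in>I.
      (t - t2) $ l * A i j l (s *\<^sub>R (t - t2) + t2) * u j (s *\<^sub>R (t - t2) + t2) :: complex)"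
  by (intro continuous_on_sum continuous_on_mult continuous_on_const
      continuous_on_compose2[OF A[OF i]] continuous_on_compose2[OF u])
     (auto intro!: continuous_intros segment_in_convex[OF W])

text \<open>On the segment \<open>u\<close> is bounded by a constant times
  \<open>(s * norm (t - t2)) ^ k\<close>, and integrating \<open>s ^ k\<close> produces the
  denominator \<open>Suc k\<close>. Under iteration these denominators build up the factorial that
  makes the iterates converge on the whole ball.\<close>

lemma norm_pfaff_op_le:
  fixes t2 :: "complex^'r::finite"
  assumes W: "convex W" "t2 \<in> W" "t \<in> W"
    and A: "\<And>i j l. i \<in> I \<Longrightarrow> j \<in> I \<Longrightarrow> continuous_on W (A i j l)"
    and u: "\<And>j. j \<in> I \<Longrightarrow> continuous_on W (u j)" and i: "i \<in> I"
    and M: "\<And>j l t. j \<in> I \<Longrightarrow> t \<in> W \<Longrightarrow> norm (A i j l t) \<le> M"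
    and K: "\<And>j t. j \<in> I \<Longrightarrow> t \<in> W \<Longrightarrow> norm (u j t) \<le> K * norm (t - t2) ^ k"
  shows "norm (pfaff_op I A t2 u i t) \<le> (real CARD('r) * real (card I) * M) * K * norm (t - t2) ^ Suc k / real (Suc k)"
proof -
  let ?r = "norm (t - t2)"
  have "norm (pfaff_op I A t2 u i t) \<le> integral {0..1} (\<lambda>s. (real CARD('r) * real (card I) * M * K * ?r ^ Suc k) * s ^ k)"
    unfolding pfaff_op_def
  proof (rule integral_norm_bound_integral)
    show "(\<lambda>s. \<Sum>l\<in>UNIV. \<Sum>j\<in>I. (t - t2) $ l * A i j l (s *\<^sub>R (t - t2) + t2) * u j (s *\<^sub>R (t - t2) + t2)) integrable_on {0..1}"
      by (intro integrable_continuous_interval continuous_on_pfaff_integrand[OF W A u i])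
    show "(\<lambda>s::real. (real CARD('r) * real (card I) * M * K * ?r ^ Suc k) * s ^ k) integrable_on {0..1}"
      by (intro integrable_continuous_interval continuous_intros)
    fix s :: real assume s: "s \<in> {0..1}"
    let ?p = "s *\<^sub>R (t - t2) + t2"
    have p: "?p \<in> W" by (rule segment_in_convex[OF W s])
    have "norm (\<Sum>l\<in>UNIV. \<Sum>j\<in>I. (t - t2) $ l * A i j l ?p * u j ?p) \<le> (\<Sum>l\<in>(UNIV::'r set). \<Sum>j\<in>I. ?r * M * (K * (s * ?r) ^ k))"
    proof (intro sum_norm_le)
      fix l j assume j: "j \<in> I"
      have "norm ((t - t2) $ l) * norm (A i j l ?p) * norm (u j ?p) \<le> ?r * M * (K * norm (?p - t2) ^ k)"
        by (intro mult_mono mult_nonneg_nonneg Finite_Cartesian_Product.norm_nth_le M[OF j p] K[OF j p] norm_ge_zero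
            order_trans[OF norm_ge_zero M[OF j p]])
      then show "norm ((t - t2) $ l * A i j l ?p * u j ?p) \<le> ?r * M * (K * (s * ?r) ^ k)"
        using s by (simp add: norm_mult)
    qed
    also have "\<dots> = (real CARD('r) * real (card I) * M * K * ?r ^ Suc k) * s ^ k"
      by (simp add: power_mult_distrib)
    finally show "norm (\<Sum>l\<in>UNIV. \<Sum>j\<in>I. (t - t2) $ l * A i j l ?p * u j ?p) \<le> \<dots>" .
  qed
  also have "\<dots> = (real CARD('r) * real (card I) * M) * K * ?r ^ Suc k / real (Suc k)"
    by (simp add: integral_power_01)
  finally show ?thesis .
qed

lemma pfaff_op_diff:
  assumes W: "convex W" "t2 \<in> W" "t \<in> W"
    and A: "\<And>i j l. i \<in> I \<Longrightarrow> j \<in> I \<Longrightarrow> continuous_on W (A i j l)"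
    and u: "\<And>j. j \<in> I \<Longrightarrow> continuous_on W (u j)" "\<And>j. j \<in> I \<Longrightarrow> continuous_on W (v j)" and i: "i \<in> I"
  shows "pfaff_op I A t2 (\<lambda>j t. u j t - v j t) i t = pfaff_op I A t2 u i t - pfaff_op I A t2 v i t"
proof -
  let ?F = "\<lambda>u s. \<Sum>l\<in>UNIV. \<Sum>j\<in>I. (t - t2) $ l * A i j l (s *\<^sub>R (t - t2) + t2) * u j (s *\<^sub>R (t - t2) + t2)"
  have int: "?F u integrable_on {0..1}" "?F v integrable_on {0..1}"
    by (intro integrable_continuous_interval continuous_on_pfaff_integrand[OF W] A u i; assumption)+
  show ?thesis
    unfolding pfaff_op_def integral_diff[OF int, symmetric]
    by (simp add: sum_subtractf right_diff_distrib)
qed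

lemma holo_pfaff_op:
  fixes t2 :: "complex^'r::finite"
  assumes W: "convex W" "open W" "t2 \<in> W"
    and A: "\<And>i j l. i \<in> I \<Longrightarrow> j \<in> I \<Longrightarrow> holo_on W (A i j l)"
    and u: "\<And>j. j \<in> I \<Longrightarrow> holo_on W (u j)" and i: "i \<in> I"
  shows "holo_on W (pfaff_op I A t2 u i)"
proof -
  have in_W: "s *\<^sub>R (t - t2) + t2 \<in> W" if "t \<in> W" "s \<in> {0..1}" for s t
    using segment_in_convex[OF W(1,3) that] .
  have aff: "holo_on W (\<lambda>t. \<phi> (s *\<^sub>R (t - t2) + t2))" if "holo_on W \<phi>" "s \<in> {0..1}" for \<phi> s
  proof -
    have "holo_on W (\<lambda>t. \<phi> (s *\<^sub>R t + (t2 - s *\<^sub>R t2)))"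
    proof (rule holo_on_affine[OF that(1)])
      show "bounded_linear ((*\<^sub>R) s :: complex^'r \<Rightarrow> _)" by (rule bounded_linear_scaleR_right)
      show "s *\<^sub>R (c *s x) = c *s (s *\<^sub>R x)" for c and x :: "complex^'r" by (simp add: vec_eq_iff)
      show "s *\<^sub>R t + (t2 - s *\<^sub>R t2) \<in> W" if "t \<in> W" for t
        using in_W[OF that \<open>s \<in> {0..1}\<close>] by (simp add: algebra_simps)
    qed
    then show ?thesis by (simp add: algebra_simps)
  qed
  have cont: "continuous_on (W \<times> {0..1}) (\<lambda>y. \<phi> (snd y *\<^sub>R (fst y - t2) + t2))" if "holo_on W \<phi>" for \<phi>
    by (rule continuous_on_compose2[OF holo_on_continuous[OF that]]) (use in_W in \<open>auto intro!: continuous_intros\<close>)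
  have "holo_on W (\<lambda>t. integral {0..1} (\<lambda>s. \<Sum>l\<in>UNIV. \<Sum>j\<in>I.
      (t - t2) $ l * A i j l (s *\<^sub>R (t - t2) + t2) * u j (s *\<^sub>R (t - t2) + t2)))"
  proof (rule holo_param_integral[OF W(2)])
    show "holo_on W (\<lambda>t. \<Sum>l\<in>UNIV. \<Sum>j\<in>I. (t - t2) $ l * A i j l (s *\<^sub>R (t - t2) + t2) * u j (s *\<^sub>R (t - t2) + t2))"
      if "s \<in> {0..1}" for s
      unfolding vector_minus_component
      by (intro holo_on_sum holo_on_mult holo_on_diff holo_on_coord holo_on_const aff that A[OF i] u)
    show "continuous_on (W \<times> {0..1}) (\<lambda>(t,s). \<Sum>l\<in>UNIV. \<Sum>j\<in>I. (t - t2) $ l * A i j l (s *\<^sub>R (t - t2) + t2) * u j (s *\<^sub>R (t - t2) + t2))"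
      unfolding case_prod_beta
      by (intro continuous_on_sum continuous_on_mult cont A[OF i] u continuous_intros) 
  qed
  then show ?thesis unfolding pfaff_op_def[abs_def] .
qed

lemma summable_pfaff_majorant: "summable (\<lambda>n. C * (K * R) ^ n / fact n :: real)"
  using summable_mult[OF summable_exp[of "K * R"], of C] by (simp add: divide_inverse mult_ac)

text \<open>The ball does not depend on the size of the coefficients \<open>A\<close>, because the system is linear.\<close>

lemma pfaff_extension:
  fixes A :: "'i \<Rightarrow> 'i \<Rightarrow> 'r \<Rightarrow> complex^'r::finite \<Rightarrow> complex"
  assumes I: "finite I" and A: "\<And>i j l. i \<in> I \<Longrightarrow> j \<in> I \<Longrightarrow> holo_on (cball t1 \<epsilon>) (A i j l)"
    and t2: "t2 \<in> ball t1 \<epsilon>" and \<delta>: "\<delta> > 0"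
    and y: "\<And>i t. i \<in> I \<Longrightarrow> t \<in> ball t2 \<delta> \<Longrightarrow>
      (y i has_derivative (\<lambda>x. \<Sum>l\<in>UNIV. \<Sum>j\<in>I. x $ l * A i j l t * y j t)) (at t)"
  shows "\<exists>Y. \<forall>i\<in>I. holo_on (ball t1 \<epsilon>) (Y i) \<and> (\<forall>\<^sub>F t in nhds t2. Y i t = y i t)"
proof -
  let ?B = "ball t1 \<epsilon>" and ?T = "pfaff_op I A t2"
  have AB: "\<And>i j l. i \<in> I \<Longrightarrow> j \<in> I \<Longrightarrow> holo_on ?B (A i j l)"
    using A by (meson ball_subset_cball holo_on_subset)
  define YY where "YY = rec_nat (\<lambda>i t. y i t2) (\<lambda>n u i t. y i t2 + ?T u i t)"
  have Y0: "YY 0 = (\<lambda>i t. y i t2)" and YS: "\<And>n. YY (Suc n) = (\<lambda>i t. y i t2 + ?T (YY n) i t)"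
    by (simp_all add: YY_def)
  have hY: "holo_on ?B (YY n i)" if "i \<in> I" for n i
    using that
  proof (induction n arbitrary: i)
    case (Suc n)
    show ?case unfolding YS
      by (intro holo_on_add holo_on_const holo_pfaff_op[OF convex_ball open_ball t2 AB] Suc)
  qed (simp add: Y0)
  have "\<exists>M. \<forall>t\<in>cball t1 \<epsilon>. norm (A i j l t) \<le> M" if "i \<in> I" "j \<in> I" for i j l
    using compact_imp_bounded[OF compact_continuous_image[OF holo_on_continuous[OF A[OF that, of l]] compact_cball]]
    by (auto simp: bounded_iff)
  then obtain Mf where Mf: "\<And>i j l t. i \<in> I \<Longrightarrow> j \<in> I \<Longrightarrow> t \<in> cball t1 \<epsilon> \<Longrightarrow> norm (A i j l t) \<le> Mf i j l"
    by metis
  \<comment> \<open>One constant for all entries, obtained by summing the individual bounds; these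
    exist because \<open>A\<close> is holomorphic on the closed ball, which is compact.\<close>
  define M where "M = (\<Sum>i\<in>I. \<Sum>j\<in>I. \<Sum>l\<in>UNIV. \<bar>Mf i j l\<bar>)"
  have M0: "M \<ge> 0" unfolding M_def by (intro sum_nonneg) auto
  have M: "norm (A i j l t) \<le> M" if "i \<in> I" "j \<in> I" "t \<in> ?B" for i j l t
  proof -
    have "norm (A i j l t) \<le> \<bar>Mf i j l\<bar>" using Mf[of i j t l] that by auto
    also have "\<dots> \<le> (\<Sum>l\<in>UNIV. \<bar>Mf i j l\<bar>)" by (rule member_le_sum) auto
    also have "\<dots> \<le> (\<Sum>j\<in>I. \<Sum>l\<in>UNIV. \<bar>Mf i j l\<bar>)"
      by (rule member_le_sum[where f="\<lambda>j. \<Sum>l\<in>UNIV. \<bar>Mf i j l\<bar>"]) (use that I in \<open>auto intro: sum_nonneg\<close>)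
    also have "\<dots> \<le> M" unfolding M_def
      by (rule member_le_sum[where f="\<lambda>i. \<Sum>j\<in>I. \<Sum>l\<in>UNIV. \<bar>Mf i j l\<bar>"]) (use that I in \<open>auto intro!: sum_nonneg\<close>)
    finally show ?thesis .
  qed
  define N where "N = real CARD('r) * real (card I) * M"
  have N0: "N \<ge> 0" using M0 by (simp add: N_def)
  \<comment> \<open>One application of the operator raises the exponent and the factorial by one.
    The same estimate serves the differences of consecutive iterates and, with another
    \<open>C\<close>, the distance from \<open>y\<close> to the iterates.\<close>
  have iter: "norm (?T u i t) \<le> C * (N * norm (t - t2)) ^ Suc n / fact (Suc n)"
    if W: "convex W" "t2 \<in> W" "t \<in> W" "W \<subseteq> ?B" and u: "\<And>j. j \<in> I \<Longrightarrow> continuous_on W (u j)" and i: "i \<in> I"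
      and K: "\<And>j t. j \<in> I \<Longrightarrow> t \<in> W \<Longrightarrow> norm (u j t) \<le> C * (N * norm (t - t2)) ^ n / fact n" for W t u i n C
  proof -
    have "norm (?T u i t) \<le> (real CARD('r) * real (card I) * M) * (C * N ^ n / fact n) * norm (t - t2) ^ Suc n / real (Suc n)"
    proof (rule norm_pfaff_op_le[OF W(1-3) _ u i])
      show "continuous_on W (A i j l)" if "i \<in> I" "j \<in> I" for i j l
        using holo_on_continuous[OF AB[OF that]] W(4) by (rule continuous_on_subset)
    qed (use M i W(4) K in \<open>auto simp: power_mult_distrib field_simps\<close>)
    then show ?thesis by (simp add: N_def power_mult_distrib field_simps)
  qed
  have contA: "continuous_on W (A i j l)" if "W \<subseteq> ?B" "i \<in> I" "j \<in> I" for W i j l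
    using holo_on_continuous[OF AB[OF that(2,3)]] that(1) by (rule continuous_on_subset)
  have contY: "continuous_on W (YY n i)" if "W \<subseteq> ?B" "i \<in> I" for W n i
    using holo_on_continuous[OF hY[OF that(2)]] that(1) by (rule continuous_on_subset)
  define C where "C = (\<Sum>i\<in>I. norm (y i t2))"
  have C: "norm (y i t2) \<le> C" if "i \<in> I" for i
    unfolding C_def by (rule member_le_sum) (use that I in auto)
  have C0: "C \<ge> 0" unfolding C_def by (intro sum_nonneg) auto
  have step: "norm (YY (Suc n) i t - YY n i t) \<le> C * (N * norm (t - t2)) ^ Suc n / fact (Suc n)" if "i \<in> I" "t \<in> ?B" for n i t
    using that
  proof (induction n arbitrary: i t)
    case 0
    then show ?case unfolding YS Y0
      using iter[of ?B t "\<lambda>i t. y i t2" i C 0] C t2 by simp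
  next
    case (Suc n)
    have "norm (?T (\<lambda>j t. YY (Suc n) j t - YY n j t) i t) \<le> C * (N * norm (t - t2)) ^ Suc (Suc n) / fact (Suc (Suc n))"
      using Suc t2 by (intro iter[of ?B]) (auto intro!: continuous_on_diff contY)
    moreover have "YY (Suc (Suc n)) i t - YY (Suc n) i t = ?T (\<lambda>j t. YY (Suc n) j t - YY n j t) i t"
    proof -
      have "?T (\<lambda>j t. YY (Suc n) j t - YY n j t) i t = ?T (YY (Suc n)) i t - ?T (YY n) i t"
        by (rule pfaff_op_diff[of ?B]) (use Suc(2,3) t2 in \<open>auto intro!: contY contA\<close>)
      then show ?thesis by (simp add: YS[of "Suc n"] YS[of n])
    qed
    ultimately show ?case by simp
  qed
  define R where "R = 2 * \<epsilon>"
  have R: "norm (t - t2) \<le> R" if "t \<in> ?B" for t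
  proof -
    have "dist t t2 \<le> dist t1 t + dist t1 t2" using dist_triangle2[of t t2 t1] by (simp add: dist_commute)
    then show ?thesis using that t2 by (simp add: dist_norm R_def)
  qed
  have R0: "R \<ge> 0" using t2 by (simp add: R_def) (smt (verit) zero_le_dist)
  \<comment> \<open>The limit of the iterates as a telescoping series, ready for the M-test on the
    whole ball.\<close>
  define Y where "Y = (\<lambda>i t. y i t2 + suminf (\<lambda>n. YY (Suc n) i t - YY n i t))"
  have lim: "uniform_limit ?B (\<lambda>n t. YY n i t) (Y i) sequentially" if i: "i \<in> I" for i
  proof -
    have "uniform_limit ?B (\<lambda>n t. \<Sum>k<n. YY (Suc k) i t - YY k i t) (\<lambda>t. suminf (\<lambda>n. YY (Suc n) i t - YY n i t)) sequentially"
    proof (rule Weierstrass_m_test)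
      show "summable (\<lambda>n. C * (N * R) ^ Suc n / fact (Suc n))"
        using summable_pfaff_majorant by (subst summable_Suc_iff)
      fix n t assume "t \<in> ?B"
      then show "norm (YY (Suc n) i t - YY n i t) \<le> C * (N * R) ^ Suc n / fact (Suc n)"
        by (intro order_trans[OF step[OF i]] divide_right_mono mult_left_mono power_mono mult_left_mono R C0 N0) (auto simp: N0)
    qed
    moreover have "(\<Sum>k<n. YY (Suc k) i t - YY k i t) = YY n i t - y i t2" for n t
      using sum_lessThan_telescope[of "\<lambda>k. YY k i t" n] by (simp add: Y0)
    ultimately show ?thesis
      by (simp add: uniform_limit_iff Y_def dist_norm algebra_simps)
  qed
  have hol: "holo_on ?B (Y i)" if "i \<in> I" for i
    by (rule holo_uniform_limit[OF open_ball hY[OF that] lim[OF that]])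
  obtain \<rho> where \<rho>: "\<rho> > 0" "\<rho> < \<delta>" "cball t2 \<rho> \<subseteq> ?B"
  proof -
    obtain e where "e > 0" "cball t2 e \<subseteq> ?B" using open_contains_cball[of ?B] t2 by blast
    moreover have "cball t2 (min e (\<delta>/2)) \<subseteq> cball t2 e" by (auto simp: subset_eq)
    ultimately show ?thesis using \<delta> by (intro that[of "min e (\<delta>/2)"]) (auto simp: min_def)
  qed
  let ?W = "ball t2 \<rho>"
  have W\<delta>: "cball t2 \<rho> \<subseteq> ball t2 \<delta>" using \<rho> by auto
  have WB: "?W \<subseteq> ?B" using \<rho> by auto
  have cy: "continuous_on (cball t2 \<rho>) (y i)" if "i \<in> I" for i
    using y[OF that] W\<delta> by (meson continuous_at_imp_continuous_on has_derivative_continuous subsetD)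
  have cyW: "continuous_on ?W (y i)" if "i \<in> I" for i
    using cy[OF that] ball_subset_cball by (rule continuous_on_subset)
  have "\<exists>K. \<forall>t\<in>?W. norm (y i t - y i t2) \<le> K" if "i \<in> I" for i
    using compact_imp_bounded[OF compact_continuous_image[OF continuous_on_diff[OF cy[OF that] continuous_on_const[of _ "y i t2"]] compact_cball]]
    by (simp add: bounded_iff) (meson ball_subset_cball subsetD)
  then obtain Kf where Kf: "\<And>i t. i \<in> I \<Longrightarrow> t \<in> ?W \<Longrightarrow> norm (y i t - y i t2) \<le> Kf i" by metis
  define K where "K = (\<Sum>i\<in>I. \<bar>Kf i\<bar>)"
  have K: "norm (y i t - y i t2) \<le> K" if "i \<in> I" "t \<in> ?W" for i t
  proof -
    have "norm (y i t - y i t2) \<le> \<bar>Kf i\<bar>" using Kf[OF that] by simp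
    also have "\<dots> \<le> K" unfolding K_def by (rule member_le_sum) (use that I in auto)
    finally show ?thesis .
  qed
  \<comment> \<open>Near \<open>t2\<close> the given solution is a fixed point of the iteration: its
    derivative is integrated along the segment.\<close>
  have fix_y: "y i t = y i t2 + ?T y i t" if i: "i \<in> I" and t: "t \<in> ?W" for i t
  proof -
    let ?p = "\<lambda>s. s *\<^sub>R (t - t2) + t2"
    let ?f = "\<lambda>s. \<Sum>l\<in>UNIV. \<Sum>j\<in>I. (t - t2) $ l * A i j l (?p s) * y j (?p s)"
    have "(?f has_integral (y i (?p 1) - y i (?p 0))) {0..1}"
    proof (rule fundamental_theorem_of_calculus)
      fix s :: real assume s: "s \<in> {0..1}"
      have p: "?p s \<in> ball t2 \<delta>" using segment_in_convex[OF convex_ball centre_in_ball[THEN iffD2, OF \<rho>(1)] t s] \<rho>(2) by auto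
      have "(?p has_derivative (\<lambda>h. h *\<^sub>R (t - t2))) (at s within {0..1})"
        by (auto intro!: derivative_eq_intros)
      from has_derivative_compose[OF this y[OF i p]]
      have "((\<lambda>s. y i (?p s)) has_derivative (\<lambda>h. \<Sum>l\<in>UNIV. \<Sum>j\<in>I. (h *\<^sub>R (t - t2)) $ l * A i j l (?p s) * y j (?p s))) (at s within {0..1})" .
      then show "((\<lambda>s. y i (?p s)) has_vector_derivative ?f s) (at s within {0..1})"
        unfolding has_vector_derivative_def by (simp add: scaleR_sum_right)
    qed simp
    then have "integral {0..1} ?f = y i t - y i t2" by (simp add: integral_unique)
    then show ?thesis by (simp add: pfaff_op_def)
  qed
  \<comment> \<open>Being a fixed point, \<open>y\<close> obeys the same recursion as the iterates,
    so near \<open>t2\<close> they converge to it.\<close>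
  have err: "norm (y i t - YY n i t) \<le> K * (N * norm (t - t2)) ^ n / fact n" if "i \<in> I" "t \<in> ?W" for n i t
    using that
  proof (induction n arbitrary: i t)
    case 0
    then show ?case using K by (simp add: Y0)
  next
    case (Suc n)
    have "norm (?T (\<lambda>j t. y j t - YY n j t) i t) \<le> K * (N * norm (t - t2)) ^ Suc n / fact (Suc n)"
      using Suc \<rho>(1) WB by (intro iter[of ?W]) (auto intro!: continuous_on_diff contY cyW)
    moreover have "y i t - YY (Suc n) i t = ?T (\<lambda>j t. y j t - YY n j t) i t"
    proof -
      have "?T (\<lambda>j t. y j t - YY n j t) i t = ?T y i t - ?T (YY n) i t"
        by (rule pfaff_op_diff[of ?W]) (use Suc(2,3) \<rho>(1) WB in \<open>auto intro!: contY contA cyW\<close>)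
      then show ?thesis using fix_y[OF Suc(2,3)] by (simp add: YS[of n])
    qed
    ultimately show ?case by simp
  qed
  have eq: "Y i t = y i t" if i: "i \<in> I" and t: "t \<in> ?W" for i t
  proof -
    have "(\<lambda>n. K * (N * norm (t - t2)) ^ n / fact n) \<longlonglongrightarrow> 0"
      by (rule summable_LIMSEQ_zero[OF summable_pfaff_majorant])
    then have "(\<lambda>n. y i t - YY n i t) \<longlonglongrightarrow> 0"
      by (rule tendsto_0_le[where K=1, OF _ always_eventually]) (use order_trans[OF err[OF that] abs_ge_self] in auto)
    moreover have "(\<lambda>n. y i t - YY n i t) \<longlonglongrightarrow> y i t - Y i t"
      using tendsto_uniform_limitI[OF lim[OF i], of t] t WB by (auto intro!: tendsto_intros)
    ultimately show ?thesis using LIMSEQ_unique by fastforce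
  qed
  have "\<forall>\<^sub>F t in nhds t2. t \<in> ?W" using \<rho>(1) by (intro eventually_nhds_in_open) auto
  then have "\<forall>\<^sub>F t in nhds t2. Y i t = y i t" if "i \<in> I" for i
    by (rule eventually_mono) (use eq that in auto)
  with hol show ?thesis by blast
qed

text \<open>\<open>Adm\<close> is kept abstract since the lemma is used twice: for families alone,
  and for families tied to a prescribed function. The driving hypothesis is that
  \<open>\<epsilon>\<close> depends on the point of the path only and not on the germ to be
  extended; compactness, in the form of bisection of \<open>{0..1}\<close>, does the rest.\<close>

lemma continuation_along_path:
  fixes \<gamma> :: "real \<Rightarrow> 'a::metric_space" and Adm :: "'a set \<Rightarrow> ('a \<Rightarrow> 'b) \<Rightarrow> bool"
  assumes cont: "continuous_on {0..1} \<gamma>"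
    and ext: "\<forall>s\<in>{0..1}. \<exists>\<epsilon>>0. \<forall>t\<in>ball (\<gamma> s) \<epsilon>. \<forall>\<Phi>. (\<exists>\<delta>>0. Adm (ball t \<delta>) \<Phi>) \<longrightarrow>
        (\<exists>\<Psi>. Adm (ball (\<gamma> s) \<epsilon>) \<Psi> \<and> (\<forall>\<^sub>F w in nhds t. \<Psi> w = \<Phi> w))"
    and sub: "\<forall>U V \<Phi>. Adm U \<Phi> \<longrightarrow> V \<subseteq> U \<longrightarrow> Adm V \<Phi>"
    and init: "\<delta>0 > 0" "Adm (ball (\<gamma> 0) \<delta>0) \<Phi>0"
  shows "\<exists>\<Phi> d. (\<forall>s\<in>{0..1}. d s > 0 \<and> Adm (ball (\<gamma> s) (d s)) (\<Phi> s)) \<and>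
    (\<forall>\<^sub>F w in nhds (\<gamma> 0). \<Phi> 0 w = \<Phi>0 w) \<and>
    (\<forall>s\<in>{0..1}. \<exists>e>0. \<forall>s'\<in>{0..1}. \<bar>s' - s\<bar> < e \<longrightarrow>
        \<gamma> s' \<in> ball (\<gamma> s) (d s) \<and> (\<forall>\<^sub>F w in nhds (\<gamma> s'). \<Phi> s' w = \<Phi> s w))"
proof -
  \<comment> \<open>Quantifying over every admissible germ at \<open>a\<close> is what allows
    continuations on adjacent intervals to be concatenated.\<close>
  define P where "P = (\<lambda>a b. 0 \<le> a \<longrightarrow> a \<le> b \<longrightarrow> b \<le> (1::real) \<longrightarrow> (\<forall>\<Phi>0. (\<exists>\<delta>>0. Adm (ball (\<gamma> a) \<delta>) \<Phi>0) \<longrightarrow>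
    (\<exists>\<Phi>. (\<forall>s\<in>{a..b}. \<exists>\<delta>>0. Adm (ball (\<gamma> s) \<delta>) (\<Phi> s)) \<and> (\<forall>\<^sub>F w in nhds (\<gamma> a). \<Phi> a w = \<Phi>0 w) \<and>
      (\<forall>s\<in>{a..b}. \<exists>e>0. \<forall>s'\<in>{a..b}. \<bar>s' - s\<bar> < e \<longrightarrow> (\<forall>\<^sub>F w in nhds (\<gamma> s'). \<Phi> s' w = \<Phi> s w)))))"
  have near: "\<exists>e>0. \<forall>s'\<in>{0..1}. \<bar>s' - s\<bar> < e \<longrightarrow> \<gamma> s' \<in> T" if st: "s \<in> {0..1}" "open T" "\<gamma> s \<in> T" for s T
  proof -
    obtain r where r: "r > 0" "ball (\<gamma> s) r \<subseteq> T" using st(2,3) open_contains_ball by blast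
    obtain e where "e > 0" "\<And>s'. s' \<in> {0..1} \<Longrightarrow> dist s' s < e \<Longrightarrow> dist (\<gamma> s') (\<gamma> s) < r"
      using cont st(1) r(1) unfolding continuous_on_iff by blast
    then show ?thesis using r(2) by (intro exI[of _ e]) (force simp: dist_real_def dist_commute)
  qed
  have "P 0 1"
  proof (rule Bolzano)
    fix a b c assume ab: "P a b" and bc: "P b c" and le: "a \<le> b" "b \<le> c"
    show "P a c"
      unfolding P_def
    proof (intro impI allI)
      fix \<Phi>0 assume ac: "0 \<le> a" "c \<le> 1" and \<Phi>0: "\<exists>\<delta>>0. Adm (ball (\<gamma> a) \<delta>) \<Phi>0"
      have b: "0 \<le> b" "b \<le> 1" using ac le by auto
      obtain \<Phi> where \<Phi>: "\<And>s. s \<in> {a..b} \<Longrightarrow> \<exists>\<delta>>0. Adm (ball (\<gamma> s) \<delta>) (\<Phi> s)" "\<forall>\<^sub>F w in nhds (\<gamma> a). \<Phi> a w = \<Phi>0 w"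
        "\<And>s. s \<in> {a..b} \<Longrightarrow> \<exists>e>0. \<forall>s'\<in>{a..b}. \<bar>s' - s\<bar> < e \<longrightarrow> (\<forall>\<^sub>F w in nhds (\<gamma> s'). \<Phi> s' w = \<Phi> s w)"
        using ab[unfolded P_def, rule_format, OF ac(1) le(1) b(2) \<Phi>0] by blast
      have \<Phi>b: "\<exists>\<delta>>0. Adm (ball (\<gamma> b) \<delta>) (\<Phi> b)" using \<Phi>(1)[of b] le by simp
      obtain \<Psi> where \<Psi>: "\<And>s. s \<in> {b..c} \<Longrightarrow> \<exists>\<delta>>0. Adm (ball (\<gamma> s) \<delta>) (\<Psi> s)" "\<forall>\<^sub>F w in nhds (\<gamma> b). \<Psi> b w = \<Phi> b w"
        "\<And>s. s \<in> {b..c} \<Longrightarrow> \<exists>e>0. \<forall>s'\<in>{b..c}. \<bar>s' - s\<bar> < e \<longrightarrow> (\<forall>\<^sub>F w in nhds (\<gamma> s'). \<Psi> s' w = \<Psi> s w)"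
        using bc[unfolded P_def, rule_format, OF b(1) le(2) ac(2) \<Phi>b] by blast
      define \<Theta> where "\<Theta> = (\<lambda>s. if s \<le> b then \<Phi> s else \<Psi> s)"
      have 1: "\<exists>\<delta>>0. Adm (ball (\<gamma> s) \<delta>) (\<Theta> s)" if "s \<in> {a..c}" for s
        using \<Phi>(1)[of s] \<Psi>(1)[of s] that by (auto simp: \<Theta>_def)
      have 2: "\<forall>\<^sub>F w in nhds (\<gamma> a). \<Theta> a w = \<Phi>0 w" using \<Phi>(2) le by (simp add: \<Theta>_def)
      have 3: "\<exists>e>0. \<forall>s'\<in>{a..c}. \<bar>s' - s\<bar> < e \<longrightarrow> (\<forall>\<^sub>F w in nhds (\<gamma> s'). \<Theta> s' w = \<Theta> s w)" if s: "s \<in> {a..c}" for s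
      proof -
        consider "s < b" | "s > b" | "s = b" by linarith
        then show ?thesis
        proof cases
          case 1
          then obtain e where "e > 0" "\<forall>s'\<in>{a..b}. \<bar>s' - s\<bar> < e \<longrightarrow> (\<forall>\<^sub>F w in nhds (\<gamma> s'). \<Phi> s' w = \<Phi> s w)"
            using \<Phi>(3)[of s] s by auto
          then show ?thesis using 1 by (intro exI[of _ "min e (b - s)"]) (auto simp: \<Theta>_def)
        next
          case 2
          then obtain e where "e > 0" "\<forall>s'\<in>{b..c}. \<bar>s' - s\<bar> < e \<longrightarrow> (\<forall>\<^sub>F w in nhds (\<gamma> s'). \<Psi> s' w = \<Psi> s w)"
            using \<Psi>(3)[of s] s by auto
          then show ?thesis using 2 by (intro exI[of _ "min e (s - b)"]) (auto simp: \<Theta>_def)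
        next
          case 3
          obtain e1 where e1: "e1 > 0" "\<And>s'. s' \<in> {a..b} \<Longrightarrow> \<bar>s' - b\<bar> < e1 \<Longrightarrow> (\<forall>\<^sub>F w in nhds (\<gamma> s'). \<Phi> s' w = \<Phi> b w)"
            using \<Phi>(3)[of b] le by auto
          obtain e2 where e2: "e2 > 0" "\<And>s'. s' \<in> {b..c} \<Longrightarrow> \<bar>s' - b\<bar> < e2 \<Longrightarrow> (\<forall>\<^sub>F w in nhds (\<gamma> s'). \<Psi> s' w = \<Psi> b w)"
            using \<Psi>(3)[of b] le by auto
          \<comment> \<open>The two pieces agree as germs at \<open>\<gamma> b\<close>; to the right
            of \<open>b\<close> one must also be close enough for \<open>\<gamma> s'\<close> to lie
            in the neighbourhood \<open>T\<close> of agreement.\<close>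
          obtain T where T: "open T" "\<gamma> b \<in> T" "\<And>w. w \<in> T \<Longrightarrow> \<Psi> b w = \<Phi> b w"
            using \<Psi>(2) by (auto simp: eventually_nhds)
          obtain e3 where e3: "e3 > 0" "\<And>s'. s' \<in> {0..1} \<Longrightarrow> \<bar>s' - b\<bar> < e3 \<Longrightarrow> \<gamma> s' \<in> T"
            using near[OF _ T(1,2)] ac le by auto
          have "\<forall>\<^sub>F w in nhds (\<gamma> s'). \<Theta> s' w = \<Theta> b w" if s': "s' \<in> {a..c}" "\<bar>s' - b\<bar> < min e1 (min e2 e3)" for s'
          proof (cases "s' \<le> b")
            case True
            then show ?thesis using e1(2)[of s'] s' by (simp add: \<Theta>_def)
          next
            case False
            have "\<gamma> s' \<in> T" using e3(2)[of s'] s' ac by auto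
            then have "\<forall>\<^sub>F w in nhds (\<gamma> s'). w \<in> T" using T(1) by (intro eventually_nhds_in_open)
            moreover have "\<forall>\<^sub>F w in nhds (\<gamma> s'). \<Psi> s' w = \<Psi> b w" using e2(2)[of s'] s' False by auto
            ultimately have "\<forall>\<^sub>F w in nhds (\<gamma> s'). \<Psi> s' w = \<Phi> b w" by eventually_elim (simp add: T(3))
            then show ?thesis using False by (simp add: \<Theta>_def)
          qed
          then show ?thesis using e1(1) e2(1) e3(1) 3 by (intro exI[of _ "min e1 (min e2 e3)"]) auto
        qed
      qed
      show "\<exists>\<Phi>. (\<forall>s\<in>{a..c}. \<exists>\<delta>>0. Adm (ball (\<gamma> s) \<delta>) (\<Phi> s)) \<and> (\<forall>\<^sub>F w in nhds (\<gamma> a). \<Phi> a w = \<Phi>0 w) \<and>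
        (\<forall>s\<in>{a..c}. \<exists>e>0. \<forall>s'\<in>{a..c}. \<bar>s' - s\<bar> < e \<longrightarrow> (\<forall>\<^sub>F w in nhds (\<gamma> s'). \<Phi> s' w = \<Phi> s w))"
        using 1 2 3 by (intro exI[of _ \<Theta>] conjI ballI)
    qed
  next
    fix x :: real assume x: "0 \<le> x" "x \<le> 1"
    then obtain \<epsilon> where \<epsilon>: "\<epsilon> > 0" "\<And>t \<Phi>. t \<in> ball (\<gamma> x) \<epsilon> \<Longrightarrow> \<exists>\<delta>>0. Adm (ball t \<delta>) \<Phi> \<Longrightarrow>
        \<exists>\<Psi>. Adm (ball (\<gamma> x) \<epsilon>) \<Psi> \<and> (\<forall>\<^sub>F w in nhds t. \<Psi> w = \<Phi> w)"
      using bspec[OF ext, of x] by auto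
    obtain d where d: "d > 0" "\<And>s'. s' \<in> {0..1} \<Longrightarrow> \<bar>s' - x\<bar> < d \<Longrightarrow> \<gamma> s' \<in> ball (\<gamma> x) \<epsilon>"
      using near[of x "ball (\<gamma> x) \<epsilon>"] x \<epsilon>(1) by auto
    \<comment> \<open>Over a short interval the path stays in one ball, so a single extension serves
      every parameter.\<close>
    have "P a b" if ab: "a \<le> x" "x \<le> b" "b - a < d" for a b
      unfolding P_def
    proof (intro impI allI)
      fix \<Phi>0 assume *: "0 \<le> a" "b \<le> 1" "\<exists>\<delta>>0. Adm (ball (\<gamma> a) \<delta>) \<Phi>0"
      have in_ball: "\<gamma> s \<in> ball (\<gamma> x) \<epsilon>" if "s \<in> {a..b}" for s
        using that ab * by (intro d(2)) auto
      obtain \<Psi> where \<Psi>: "Adm (ball (\<gamma> x) \<epsilon>) \<Psi>" "\<forall>\<^sub>F w in nhds (\<gamma> a). \<Psi> w = \<Phi>0 w"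
        using \<epsilon>(2)[OF in_ball *(3)] ab by auto
      have "\<exists>\<delta>>0. Adm (ball (\<gamma> s) \<delta>) \<Psi>" if "s \<in> {a..b}" for s
        using in_ball[OF that] open_contains_ball[of "ball (\<gamma> x) \<epsilon>"] sub[rule_format, OF \<Psi>(1)] by (meson open_ball)
      then show "\<exists>\<Phi>. (\<forall>s\<in>{a..b}. \<exists>\<delta>>0. Adm (ball (\<gamma> s) \<delta>) (\<Phi> s)) \<and> (\<forall>\<^sub>F w in nhds (\<gamma> a). \<Phi> a w = \<Phi>0 w) \<and>
        (\<forall>s\<in>{a..b}. \<exists>e>0. \<forall>s'\<in>{a..b}. \<bar>s' - s\<bar> < e \<longrightarrow> (\<forall>\<^sub>F w in nhds (\<gamma> s'). \<Phi> s' w = \<Phi> s w))"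
        using \<Psi>(2) by (intro exI[of _ "\<lambda>s. \<Psi>"]) (auto intro: exI[of _ 1])
    qed
    with d(1) show "\<exists>d>0. \<forall>a b. a \<le> x \<and> x \<le> b \<and> b - a < d \<longrightarrow> P a b" by blast
  qed simp
  have init0: "\<exists>\<delta>>0. Adm (ball (\<gamma> 0) \<delta>) \<Phi>0" using init by blast
  obtain \<Phi> where \<Phi>: "\<forall>s\<in>{0..1}. \<exists>\<delta>>0. Adm (ball (\<gamma> s) \<delta>) (\<Phi> s)" "\<forall>\<^sub>F w in nhds (\<gamma> 0). \<Phi> 0 w = \<Phi>0 w"
      "\<And>s. s \<in> {0..1} \<Longrightarrow> \<exists>e>0. \<forall>s'\<in>{0..1}. \<bar>s' - s\<bar> < e \<longrightarrow> (\<forall>\<^sub>F w in nhds (\<gamma> s'). \<Phi> s' w = \<Phi> s w)"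
    using \<open>P 0 1\<close>[unfolded P_def, rule_format, OF _ _ _ init0] by auto
  from \<Phi>(1) obtain d where d: "\<And>s. s \<in> {0..1} \<Longrightarrow> d s > 0 \<and> Adm (ball (\<gamma> s) (d s)) (\<Phi> s)" by metis
  show ?thesis
  proof (intro exI[of _ \<Phi>] exI[of _ d] conjI ballI \<Phi>(2))
    fix s :: real assume s: "s \<in> {0..1}"
    show "d s > 0" "Adm (ball (\<gamma> s) (d s)) (\<Phi> s)" using d[OF s] by auto
    obtain e1 where e1: "e1 > 0" "\<forall>s'\<in>{0..1}. \<bar>s' - s\<bar> < e1 \<longrightarrow> (\<forall>\<^sub>F w in nhds (\<gamma> s'). \<Phi> s' w = \<Phi> s w)"
      using \<Phi>(3)[OF s] by blast
    obtain e2 where e2: "e2 > 0" "\<forall>s'\<in>{0..1}. \<bar>s' - s\<bar> < e2 \<longrightarrow> \<gamma> s' \<in> ball (\<gamma> s) (d s)"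
      using near[OF s, of "ball (\<gamma> s) (d s)"] d[OF s] by auto
    show "\<exists>e>0. \<forall>s'\<in>{0..1}. \<bar>s' - s\<bar> < e \<longrightarrow> \<gamma> s' \<in> ball (\<gamma> s) (d s) \<and> (\<forall>\<^sub>F w in nhds (\<gamma> s'). \<Phi> s' w = \<Phi> s w)"
      using e1 e2 by (intro exI[of _ "min e1 e2"]) auto
  qed
qed

section \<open>Characters of monoid algebras\<close>

text \<open>Linear extension of a function on exponents to combinations of monomials. For
  multiplicative \<open>\<phi>\<close> it is the corresponding character; for
  \<open>\<phi> k = R (g + k)\<close> it is a functional on a family of diagonals.\<close>

definition lin :: "('k \<Rightarrow> complex) \<Rightarrow> ('k \<Rightarrow>\<^sub>0 complex) \<Rightarrow> complex" where
  "lin \<phi> s = (\<Sum>k\<in>Poly_Mapping.keys s. Poly_Mapping.lookup s k * \<phi> k)"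

lemma lin_eq:
  assumes "finite X" "Poly_Mapping.keys s \<subseteq> X"
  shows "lin \<phi> s = (\<Sum>k\<in>X. Poly_Mapping.lookup s k * \<phi> k)"
  unfolding lin_def by (rule sum.mono_neutral_left) (use assms in \<open>auto simp: in_keys_iff\<close>)

lemma lin_zero [simp]: "lin \<phi> 0 = 0" by (simp add: lin_def)

lemma lin_single [simp]: "lin \<phi> (Poly_Mapping.single k c) = c * \<phi> k"
  by (simp add: lin_def)

lemma lin_one [simp]: "lin \<phi> (1 :: 'k::zero \<Rightarrow>\<^sub>0 complex) = \<phi> 0"
  unfolding single_one[symmetric] lin_single by simp

lemma lin_add: "lin \<phi> (s + t) = lin \<phi> s + lin \<phi> t"
proof -
  let ?X = "Poly_Mapping.keys s \<union> Poly_Mapping.keys t"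
  have "Poly_Mapping.keys (s + t) \<subseteq> ?X" by (rule Poly_Mapping.keys_add)
  then show ?thesis
    by (simp add: lin_eq[of ?X] lookup_add algebra_simps sum.distrib)
qed

lemma lin_minus: "lin \<phi> (s - t) = lin \<phi> s - lin \<phi> t"
  using lin_add[of \<phi> "s - t" t] by simp

lemma poly_mapping_eq_sum_single:
  "s = (\<Sum>k\<in>Poly_Mapping.keys s. Poly_Mapping.single k (Poly_Mapping.lookup s k))"
  by (rule poly_mapping_eqI) (simp add: lookup_sum lookup_single when_def in_keys_iff sum.delta)

lemma poly_mapping_keys_induct:
  assumes "P 0" "\<And>k c. k \<in> Poly_Mapping.keys s \<Longrightarrow> P (Poly_Mapping.single k c)" "\<And>a b. P a \<Longrightarrow> P b \<Longrightarrow> P (a + b)"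
  shows "P (s :: 'k \<Rightarrow>\<^sub>0 'b::comm_monoid_add)"
proof -
  have "P (\<Sum>k\<in>A. Poly_Mapping.single k (Poly_Mapping.lookup s k))" if "A \<subseteq> Poly_Mapping.keys s" for A
    using finite_subset[OF that finite_keys] that by (induction A) (auto intro: assms)
  from this[of "Poly_Mapping.keys s"] show ?thesis by (simp flip: poly_mapping_eq_sum_single)
qed

lemma lin_single_mult: "lin \<phi> (Poly_Mapping.single m c * s) = c * lin (\<lambda>k. \<phi> (m + k)) s"
  by (induction s rule: poly_mapping_keys_induct) (auto simp: mult_single distrib_left lin_add algebra_simps)

text \<open>Countability of the exponents is built into the sort because the residue field argument
  plays the dimension of the algebra against the cardinality of the complex numbers.\<close>

locale monoid_algebra =
  fixes Mon :: "'k::{comm_monoid_add,countable} set"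
  assumes zero_Mon: "0 \<in> Mon" and add_Mon: "a \<in> Mon \<Longrightarrow> b \<in> Mon \<Longrightarrow> a + b \<in> Mon"
begin

definition alg :: "('k \<Rightarrow>\<^sub>0 complex) set" where "alg = {s. Poly_Mapping.keys s \<subseteq> Mon}"

text \<open>Closure under monomial multiples is the form in which concrete ideals are verified; with
  additivity it gives closure under multiplication by all of \<open>alg\<close>.\<close>

definition is_ideal :: "('k \<Rightarrow>\<^sub>0 complex) set \<Rightarrow> bool" where
  "is_ideal J \<longleftrightarrow> J \<subseteq> alg \<and> 0 \<in> J \<and> (\<forall>a\<in>J. \<forall>b\<in>J. a + b \<in> J) \<and>
    (\<forall>m\<in>Mon. \<forall>c. \<forall>a\<in>J. Poly_Mapping.single m c * a \<in> J)"

lemma alg_single [simp]: "m \<in> Mon \<Longrightarrow> Poly_Mapping.single m c \<in> alg"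
  by (simp add: alg_def)

lemma alg_zero [simp]: "0 \<in> alg" by (simp add: alg_def)

lemma alg_add: "a \<in> alg \<Longrightarrow> b \<in> alg \<Longrightarrow> a + b \<in> alg"
  using Poly_Mapping.keys_add[of a b] by (auto simp: alg_def)

lemma alg_mult: "a \<in> alg \<Longrightarrow> b \<in> alg \<Longrightarrow> a * b \<in> alg"
  using Poly_Mapping.keys_mult[of a b] add_Mon by (fastforce simp: alg_def)

lemma alg_one [simp]: "1 \<in> alg"
  using alg_single[OF zero_Mon, of 1] by simp

lemma alg_uminus: "a \<in> alg \<Longrightarrow> - a \<in> alg"
  by (auto simp: alg_def in_keys_iff)

lemma alg_diff: "a \<in> alg \<Longrightarrow> b \<in> alg \<Longrightarrow> a - b \<in> alg"
  using alg_add[OF _ alg_uminus, of a b] by simp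

lemma alg_induct [consumes 1, case_names zero single add]:
  assumes "s \<in> alg" "P 0" "\<And>k c. k \<in> Mon \<Longrightarrow> P (Poly_Mapping.single k c)" "\<And>a b. P a \<Longrightarrow> P b \<Longrightarrow> P (a + b)"
  shows "P s"
  using assms by (intro poly_mapping_keys_induct[of P s]) (auto simp: alg_def)

context
  fixes M assumes M: "is_ideal M"
begin

lemma ideal_zero: "0 \<in> M" and ideal_add: "a \<in> M \<Longrightarrow> b \<in> M \<Longrightarrow> a + b \<in> M"
  and ideal_alg: "a \<in> M \<Longrightarrow> a \<in> alg"
  using M by (auto simp: is_ideal_def)

lemma ideal_mult: "s \<in> alg \<Longrightarrow> a \<in> M \<Longrightarrow> s * a \<in> M"
  by (induction s rule: alg_induct) (use M in \<open>auto simp: is_ideal_def distrib_right\<close>)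

lemma ideal_uminus: "a \<in> M \<Longrightarrow> - a \<in> M"
  using ideal_mult[OF alg_uminus[OF alg_one], of a] by simp

lemma ideal_diff: "a \<in> M \<Longrightarrow> b \<in> M \<Longrightarrow> a - b \<in> M"
  using ideal_add[OF _ ideal_uminus, of a b] by simp

lemma ideal_sum: "(\<And>i. i \<in> I \<Longrightarrow> f i \<in> M) \<Longrightarrow> sum f I \<in> M"
  by (induction I rule: infinite_finite_induct) (auto intro: ideal_add ideal_zero)

end

text \<open>Zorn's lemma. Maximality is delivered in the form used later, as invertibility modulo
  \<open>M\<close> of every element outside \<open>M\<close>.\<close>

lemma exists_maximal_ideal:
  assumes "is_ideal J" "1 \<notin> J"
  obtains M where "is_ideal M" "J \<subseteq> M" "1 \<notin> M" "\<And>s. s \<in> alg \<Longrightarrow> s \<notin> M \<Longrightarrow> \<exists>y\<in>alg. s * y - 1 \<in> M"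
proof -
  let ?A = "{I. is_ideal I \<and> J \<subseteq> I \<and> 1 \<notin> I}"
  have "\<exists>M\<in>?A. \<forall>X\<in>?A. M \<subseteq> X \<longrightarrow> X = M"
  proof (rule subset_Zorn_nonempty)
    show "?A \<noteq> {}" using assms by blast
    fix C assume C: "C \<noteq> {}" "subset.chain ?A C"
    have id: "is_ideal I" "J \<subseteq> I" "1 \<notin> I" if "I \<in> C" for I using C that by (auto simp: subset.chain_def)
    have ch: "I \<subseteq> I' \<or> I' \<subseteq> I" if "I \<in> C" "I' \<in> C" for I I' using C that by (auto simp: subset.chain_def)
    have "a + b \<in> \<Union>C" if ab: "a \<in> \<Union>C" "b \<in> \<Union>C" for a b
    proof -
      obtain I I' where "a \<in> I" "I \<in> C" "b \<in> I'" "I' \<in> C" using ab by auto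
      then obtain K where "K \<in> C" "a \<in> K" "b \<in> K" using ch by blast
      then show ?thesis using ideal_add[OF id(1)] by blast
    qed
    moreover have "\<Union>C \<subseteq> alg" "0 \<in> \<Union>C" using ideal_alg[OF id(1)] ideal_zero[OF id(1)] C(1) by blast+
    moreover have "Poly_Mapping.single m c * a \<in> \<Union>C" if "m \<in> Mon" "a \<in> \<Union>C" for m c a
      using ideal_mult[OF id(1) alg_single[OF that(1)]] that(2) by blast
    ultimately have "is_ideal (\<Union>C)" unfolding is_ideal_def by simp
    then show "\<Union>C \<in> ?A" using id C(1) by blast
  qed
  then obtain M where M: "is_ideal M" "J \<subseteq> M" "1 \<notin> M"
    and max: "\<And>X. is_ideal X \<Longrightarrow> J \<subseteq> X \<Longrightarrow> 1 \<notin> X \<Longrightarrow> M \<subseteq> X \<Longrightarrow> X = M" by auto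
  show thesis
  proof (rule that[OF M])
    fix s assume s: "s \<in> alg" "s \<notin> M"
    \<comment> \<open>The ideal generated by \<open>M\<close> and \<open>s\<close>, which contains 1
      by maximality.\<close>
    define X where "X = {\<mu> + s * y | \<mu> y. \<mu> \<in> M \<and> y \<in> alg}"
    have "is_ideal X"
      unfolding is_ideal_def
    proof (intro conjI ballI allI)
      show "X \<subseteq> alg" using ideal_alg[OF M(1)] s by (auto simp: X_def intro!: alg_add alg_mult)
      show "0 \<in> X" unfolding X_def using ideal_zero[OF M(1)] alg_zero by (auto intro!: exI[of _ 0])
    next
      fix a b assume "a \<in> X" "b \<in> X"
      then obtain \<mu> y \<nu> z where e: "a = \<mu> + s * y" "b = \<nu> + s * z" "\<mu> \<in> M" "\<nu> \<in> M" "y \<in> alg" "z \<in> alg"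
        by (auto simp: X_def)
      have "a + b = (\<mu> + \<nu>) + s * (y + z)" by (simp add: e algebra_simps)
      then show "a + b \<in> X" using e ideal_add[OF M(1)] alg_add unfolding X_def by blast
    next
      fix m c a assume m: "m \<in> Mon" and "a \<in> X"
      then obtain \<mu> y where e: "a = \<mu> + s * y" "\<mu> \<in> M" "y \<in> alg" by (auto simp: X_def)
      have "Poly_Mapping.single m c * a = Poly_Mapping.single m c * \<mu> + s * (Poly_Mapping.single m c * y)"
        by (simp add: e algebra_simps)
      then show "Poly_Mapping.single m c * a \<in> X"
        using e ideal_mult[OF M(1) alg_single[OF m]] alg_mult[OF alg_single[OF m]] unfolding X_def by blast
    qed
    moreover have "M \<subseteq> X"
    proof
      fix a assume "a \<in> M"
      then have "a + s * 0 \<in> X" unfolding X_def using alg_zero by blast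
      then show "a \<in> X" by simp
    qed
    moreover have "s \<in> X"
    proof -
      have "0 + s * 1 \<in> X" unfolding X_def using alg_one ideal_zero[OF M(1)] by blast
      then show ?thesis by simp
    qed
    ultimately have "1 \<in> X" using max[of X] M(2) s(2) by blast
    then obtain \<mu> y where e: "1 = \<mu> + s * y" "\<mu> \<in> M" "y \<in> alg" by (auto simp: X_def)
    have "s * y - 1 = - \<mu>" by (subst e(1)) simp
    then show "\<exists>y\<in>alg. s * y - 1 \<in> M" using ideal_uminus[OF M(1) e(2)] e(3) by (intro bexI[of _ y]) simp_all
  qed
qed

end

text \<open>Gaussian elimination on the coordinates: the pivot \<open>c0\<close> clears coordinate
  \<open>k\<close>, and its own coefficient is chosen at the end. The vectors form an indexed
  family, so equal vectors count separately.\<close>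

lemma linear_dependence:
  fixes v :: "'c \<Rightarrow> 'k \<Rightarrow> complex"
  assumes "finite X" "finite C" "card X < card C"
  shows "\<exists>l. (\<exists>c\<in>C. l c \<noteq> 0) \<and> (\<forall>k\<in>X. (\<Sum>c\<in>C. l c * v c k) = 0)"
  using assms
proof (induction X arbitrary: C v rule: finite_induct)
  case empty
  then have "C \<noteq> {}" by auto
  then show ?case by (intro exI[of _ "\<lambda>_. 1"]) auto
next
  case (insert k X)
  show ?case
  proof (cases "\<forall>c\<in>C. v c k = 0")
    case True
    have "\<exists>l. (\<exists>c\<in>C. l c \<noteq> 0) \<and> (\<forall>k\<in>X. (\<Sum>c\<in>C. l c * v c k) = 0)"
      by (rule insert.IH) (use insert in auto)
    then obtain l where "\<exists>c\<in>C. l c \<noteq> 0" "\<forall>k\<in>X. (\<Sum>c\<in>C. l c * v c k) = 0" by blast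
    with True show ?thesis by (intro exI[of _ l]) auto
  next
    case False
    then obtain c0 where c0: "c0 \<in> C" "v c0 k \<noteq> 0" by auto
    let ?C = "C - {c0}"
    have "\<exists>l. (\<exists>c\<in>?C. l c \<noteq> 0) \<and> (\<forall>j\<in>X. (\<Sum>c\<in>?C. l c * (v c j - v c k / v c0 k * v c0 j)) = 0)"
      by (rule insert.IH) (use insert c0 in auto)
    then obtain l where l: "\<exists>c\<in>?C. l c \<noteq> 0" "\<And>j. j \<in> X \<Longrightarrow> (\<Sum>c\<in>?C. l c * (v c j - v c k / v c0 k * v c0 j)) = 0"
      by blast
    define S where "S = (\<Sum>c\<in>?C. l c * v c k) / v c0 k"
    define l' where "l' = (\<lambda>c. if c = c0 then - S else l c)"
    have sum: "(\<Sum>c\<in>C. l' c * v c j) = (\<Sum>c\<in>?C. l c * v c j) - S * v c0 j" for j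
    proof -
      have "(\<Sum>c\<in>C. l' c * v c j) = l' c0 * v c0 j + (\<Sum>c\<in>?C. l' c * v c j)"
        using insert.prems c0 by (simp add: sum.remove)
      also have "(\<Sum>c\<in>?C. l' c * v c j) = (\<Sum>c\<in>?C. l c * v c j)"
        by (rule sum.cong) (auto simp: l'_def)
      finally show ?thesis by (simp add: l'_def)
    qed
    have "(\<Sum>c\<in>C. l' c * v c j) = 0" if "j \<in> insert k X" for j
    proof (cases "j = k")
      case True
      then show ?thesis using c0 by (simp add: sum S_def)
    next
      case False
      have "0 = (\<Sum>c\<in>?C. l c * (v c j - v c k / v c0 k * v c0 j))" using l(2)[of j] False that by simp
      also have "\<dots> = (\<Sum>c\<in>?C. l c * v c j) - (\<Sum>c\<in>?C. l c * (v c k / v c0 k * v c0 j))"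
        by (simp add: right_diff_distrib sum_subtractf)
      also have "(\<Sum>c\<in>?C. l c * (v c k / v c0 k * v c0 j)) = S * v c0 j"
        unfolding S_def sum_divide_distrib sum_distrib_right by (rule sum.cong) simp_all
      finally show ?thesis by (simp add: sum)
    qed
    moreover have "\<exists>c\<in>C. l' c \<noteq> 0" using l(1) by (auto simp: l'_def)
    ultimately show ?thesis by blast
  qed
qed

context monoid_algebra
begin

abbreviation cst :: "complex \<Rightarrow> 'k \<Rightarrow>\<^sub>0 complex" where "cst \<equiv> Poly_Mapping.single 0"

definition ev :: "('k \<Rightarrow>\<^sub>0 complex) \<Rightarrow> complex poly \<Rightarrow> 'k \<Rightarrow>\<^sub>0 complex" where
  "ev x p = poly (map_poly cst p) x"

lemma ev_0 [simp]: "ev x 0 = 0" by (simp add: ev_def)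

lemma ev_pCons [simp]: "ev x (pCons a p) = cst a + x * ev x p"
  by (simp add: ev_def map_poly_pCons)

lemma ev_add: "ev x (p + q) = ev x p + ev x q"
  by (induction p q rule: poly_induct2) (simp_all add: single_add algebra_simps)

lemma ev_smult: "ev x (Polynomial.smult c p) = cst c * ev x p"
  by (induction p) (simp_all add: mult_single algebra_simps)

lemma ev_linear_mult: "ev x ([:- c, 1:] * p) = (x - cst c) * ev x p"
proof -
  have "[:- c, 1:] * p = Polynomial.smult (- c) p + pCons 0 p" by simp
  then show ?thesis by (simp only: ev_add ev_smult ev_pCons) (simp add: single_uminus algebra_simps)
qed

lemma ev_prod_linear: "ev x (\<Prod>c\<in>D. [:- c, 1:]) = (\<Prod>c\<in>D. x - cst c)"
proof (induction D rule: infinite_finite_induct)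
  case (insert c D)
  then show ?case by (simp only: prod.insert ev_linear_mult simp_thms not_False_eq_True)
qed (simp_all add: one_pCons)

lemma ev_sum: "ev x (\<Sum>i\<in>I. p i) = (\<Sum>i\<in>I. ev x (p i))"
  by (induction I rule: infinite_finite_induct) (auto simp: ev_add)

lemma ev_alg: "x \<in> alg \<Longrightarrow> ev x p \<in> alg"
  by (induction p) (auto intro!: alg_add alg_mult simp: zero_Mon)

lemma alg_prod: "(\<And>i. i \<in> I \<Longrightarrow> f i \<in> alg) \<Longrightarrow> prod f I \<in> alg"
  by (induction I rule: infinite_finite_induct) (auto intro: alg_mult)

text \<open>As the algebra has countable dimension, inverses of \<open>x - c\<close> for uncountably many \<open>c\<close>
  would be linearly dependent, which makes \<open>x\<close> algebraic modulo the maximal ideal.\<close>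

lemma maximal_ideal_residue:
  assumes M: "is_ideal M" "1 \<notin> M" and inv: "\<And>s. s \<in> alg \<Longrightarrow> s \<notin> M \<Longrightarrow> \<exists>y\<in>alg. s * y - 1 \<in> M"
    and x: "x \<in> alg"
  shows "\<exists>c. x - cst c \<in> M"
proof (rule ccontr)
  assume nex: "\<nexists>c. x - cst c \<in> M"
  have xc: "x - cst c \<in> alg" for c by (intro alg_diff x alg_single zero_Mon)
  have "\<exists>y\<in>alg. (x - cst c) * y - 1 \<in> M" for c using inv[OF xc] nex by blast
  then obtain y where y: "\<And>c. y c \<in> alg" "\<And>c. (x - cst c) * y c - 1 \<in> M" by metis
  \<comment> \<open>A polynomial in \<open>x\<close> lying in \<open>M\<close> can be lowered in
    degree: a complex root \<open>r\<close> splits off the factor \<open>x - cst r\<close>, which is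
    invertible modulo \<open>M\<close>.\<close>
  have no_root: "ev x p \<notin> M" if "p \<noteq> 0" for p
    using that
  proof (induction "degree p" arbitrary: p rule: less_induct)
    case less
    show ?case
    proof
      assume p: "ev x p \<in> M"
      show False
      proof (cases "degree p = 0")
        case True
        then obtain a where a: "p = [:a:]" by (auto elim: degree_eq_zeroE)
        then have "a \<noteq> 0" using less.prems by simp
        have "cst (1/a) * ev x p \<in> M" by (rule ideal_mult[OF M(1) alg_single[OF zero_Mon] p])
        also have "cst (1/a) * ev x p = 1" using \<open>a \<noteq> 0\<close> by (simp add: a mult_single)
        finally show False using M(2) by simp
      next
        case False
        then have "\<not> constant (poly p)" by (simp add: constant_degree)
        then obtain r where "poly p r = 0" using fundamental_theorem_of_algebra by blast
        then obtain q where q: "p = [:- r, 1:] * q" by (auto simp: poly_eq_0_iff_dvd elim: dvdE)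
        have q0: "q \<noteq> 0" using less.prems q by auto
        have "degree q < degree p" unfolding q using q0 by (subst degree_mult_eq) auto
        then have nq: "ev x q \<notin> M" using less.hyps q0 by blast
        have "y r * ((x - cst r) * ev x q) \<in> M"
          using p unfolding q ev_linear_mult by (rule ideal_mult[OF M(1) y(1)])
        moreover have "ev x q * ((x - cst r) * y r - 1) \<in> M"
          by (rule ideal_mult[OF M(1) ev_alg[OF x] y(2)])
        ultimately have "y r * ((x - cst r) * ev x q) - ev x q * ((x - cst r) * y r - 1) \<in> M"
          by (rule ideal_diff[OF M(1)])
        then show False using nq by (simp add: algebra_simps)
      qed
    qed
  qed
  \<comment> \<open>There are uncountably many constants but only countably many finite supports, so
    infinitely many of the inverses \<open>y c\<close> share one support and live in a
    finite-dimensional space.\<close>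
  have "\<exists>X. finite X \<and> infinite {c. Poly_Mapping.keys (y c) = X}"
  proof (rule ccontr)
    assume "\<not> ?thesis"
    then have "countable {c. Poly_Mapping.keys (y c) = X}" if "finite X" for X
      using that by (auto intro: countable_finite)
    then have "countable (\<Union>X\<in>Collect finite. {c. Poly_Mapping.keys (y c) = X})"
      by (intro countable_UN countable_Collect_finite) auto
    moreover have "(\<Union>X\<in>Collect finite. {c. Poly_Mapping.keys (y c) = X}) = UNIV" by auto
    ultimately have "countable (UNIV :: complex set)" by simp
    then have "countable (range complex_of_real)" by (rule countable_subset[rotated]) auto
    then have "countable (UNIV :: real set)" by (rule countable_image_inj_on) (auto intro: inj_onI)
    then show False using uncountable_UNIV_real by simp
  qed
  then obtain X where X: "finite X" "infinite {c. Poly_Mapping.keys (y c) = X}" by blast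
  obtain C where C: "finite C" "card C = Suc (card X)" "C \<subseteq> {c. Poly_Mapping.keys (y c) = X}"
    using infinite_arbitrarily_large[OF X(2)] by blast
  obtain l where l: "\<exists>c\<in>C. l c \<noteq> 0" "\<And>k. k \<in> X \<Longrightarrow> (\<Sum>c\<in>C. l c * Poly_Mapping.lookup (y c) k) = 0"
    using linear_dependence[OF X(1) C(1), of "\<lambda>c. Poly_Mapping.lookup (y c)"] C(2) by auto
  have dep: "(\<Sum>c\<in>C. cst (l c) * y c) = 0"
  proof (rule poly_mapping_eqI)
    fix k
    have "Poly_Mapping.lookup (cst (l c) * y c) k = l c * Poly_Mapping.lookup (y c) k" for c
      unfolding mult_map_scale_conv_mult[symmetric] by (simp add: Poly_Mapping.map.rep_eq when_def)
    moreover have "(\<Sum>c\<in>C. l c * Poly_Mapping.lookup (y c) k) = 0"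
    proof (cases "k \<in> X")
      case False
      then have "Poly_Mapping.lookup (y c) k = 0" if "c \<in> C" for c
        using C(3) that by (auto simp: in_keys_iff)
      then show ?thesis by simp
    qed (rule l(2))
    ultimately show "Poly_Mapping.lookup (\<Sum>c\<in>C. cst (l c) * y c) k = Poly_Mapping.lookup 0 k"
      by (simp add: lookup_sum)
  qed
  \<comment> \<open>The numerator of \<open>\<Sum>c\<in>C. l c / (x - c)\<close> over the common
    denominator. It is not the zero polynomial, since at \<open>c0\<close> only the summand of
    \<open>c0\<close> survives.\<close>
  define p where "p = (\<Sum>c\<in>C. Polynomial.smult (l c) (\<Prod>c'\<in>C - {c}. [:- c', 1:]))"
  obtain c0 where c0: "c0 \<in> C" "l c0 \<noteq> 0" using l(1) by blast
  have "poly p c0 = (\<Sum>c\<in>C. l c * (\<Prod>c'\<in>C - {c}. c0 - c'))"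
    by (simp add: p_def poly_sum poly_prod)
  also have "\<dots> = (\<Sum>c\<in>C. if c = c0 then l c0 * (\<Prod>c'\<in>C - {c0}. c0 - c') else 0)"
    by (rule sum.cong) (use C(1) c0(1) in auto)
  also have "\<dots> = l c0 * (\<Prod>c'\<in>C - {c0}. c0 - c')" using C(1) c0(1) by simp
  also have "\<dots> \<noteq> 0" using c0 C(1) by auto
  finally have "p \<noteq> 0" by auto
  let ?E = "\<Prod>c\<in>C. x - cst c"
  have "(\<Sum>c\<in>C. - (cst (l c) * (\<Prod>c'\<in>C - {c}. x - cst c')) * ((x - cst c) * y c - 1)) \<in> M"
    by (intro ideal_sum[OF M(1)] ideal_mult[OF M(1)] y alg_uminus alg_mult alg_prod xc alg_single zero_Mon)
  also have "(\<Sum>c\<in>C. - (cst (l c) * (\<Prod>c'\<in>C - {c}. x - cst c')) * ((x - cst c) * y c - 1))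
      = (\<Sum>c\<in>C. cst (l c) * (\<Prod>c'\<in>C - {c}. x - cst c') - (cst (l c) * y c) * ?E)"
  proof (rule sum.cong)
    fix c assume "c \<in> C"
    with C(1) have E: "?E = (x - cst c) * (\<Prod>c'\<in>C - {c}. x - cst c')" by (rule prod.remove)
    have gen: "- (a * R) * (d * y - 1) = a * R - (a * y) * (d * R)" for a R d y :: "'k \<Rightarrow>\<^sub>0 complex"
      by (simp add: algebra_simps)
    show "- (cst (l c) * (\<Prod>c'\<in>C - {c}. x - cst c')) * ((x - cst c) * y c - 1) =
        cst (l c) * (\<Prod>c'\<in>C - {c}. x - cst c') - (cst (l c) * y c) * ?E"
      unfolding E by (rule gen)
  qed simp
  also have "\<dots> = (\<Sum>c\<in>C. cst (l c) * (\<Prod>c'\<in>C - {c}. x - cst c')) - (\<Sum>c\<in>C. cst (l c) * y c) * ?E"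
    by (simp add: sum_subtractf sum_distrib_right)
  also have "\<dots> = ev x p" by (simp only: dep p_def ev_sum ev_smult ev_prod_linear mult_zero_left diff_zero)
  finally show False using no_root[OF \<open>p \<noteq> 0\<close>] by simp
qed

text \<open>Modulo a maximal ideal every element is congruent to a constant, and the constants
  belonging to the monomials form the character: the weak Nullstellensatz for algebras of countable
  dimension.\<close>

lemma character_exists:
  assumes J: "is_ideal J" "1 \<notin> J"
  obtains \<phi> where "\<phi> 0 = 1" "\<And>a b. a \<in> Mon \<Longrightarrow> b \<in> Mon \<Longrightarrow> \<phi> (a + b) = \<phi> a * \<phi> b" "\<And>s. s \<in> J \<Longrightarrow> lin \<phi> s = 0"
proof -
  obtain M where M: "is_ideal M" "J \<subseteq> M" "1 \<notin> M" "\<And>s. s \<in> alg \<Longrightarrow> s \<notin> M \<Longrightarrow> \<exists>y\<in>alg. s * y - 1 \<in> M"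
    using exists_maximal_ideal[OF J] by metis
  have cst_M: "c = 0" if "cst c \<in> M" for c
  proof (rule ccontr)
    assume "c \<noteq> 0"
    have "cst (1/c) * cst c \<in> M" by (rule ideal_mult[OF M(1) alg_single[OF zero_Mon] that])
    then show False using \<open>c \<noteq> 0\<close> M(3) by (simp add: mult_single)
  qed
  have "\<exists>c. m \<in> Mon \<longrightarrow> Poly_Mapping.single m 1 - cst c \<in> M" for m
    using maximal_ideal_residue[OF M(1,3,4), of "Poly_Mapping.single m 1"] by auto
  then obtain \<phi> where \<phi>: "\<And>m. m \<in> Mon \<Longrightarrow> Poly_Mapping.single m 1 - cst (\<phi> m) \<in> M" by metis
  have uniq: "c = d" if "s - cst c \<in> M" "s - cst d \<in> M" for s c d
  proof -
    have "(s - cst d) - (s - cst c) \<in> M" by (rule ideal_diff[OF M(1) that(2,1)])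
    then have "cst (c - d) \<in> M" by (simp add: single_diff)
    then show ?thesis using cst_M by fastforce
  qed
  have red: "s - cst (lin \<phi> s) \<in> M" if "s \<in> alg" for s
    using that
  proof (induction s rule: alg_induct)
    case (single k c)
    have "cst c * (Poly_Mapping.single k 1 - cst (\<phi> k)) \<in> M"
      by (rule ideal_mult[OF M(1) alg_single[OF zero_Mon] \<phi>[OF single]])
    then show ?case by (simp add: right_diff_distrib mult_single)
  next
    case (add a b)
    from ideal_add[OF M(1) this] show ?case by (simp add: lin_add single_add algebra_simps)
  qed (simp add: ideal_zero[OF M(1)])
  show thesis
  proof (rule that)
    show "\<phi> 0 = 1"
      by (rule uniq[OF \<phi>[OF zero_Mon]]) (simp add: ideal_zero[OF M(1)])
  next
    fix a b assume ab: "a \<in> Mon" "b \<in> Mon"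
    have "Poly_Mapping.single a 1 * (Poly_Mapping.single b 1 - cst (\<phi> b)) + cst (\<phi> b) * (Poly_Mapping.single a 1 - cst (\<phi> a)) \<in> M"
      by (intro ideal_add[OF M(1)] ideal_mult[OF M(1)] \<phi> ab alg_single zero_Mon)
    then have "Poly_Mapping.single (a + b) 1 - cst (\<phi> a * \<phi> b) \<in> M"
      by (simp add: right_diff_distrib mult_single mult_ac)
    from uniq[OF \<phi>[OF add_Mon[OF ab]] this] show "\<phi> (a + b) = \<phi> a * \<phi> b" .
  next
    fix s assume s: "s \<in> J"
    then have "s \<in> alg" "s \<in> M" using J M(2) by (auto simp: is_ideal_def)
    from ideal_diff[OF M(1) this(2) red[OF this(1)]] have "cst (lin \<phi> s) \<in> M" by simp
    then show "lin \<phi> s = 0" by (rule cst_M)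
  qed
qed

end

text \<open>Extending a character from the subgroup \<open>G\<close> generated by the support of \<open>\<phi>\<close> is again an instance of
  the previous result, applied to the ideal of all elements annihilated by the translates of \<open>\<phi>\<close>
  extended by \<open>0\<close> outside of \<open>G\<close>.\<close>

lemma character_extension:
  fixes Mon :: "'k::{ab_group_add,countable} set"
  assumes "monoid_algebra Mon" and \<phi>: "\<phi> 0 = 1" "\<And>a b. a \<in> Mon \<Longrightarrow> b \<in> Mon \<Longrightarrow> \<phi> (a + b) = \<phi> a * \<phi> b"
  obtains X :: "'k \<Rightarrow> complex" where "X 0 = 1" "\<And>a b. X (a + b) = X a * X b" "\<And>m. m \<in> Mon \<Longrightarrow> \<phi> m \<noteq> 0 \<Longrightarrow> X m = \<phi> m"
proof -
  interpret monoid_algebra Mon by fact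
  interpret U: monoid_algebra "UNIV :: 'k set" by unfold_locales auto
  define N where "N = {m \<in> Mon. \<phi> m \<noteq> 0}"
  have N0: "0 \<in> N" using zero_Mon \<phi>(1) by (simp add: N_def)
  have N_add: "a + b \<in> N" "\<phi> (a + b) = \<phi> a * \<phi> b" "\<phi> a \<noteq> 0" if "a \<in> N" "b \<in> N" for a b
    using that add_Mon \<phi>(2) by (auto simp: N_def)
  define G where "G = {a - b | a b. a \<in> N \<and> b \<in> N}"
  have GI: "a - b \<in> G" if "a \<in> N" "b \<in> N" for a b using that unfolding G_def by blast
  have "\<exists>z. \<forall>a b. a \<in> N \<and> b \<in> N \<and> g = a - b \<longrightarrow> z = \<phi> a / \<phi> b" for g
  proof (cases "g \<in> G")
    case True
    then obtain a0 b0 where g: "g = a0 - b0" "a0 \<in> N" "b0 \<in> N" by (auto simp: G_def)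
    have "\<phi> a0 / \<phi> b0 = \<phi> a / \<phi> b" if "a \<in> N" "b \<in> N" "g = a - b" for a b
    proof -
      have "a0 + b = a + b0" using g that by (simp add: algebra_simps)
      then have eq: "\<phi> a0 * \<phi> b = \<phi> a * \<phi> b0"
        using N_add(2)[OF g(2) that(2)] N_add(2)[OF that(1) g(3)] by simp
      have "\<phi> b0 \<noteq> 0" "\<phi> b \<noteq> 0" using g that by (auto simp: N_def)
      then show ?thesis using eq by (simp add: frac_eq_eq)
    qed
    then show ?thesis by blast
  qed (use GI in blast)
  then obtain Z where Z: "\<And>a b. a \<in> N \<Longrightarrow> b \<in> N \<Longrightarrow> Z (a - b) = \<phi> a / \<phi> b" by metis
  define Y where "Y = (\<lambda>g. if g \<in> G then Z g else 0)"
  have G_add: "g + h \<in> G" "Z (g + h) = Z g * Z h" if "g \<in> G" "h \<in> G" for g h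
  proof -
    obtain a b a' b' where e: "g = a - b" "h = a' - b'" "a \<in> N" "b \<in> N" "a' \<in> N" "b' \<in> N"
      using \<open>g \<in> G\<close> \<open>h \<in> G\<close> unfolding G_def by blast
    have gh: "g + h = (a + a') - (b + b')" by (simp add: e algebra_simps)
    have n: "a + a' \<in> N" "b + b' \<in> N" using e N_add(1) by auto
    show "g + h \<in> G" unfolding gh by (rule GI[OF n])
    show "Z (g + h) = Z g * Z h"
      unfolding gh Z[OF n] unfolding e(1,2) Z[OF e(3,4)] Z[OF e(5,6)] N_add(2)[OF e(3,5)] N_add(2)[OF e(4,6)] by simp
  qed
  have G_minus: "- g \<in> G" if g: "g \<in> G" for g
  proof -
    obtain a b where "g = a - b" "a \<in> N" "b \<in> N" using g unfolding G_def by blast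
    then show ?thesis using GI[of b a] by simp
  qed
  have Y_add: "Y (g + m) = Y g * Y m" if "g \<in> G" for g m
  proof -
    have "m \<in> G" if "g + m \<in> G" using G_add(1)[OF G_minus[OF \<open>g \<in> G\<close>] that] by simp
    then show ?thesis using G_add[OF that, of m] that by (auto simp: Y_def)
  qed
  have G0: "0 \<in> G" using GI[OF N0 N0] by simp
  have Y0: "Y 0 = 1" using Z[OF N0 N0] \<phi>(1) G0 by (simp add: Y_def)
  have NG: "m \<in> G" "Y m = \<phi> m" if "m \<in> N" for m
    using GI[OF that N0] Z[OF that N0] \<phi>(1) by (simp_all add: Y_def)
  define J where "J = {s. \<forall>m. lin (\<lambda>k. Y (k + m)) s = 0}"
  have "U.is_ideal J"
    unfolding U.is_ideal_def
  proof (intro conjI ballI allI)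
    fix m c a assume a: "a \<in> J"
    have "lin (\<lambda>k. Y (k + m')) (Poly_Mapping.single m c * a) = c * lin (\<lambda>k. Y (k + (m + m'))) a" for m'
      by (simp add: lin_single_mult add_ac)
    then show "Poly_Mapping.single m c * a \<in> J" using a by (simp add: J_def)
  qed (auto simp: J_def lin_add U.alg_def)
  moreover have "1 \<notin> J" using Y0 by (auto simp: J_def intro: exI[of _ 0])
  ultimately obtain X where X: "X 0 = 1" "\<And>a b. X (a + b) = X a * X b" "\<And>s. s \<in> J \<Longrightarrow> lin X s = 0"
    by (rule U.character_exists) auto
  show thesis
  proof (rule that[OF X(1,2)])
    fix m assume "m \<in> Mon" "\<phi> m \<noteq> 0"
    then have m: "m \<in> N" by (simp add: N_def)
    \<comment> \<open>Translation by \<open>m\<close> multiplies \<open>Y\<close> by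
      \<open>\<phi> m\<close> on and off \<open>G\<close> alike, so this difference annihilates all
      translates.\<close>
    have "Poly_Mapping.single m 1 - Poly_Mapping.single 0 (\<phi> m) \<in> J"
      using Y_add[OF NG(1)[OF m]] NG(2)[OF m] by (simp add: J_def lin_minus)
    from X(3)[OF this] show "X m = \<phi> m" using X(1) by (simp add: lin_minus)
  qed
qed

section \<open>Integer vectors and Laurent monomials\<close>

definition idot :: "int^'n::finite \<Rightarrow> int^'n \<Rightarrow> int" where
  "idot u v = (\<Sum>i\<in>UNIV. u$i * v$i)"

lemma idot_commute: "idot u v = idot v u"
  by (simp add: idot_def mult.commute)

lemma idot_sum_left: "idot (\<Sum>k\<in>K. c k *s u k) v = (\<Sum>k\<in>K. c k * idot (u k) v)"
proof -
  have "idot (\<Sum>k\<in>K. c k *s u k) v = (\<Sum>i\<in>UNIV. \<Sum>k\<in>K. c k * (u k $ i * v $ i))"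
    by (simp add: idot_def sum_distrib_right mult.assoc)
  also have "\<dots> = (\<Sum>k\<in>K. c k * idot (u k) v)"
    by (subst sum.swap) (simp add: idot_def sum_distrib_left)
  finally show ?thesis .
qed

lemma inner_int_to_real: "int_to_real u \<bullet> int_to_real v = of_int (idot u v)"
  by (simp add: inner_vec_def int_to_real_def idot_def)

lemma inj_int_to_real: "inj int_to_real"
  by (rule injI) (simp add: int_to_real_def vec_eq_iff)

lemma det_Ints:
  fixes A :: "real^'r^'r::finite"
  assumes "\<And>i j. A$i$j \<in> \<int>" shows "det A \<in> \<int>"
  unfolding det_def by (intro Ints_sum Ints_mult Ints_prod assms) auto

text \<open>The Gram matrix of independent vectors is invertible, and Cramer's rule finds dual
  vectors inside the span of \<open>q\<close>. The Gram determinant is the common denominator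
  \<open>D\<close>; multiplying by it keeps the vectors integral.\<close>

lemma dual_vectors_exist:
  fixes q :: "'r::finite \<Rightarrow> int^'n::finite"
  assumes "\<And>x::real^'r. (\<Sum>j\<in>UNIV. (x$j) *\<^sub>R int_to_real (q j)) = 0 \<Longrightarrow> x = 0"
  obtains w D where "D \<noteq> 0" "\<And>l k. idot (w l) (q k) = (if l = k then D else 0)"
proof -
  define G :: "real^'r^'r" where "G = (\<chi> k l. of_int (idot (q k) (q l)))"
  have ker: "x = 0" if x: "G *v x = 0" for x
  proof (rule assms)
    let ?y = "\<Sum>j\<in>UNIV. (x$j) *\<^sub>R int_to_real (q j)"
    have "?y \<bullet> ?y = (\<Sum>k\<in>UNIV. x$k * (\<Sum>l\<in>UNIV. x$l * of_int (idot (q l) (q k))))"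
      by (simp add: inner_sum_left inner_sum_right inner_int_to_real)
    also have "\<dots> = (\<Sum>k\<in>UNIV. x$k * (G *v x)$k)"
      by (simp add: matrix_vector_mult_def G_def mult.commute idot_commute)
    finally show "?y = 0" using x by simp
  qed
  then have "invertible G"
    using matrix_left_invertible_ker[of G] by (simp add: invertible_left_inverse)
  then have det: "det G \<noteq> 0" by (simp add: invertible_det_nz)
  have GZ: "G$i$j \<in> \<int>" for i j by (simp add: G_def)
  \<comment> \<open>Numerators of Cramer's rule for the \<open>l\<close>-th unit vector; all entries
    are integers, hence so is each determinant.\<close>
  define y where "y = (\<lambda>l k. det (\<chi> i j. if j = k then axis l (1::real) $ i else G$i$j))"
  have yZ: "y l k \<in> \<int>" for l k
    unfolding y_def by (rule det_Ints) (auto simp: axis_def GZ)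
  have "\<exists>z. y l k = of_int z" for l k using Ints_cases[OF yZ] by metis
  then obtain Y where Y: "\<And>l k. y l k = of_int (Y l k)" by metis
  obtain D where D: "det G = of_int D" using det_Ints[OF GZ] by (auto elim: Ints_cases)
  define w where "w = (\<lambda>l. \<Sum>k\<in>UNIV. Y l k *s q k)"
  have "idot (w l) (q k) = (if l = k then D else 0)" for l k
  proof -
    have "G *v (\<chi> k. y l k / det G) = axis l 1"
      using cramer[OF det, of "\<chi> k. y l k / det G" "axis l 1"] by (simp add: y_def)
    then have "(G *v (\<chi> k. y l k / det G)) $ k = axis l 1 $ k" by simp
    then have "(\<Sum>j\<in>UNIV. of_int (idot (q k) (q j)) * y l j / det G) = axis l 1 $ k"
      by (simp add: matrix_vector_mult_def G_def)
    then have "(\<Sum>j\<in>UNIV. of_int (idot (q k) (q j)) * y l j) = det G * axis l 1 $ k"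
      using det by (simp add: sum_divide_distrib[symmetric] field_simps)
    then have "of_int (\<Sum>j\<in>UNIV. idot (q k) (q j) * Y l j) = (of_int (if l = k then D else 0) :: real)"
      by (simp add: Y D axis_def split: if_splits)
    then have "(\<Sum>j\<in>UNIV. idot (q k) (q j) * Y l j) = (if l = k then D else 0)"
      by (simp only: of_int_eq_iff)
    moreover have "idot (w l) (q k) = (\<Sum>j\<in>UNIV. idot (q k) (q j) * Y l j)"
      unfolding w_def idot_sum_left by (rule sum.cong) (simp_all add: idot_def mult_ac)
    ultimately show ?thesis by simp
  qed
  moreover have "D \<noteq> 0" using det D by auto
  ultimately show thesis using that by blast
qed

lemma lmono_add: "z \<in> torus \<Longrightarrow> lmono z (a + b) = lmono z a * lmono z b"
  by (simp add: lmono_def torus_def power_int_add prod.distrib)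

lemma lmono_axis: "lmono z (axis i 1) = z $ i"
proof -
  have "lmono z (axis i 1) = (\<Prod>j\<in>UNIV. if j = i then z $ i else 1)"
    unfolding lmono_def by (rule prod.cong) (auto simp: axis_def)
  then show ?thesis by simp
qed

lemma leval_eq:
  assumes "finite X" "lsupp h \<subseteq> X" shows "leval h z = (\<Sum>a\<in>X. h a * lmono z a)"
  unfolding leval_def by (rule sum.mono_neutral_left) (use assms in \<open>auto simp: lsupp_def\<close>)

text \<open>A logarithmic derivation multiplies each monomial by an entry of its exponent. Exponents
  \<open>a\<close> with \<open>a $ i = 0\<close> drop out of the support of the derivative, so
  supports are compared by inclusion only.\<close>

lemma leval_lpderiv:
  assumes "finite (lsupp h)" "z \<in> torus"
  shows "z $ i * leval (lpderiv i h) z = (\<Sum>a\<in>lsupp h. h a * of_int (a $ i) * lmono z a)"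
proof -
  let ?X = "(\<lambda>a. a - axis i 1) ` lsupp h"
  have "lsupp (lpderiv i h) \<subseteq> ?X"
  proof
    fix b assume "b \<in> lsupp (lpderiv i h)"
    then have "b + axis i 1 \<in> lsupp h" by (auto simp: lsupp_def lpderiv_def)
    then show "b \<in> ?X" by (intro image_eqI[of _ _ "b + axis i 1"]) auto
  qed
  then have "leval (lpderiv i h) z = (\<Sum>b\<in>?X. lpderiv i h b * lmono z b)"
    using assms(1) by (intro leval_eq) auto
  also have "\<dots> = (\<Sum>a\<in>lsupp h. lpderiv i h (a - axis i 1) * lmono z (a - axis i 1))"
    by (subst sum.reindex) (auto intro!: inj_onI)
  also have "z $ i * \<dots> = (\<Sum>a\<in>lsupp h. h a * of_int (a $ i) * lmono z a)"
    unfolding sum_distrib_left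
  proof (rule sum.cong)
    fix a
    have "lmono z a = lmono z (a - axis i 1) * z $ i"
      using lmono_add[OF assms(2), of "a - axis i 1" "axis i 1"] by (simp add: lmono_axis)
    then show "z $ i * (lpderiv i h (a - axis i 1) * lmono z (a - axis i 1)) = h a * of_int (a $ i) * lmono z a"
      by (simp add: lpderiv_def)
  qed simp
  finally show ?thesis .
qed

text \<open>A homomorphism from the lattice to the nonzero numbers is determined by its values at
  the unit vectors, and these are the coordinates of a torus point.\<close>

lemma character_eq_lmono:
  fixes X :: "int^'n::finite \<Rightarrow> complex"
  assumes X: "X 0 = 1" "\<And>a b. X (a + b) = X a * X b"
  defines "p \<equiv> \<chi> i. X (axis i 1)"
  shows "p \<in> torus" "lmono p \<alpha> = X \<alpha>"
proof -
  have inv: "X a * X (- a) = 1" for a using X(2)[of a "-a"] X(1) by simp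
  then have nz: "X a \<noteq> 0" for a by (metis mult_zero_left zero_neq_one)
  then show p: "p \<in> torus" by (simp add: torus_def p_def)
  have pow: "X (k *s a) = X a powi k" for k a
  proof (induction k rule: int_induct[where k=0])
    case (step1 i)
    have "X ((i + 1) *s a) = X (i *s a) * X a"
      by (simp add: vector_sadd_rdistrib X(2))
    then show ?case using step1 nz by (simp add: power_int_add)
  next
    case (step2 i)
    have "X (i *s a) = X ((i - 1) *s a) * X a"
      unfolding X(2)[symmetric] by (rule arg_cong[where f=X]) (simp add: vec_eq_iff algebra_simps)
    then show ?case using step2 nz by (simp add: power_int_diff field_simps)
  qed (simp add: X)
  have sum: "X (\<Sum>i\<in>A. g i) = (\<Prod>i\<in>A. X (g i))" if "finite A" for A :: "'n set" and g
    using that by (induction A) (auto simp: X)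
  have "\<alpha> = (\<Sum>i\<in>UNIV. (\<alpha> $ i) *s axis i 1)"
    by (simp add: vec_eq_iff axis_def if_distrib cong: if_cong)
  then have "X \<alpha> = X (\<Sum>i\<in>UNIV. (\<alpha> $ i) *s axis i 1)" by (rule arg_cong)
  also have "\<dots> = (\<Prod>i\<in>UNIV. X ((\<alpha> $ i) *s axis i 1))" by (rule sum[OF finite])
  finally have "X \<alpha> = (\<Prod>i\<in>UNIV. X ((\<alpha> $ i) *s axis i 1))" .
  then show "lmono p \<alpha> = X \<alpha>" by (simp add: lmono_def p_def pow)
qed

text \<open>The vectors \<open>w l / D\<close> are dual to \<open>q\<close>: in logarithmic
  coordinates, moving along \<open>w l\<close> changes the \<open>l\<close>-th coordinate of
  \<open>t\<close> alone. Integrality of \<open>w l\<close> costs the denominator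
  \<open>D\<close>.\<close>

locale diagonal =
  fixes f :: "'n::finite lpoly" and q :: "'r::finite \<Rightarrow> int^'n" and w :: "'r \<Rightarrow> int^'n" and D :: int
  assumes finite_supp: "finite (lsupp f)" and D_nonzero: "D \<noteq> 0"
    and dual: "idot (w l) (q k) = (if l = k then D else 0)"
begin

text \<open>The vectors \<open>orth i\<close> span the orthogonal complement of the lattice generated by \<open>q\<close>.\<close>

definition orth :: "'n \<Rightarrow> int^'n" where
  "orth i = D *s axis i 1 - (\<Sum>l\<in>UNIV. (q l $ i) *s w l)"

lemma idot_orth: "idot (orth i) m = D * m $ i - (\<Sum>l\<in>UNIV. q l $ i * idot (w l) m)"
proof -
  have "idot (orth i) m = idot (D *s axis i 1) m - idot (\<Sum>l\<in>UNIV. (q l $ i) *s w l) m"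
    by (simp add: orth_def idot_def left_diff_distrib sum_subtractf)
  moreover have "idot (D *s axis i 1) m = D * m $ i"
  proof -
    have "idot (D *s axis i 1) m = (\<Sum>j\<in>UNIV. if j = i then D * m $ i else 0)"
      unfolding idot_def by (rule sum.cong) (auto simp: axis_def)
    then show ?thesis by simp
  qed
  ultimately show ?thesis by (simp add: idot_sum_left)
qed

lemma idot_orth_q [simp]: "idot (orth i) (q k) = 0"
  by (simp add: idot_orth dual if_distrib mult.commute cong: if_cong)

text \<open>Generators are adjoined one at a time, so that closure of an ideal under
  \<open>Mon b\<close> can be checked generator by generator. Negatives are adjoined for the
  \<open>q j\<close> but not for the \<open>a - b\<close>, which is why a character may vanish at
  some \<open>a - b\<close>.\<close>

inductive_set Mon :: "int^'n \<Rightarrow> (int^'n) set" for b where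
  zero: "0 \<in> Mon b"
| supp: "m \<in> Mon b \<Longrightarrow> a \<in> lsupp f \<Longrightarrow> m + (a - b) \<in> Mon b"
| plus: "m \<in> Mon b \<Longrightarrow> m + q j \<in> Mon b"
| minus: "m \<in> Mon b \<Longrightarrow> m - q j \<in> Mon b"

lemma Mon_add: "m \<in> Mon b \<Longrightarrow> m' \<in> Mon b \<Longrightarrow> m' + m \<in> Mon b"
proof (induction rule: Mon.induct)
  case (supp m a)
  then show ?case using Mon.supp[of "m' + m" b a] by (simp add: add.assoc)
next
  case (plus m j)
  then show ?case using Mon.plus[of "m' + m" b j] by (simp add: add.assoc)
next
  case (minus m j)
  then show ?case using Mon.minus[of "m' + m" b j] by (simp add: add_diff_eq)
qed simp

lemma monoid_algebra_Mon: "monoid_algebra (Mon b)"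
  by unfold_locales (auto intro: Mon.zero Mon_add)

lemma Mon_gen: "a \<in> lsupp f \<Longrightarrow> a - b \<in> Mon b" "q j \<in> Mon b" "- q j \<in> Mon b"
  using Mon.supp[OF Mon.zero, of a b] Mon.plus[OF Mon.zero, of j b] Mon.minus[OF Mon.zero, of j b] by auto

section \<open>The support of a character spans a face of the Newton polyhedron\<close>

context
  fixes b :: "int^'n" and \<phi> :: "int^'n \<Rightarrow> complex" and t1 :: "complex^'r"
  assumes b: "b \<in> lsupp f" and ch: "\<phi> 0 = 1" "\<And>m m'. m \<in> Mon b \<Longrightarrow> m' \<in> Mon b \<Longrightarrow> \<phi> (m + m') = \<phi> m * \<phi> m'"
begin

definition charsupp :: "(int^'n) set" where "charsupp = {a \<in> lsupp f. \<phi> (a - b) \<noteq> 0}"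

lemma character_sum:
  assumes "finite X" "X \<subseteq> lsupp f"
  shows "(\<Sum>a\<in>X. int (c a) *s (a - b)) \<in> Mon b \<and> \<phi> (\<Sum>a\<in>X. int (c a) *s (a - b)) = (\<Prod>a\<in>X. \<phi> (a - b) ^ c a)"
proof -
  have mult: "int n *s (a - b) \<in> Mon b \<and> \<phi> (int n *s (a - b)) = \<phi> (a - b) ^ n" if "a \<in> lsupp f" for a n
  proof (induction n)
    case (Suc n)
    have eq: "int (Suc n) *s (a - b) = int n *s (a - b) + (a - b)" by (simp add: vec_eq_iff algebra_simps)
    have n: "int n *s (a - b) \<in> Mon b" using Suc by blast
    show ?case
      unfolding eq using Mon_add[OF Mon_gen(1)[OF that] n] ch(2)[OF n Mon_gen(1)[OF that]] Suc
      by (simp del: vector_ssub_ldistrib)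
  qed (simp add: ch Mon.zero)
  show ?thesis using assms
  proof (induction X)
    case (insert a X)
    then show ?case using mult[of a "c a"] ch(2) Mon_add by auto
  qed (simp add: ch Mon.zero)
qed

text \<open>The positive and the negative part of the relation are two expressions for one element
  of \<open>Mon b\<close>. If \<open>p a > 0\<close> and \<open>\<phi> (a - b) = 0\<close>, then
  \<open>\<phi>\<close> vanishes on the positive side, hence at a factor of the negative side, where
  \<open>p\<close> would be negative outside \<open>charsupp\<close>.\<close>

lemma charsupp_integer_relation:
  assumes "(\<Sum>a\<in>lsupp f. p a) = 0" "(\<Sum>a\<in>lsupp f. p a *s a) = 0" "\<And>a. a \<in> lsupp f \<Longrightarrow> a \<notin> charsupp \<Longrightarrow> p a \<ge> 0"
    and a: "a \<in> lsupp f" "a \<notin> charsupp"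
  shows "p a = 0"
proof (rule ccontr)
  assume "p a \<noteq> 0"
  with assms(3)[OF a] have pa: "p a > 0" by simp
  let ?P = "\<Sum>a\<in>lsupp f. int (nat (p a)) *s (a - b)" and ?N = "\<Sum>a\<in>lsupp f. int (nat (- p a)) *s (a - b)"
  have "?P - ?N = (\<Sum>a\<in>lsupp f. p a *s (a - b))"
    unfolding sum_subtractf[symmetric]
  proof (rule sum.cong)
    fix x
    have "int (nat (p x)) - int (nat (- p x)) = p x" by simp
    then show "int (nat (p x)) *s (x - b) - int (nat (- p x)) *s (x - b) = p x *s (x - b)"
      by (metis vector_ssub_ldistrib vector_sub_rdistrib)
  qed simp
  also have "\<dots> = (\<Sum>a\<in>lsupp f. p a *s a) - (\<Sum>a\<in>lsupp f. p a) *s b"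
    by (simp add: vec_eq_iff sum_subtractf right_diff_distrib sum_distrib_right)
  finally have "?P = ?N" using assms(1,2) by simp
  then have eq: "(\<Prod>a\<in>lsupp f. \<phi> (a - b) ^ nat (p a)) = (\<Prod>a\<in>lsupp f. \<phi> (a - b) ^ nat (- p a))"
    using character_sum[OF finite_supp order_refl, of "\<lambda>a. nat (p a)"]
      character_sum[OF finite_supp order_refl, of "\<lambda>a. nat (- p a)"] by simp
  have "\<phi> (a - b) ^ nat (p a) = 0" using a pa by (simp add: charsupp_def)
  then have "(\<Prod>a\<in>lsupp f. \<phi> (a - b) ^ nat (p a)) = 0" using a finite_supp by auto
  then obtain x where "x \<in> lsupp f" "\<phi> (x - b) ^ nat (- p x) = 0" unfolding eq using finite_supp by auto
  then have "x \<in> lsupp f" "x \<notin> charsupp" "p x < 0" by (auto simp: charsupp_def zero_power_eq split: if_splits)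
  with assms(3) show False by force
qed

text \<open>Simultaneous Diophantine approximation turns a real affine relation between the exponents into an
  integral one with the required signs.\<close>

lemma charsupp_real_relation:
  assumes "(\<Sum>a\<in>lsupp f. \<mu> a) = 0" "(\<Sum>a\<in>lsupp f. \<mu> a *\<^sub>R int_to_real a) = 0"
    and nn: "\<And>a. a \<in> lsupp f \<Longrightarrow> a \<notin> charsupp \<Longrightarrow> \<mu> a \<ge> 0"
    and a: "a \<in> lsupp f" "a \<notin> charsupp"
  shows "\<mu> a = 0"
proof (rule ccontr)
  assume "\<mu> a \<noteq> 0"
  with nn[OF a] have \<mu>a: "\<mu> a > 0" by simp
  let ?A = "lsupp f"
  \<comment> \<open>\<open>B\<close> dominates the functionals tested below, the constant 1 and the
    coordinates of the exponents. With \<open>N > B\<close> the rounding errors add up to less than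
    1, and with \<open>N > 1 / \<mu> a\<close> the value at \<open>a\<close> is too large to be
    rounded to 0.\<close>
  define B where "B = 1 + real (card ?A) + (\<Sum>a\<in>?A. \<Sum>i\<in>UNIV. \<bar>real_of_int (a $ i)\<bar>)"
  obtain N where N: "max B (1 / \<mu> a) < real N" using reals_Archimedean2 by blast
  have B1: "B \<ge> 1" unfolding B_def by (simp add: add_increasing2 sum_nonneg)
  have N0: "N > 0" by (rule gr0I) (use N B1 in auto)
  obtain h where h: "bij_betw h {..<card ?A} ?A"
    using ex_bij_betw_nat_finite[OF finite_supp] by (auto simp: atLeast0LessThan)
  obtain Q p0 where Q: "0 < Q" "\<And>i. i < card ?A \<Longrightarrow> \<bar>of_int Q * \<mu> (h i) - of_int (p0 i)\<bar> < 1 / N"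
    using Dirichlet_approx_simult[OF N0, of "card ?A" "\<lambda>i. \<mu> (h i)"] by metis
  define p where "p = (\<lambda>a. p0 (the_inv_into {..<card ?A} h a))"
  have p: "\<bar>of_int Q * \<mu> x - of_int (p x)\<bar> < 1 / N" if "x \<in> ?A" for x
  proof -
    have "the_inv_into {..<card ?A} h x \<in> {..<card ?A}" "h (the_inv_into {..<card ?A} h x) = x"
      using h that by (auto simp: bij_betw_def f_the_inv_into_f intro: the_inv_into_into[THEN subsetD[rotated]] dest: the_inv_into_into)
    then show ?thesis using Q(2)[of "the_inv_into {..<card ?A} h x"] by (simp add: p_def)
  qed
  \<comment> \<open>A relation satisfied by \<open>\<mu>\<close> passes to its rounding
    \<open>p\<close>, because the resulting integer has absolute value less than 1.\<close>
  have small: "(\<Sum>x\<in>?A. p x * g x) = 0" if g: "(\<Sum>x\<in>?A. \<mu> x * of_int (g x)) = 0" "(\<Sum>x\<in>?A. \<bar>real_of_int (g x)\<bar>) < real N" for g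
  proof -
    have "\<bar>real_of_int (\<Sum>x\<in>?A. p x * g x)\<bar> = \<bar>(\<Sum>x\<in>?A. of_int (p x) * of_int (g x)) - of_int Q * (\<Sum>x\<in>?A. \<mu> x * of_int (g x))\<bar>"
      using g(1) by simp
    also have "\<dots> = \<bar>\<Sum>x\<in>?A. (of_int (p x) - of_int Q * \<mu> x) * of_int (g x)\<bar>"
      by (simp add: left_diff_distrib sum_subtractf sum_distrib_left mult.assoc)
    also have "\<dots> \<le> (\<Sum>x\<in>?A. 1 / N * \<bar>real_of_int (g x)\<bar>)"
    proof (rule order_trans[OF sum_abs sum_mono])
      fix x assume "x \<in> ?A"
      from p[OF this] show "\<bar>(of_int (p x) - of_int Q * \<mu> x) * of_int (g x)\<bar> \<le> 1 / N * \<bar>real_of_int (g x)\<bar>"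
        unfolding abs_mult by (intro mult_right_mono) (auto simp: abs_minus_commute)
    qed
    also have "\<dots> < 1" using g(2) N0 by (simp add: sum_divide_distrib[symmetric])
    finally show ?thesis by linarith
  qed
  have "(\<Sum>x\<in>?A. p x * 1) = 0"
  proof (rule small)
    have "real (card ?A) < B" unfolding B_def by (simp add: add_strict_increasing sum_nonneg add_pos_nonneg)
    then show "(\<Sum>x\<in>?A. \<bar>real_of_int 1\<bar>) < real N" using N by simp
  qed (use assms(1) in simp)
  moreover have "(\<Sum>x\<in>?A. p x * x $ i) = 0" for i
  proof (rule small)
    have "(\<Sum>x\<in>?A. \<mu> x *\<^sub>R int_to_real x) $ i = 0" using assms(2) by simp
    then show "(\<Sum>x\<in>?A. \<mu> x * real_of_int (x $ i)) = 0" by (simp add: int_to_real_def)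
    have "(\<Sum>x\<in>?A. \<bar>real_of_int (x $ i)\<bar>) \<le> (\<Sum>a\<in>?A. \<Sum>i\<in>UNIV. \<bar>real_of_int (a $ i)\<bar>)"
      by (intro sum_mono member_le_sum) auto
    also have "\<dots> < B" by (simp add: B_def add_strict_increasing add_pos_nonneg)
    finally show "(\<Sum>x\<in>?A. \<bar>real_of_int (x $ i)\<bar>) < real N" using N by simp
  qed
  then have "(\<Sum>x\<in>?A. p x *s x) = 0" by (simp add: vec_eq_iff)
  moreover have "p x \<ge> 0" if "x \<in> ?A" "x \<notin> charsupp" for x
  proof -
    have "of_int Q * \<mu> x \<ge> 0" using Q(1) nn[OF that] by simp
    moreover have "1 / real N \<le> 1" using N0 by simp
    ultimately have "real_of_int (p x) > -1" using p[OF that(1)] by linarith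
    then show ?thesis by linarith
  qed
  ultimately have "p a = 0" by - (rule charsupp_integer_relation[where p=p, OF _ _ _ a], simp_all)
  moreover have "of_int Q * \<mu> a \<ge> 1 * \<mu> a" using Q(1) \<mu>a by (intro mult_right_mono) auto
  moreover have "1 / real N < \<mu> a" using N N0 \<mu>a by (simp add: field_simps)
  ultimately show False using p[OF a(1)] by simp
qed

lemma convex_hull_int_to_real:
  assumes "finite X"
  shows "x \<in> convex hull (int_to_real ` X) \<longleftrightarrow>
    (\<exists>u. (\<forall>a\<in>X. 0 \<le> u a) \<and> sum u X = 1 \<and> (\<Sum>a\<in>X. u a *\<^sub>R int_to_real a) = x)" (is "?L \<longleftrightarrow> ?R")
proof
  have inj: "inj_on int_to_real X" using inj_int_to_real by (rule inj_on_subset) auto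
  show "?L \<Longrightarrow> ?R"
  proof -
    assume ?L
    then obtain u where "\<forall>x\<in>int_to_real ` X. 0 \<le> u x" "sum u (int_to_real ` X) = 1" "(\<Sum>x\<in>int_to_real ` X. u x *\<^sub>R x) = x"
      using assms by (auto simp: convex_hull_finite)
    then show ?R by (intro exI[of _ "u \<circ> int_to_real"]) (simp add: sum.reindex[OF inj])
  qed
  assume ?R
  then obtain u where u: "\<forall>a\<in>X. 0 \<le> u a" "sum u X = 1" "(\<Sum>a\<in>X. u a *\<^sub>R int_to_real a) = x" by blast
  have "(\<Sum>a\<in>X. u a *\<^sub>R int_to_real a) \<in> convex hull (int_to_real ` X)"
    by (rule convex_sum) (use u assms in \<open>auto intro: hull_inc\<close>)
  with u show ?L by simp
qed

text \<open>Subtracting a representation of \<open>x\<close> by \<open>charsupp\<close> from the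
  given one leaves an affine relation whose coefficients outside \<open>charsupp\<close> are those
  of \<open>u\<close>, hence nonnegative.\<close>

lemma charsupp_coefficients:
  assumes "x \<in> convex hull (int_to_real ` charsupp)"
    and u: "sum u (lsupp f) = 1" "(\<Sum>a\<in>lsupp f. u a *\<^sub>R int_to_real a) = x" "\<And>a. a \<in> lsupp f \<Longrightarrow> u a \<ge> 0"
    and a: "a \<in> lsupp f" "a \<notin> charsupp"
  shows "u a = 0"
proof -
  have fin: "finite charsupp" "charsupp \<subseteq> lsupp f" using finite_supp by (auto simp: charsupp_def)
  obtain s where s: "sum s charsupp = 1" "(\<Sum>a\<in>charsupp. s a *\<^sub>R int_to_real a) = x"
    using assms(1) fin by (auto simp: convex_hull_int_to_real)
  define s' where "s' = (\<lambda>a. if a \<in> charsupp then s a else 0)"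
  have s': "sum s' (lsupp f) = 1" "(\<Sum>a\<in>lsupp f. s' a *\<^sub>R int_to_real a) = x"
  proof -
    have "sum s' (lsupp f) = sum s' charsupp"
      by (rule sum.mono_neutral_right) (use fin finite_supp in \<open>auto simp: s'_def\<close>)
    also have "\<dots> = 1" unfolding s(1)[symmetric] by (rule sum.cong) (auto simp: s'_def)
    finally show "sum s' (lsupp f) = 1" .
    have "(\<Sum>a\<in>lsupp f. s' a *\<^sub>R int_to_real a) = (\<Sum>a\<in>charsupp. s' a *\<^sub>R int_to_real a)"
      by (rule sum.mono_neutral_right) (use fin finite_supp in \<open>auto simp: s'_def\<close>)
    also have "\<dots> = x" unfolding s(2)[symmetric] by (rule sum.cong) (auto simp: s'_def)
    finally show "(\<Sum>a\<in>lsupp f. s' a *\<^sub>R int_to_real a) = x" .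
  qed
  have "u a - s' a = 0"
    by (rule charsupp_real_relation[where \<mu>="\<lambda>a. u a - s' a"])
       (use u s' a in \<open>auto simp: sum_subtractf scaleR_left_diff_distrib s'_def\<close>)
  then show ?thesis using a by (simp add: s'_def)
qed

text \<open>If a point of the hull lies strictly between \<open>y\<close> and \<open>z\<close>,
  mixing their weights represents it too. The mixed weights vanish outside \<open>charsupp\<close>,
  and being nonnegative those of \<open>y\<close> and \<open>z\<close> vanish separately.\<close>

lemma charsupp_hull_face: "convex hull (int_to_real ` charsupp) \<in> faces f"
proof -
  let ?T = "convex hull (int_to_real ` charsupp)"
  have fin: "finite charsupp" "charsupp \<subseteq> lsupp f" using finite_supp by (auto simp: charsupp_def)
  have "b \<in> charsupp" using b ch(1) by (simp add: charsupp_def)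
  then have ne: "?T \<noteq> {}" by auto
  have in_T: "y \<in> ?T" if "sum u (lsupp f) = 1" "(\<Sum>a\<in>lsupp f. u a *\<^sub>R int_to_real a) = y" "\<And>a. a \<in> lsupp f \<Longrightarrow> u a \<ge> 0"
    "\<And>a. a \<in> lsupp f \<Longrightarrow> a \<notin> charsupp \<Longrightarrow> u a = 0" for u y
  proof -
    have "sum u charsupp = 1" unfolding that(1)[symmetric]
      by (rule sum.mono_neutral_left) (use fin finite_supp that(4) in auto)
    moreover have "(\<Sum>a\<in>charsupp. u a *\<^sub>R int_to_real a) = y" unfolding that(2)[symmetric]
      by (rule sum.mono_neutral_left) (use fin finite_supp that(4) in auto)
    ultimately show ?thesis using fin that(3) by (auto simp: convex_hull_int_to_real)
  qed
  have "?T face_of newton f"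
    unfolding face_of_def newton_def
  proof (intro conjI ballI impI)
    show "?T \<subseteq> convex hull int_to_real ` lsupp f" using fin by (intro hull_mono image_mono)
    fix y z x assume yz: "y \<in> convex hull int_to_real ` lsupp f" "z \<in> convex hull int_to_real ` lsupp f"
      and x: "x \<in> ?T" "x \<in> open_segment y z"
    obtain u where u: "\<And>a. a \<in> lsupp f \<Longrightarrow> 0 \<le> u a" "sum u (lsupp f) = 1" "(\<Sum>a\<in>lsupp f. u a *\<^sub>R int_to_real a) = y"
      using yz(1) finite_supp by (auto simp: convex_hull_int_to_real)
    obtain v where v: "\<And>a. a \<in> lsupp f \<Longrightarrow> 0 \<le> v a" "sum v (lsupp f) = 1" "(\<Sum>a\<in>lsupp f. v a *\<^sub>R int_to_real a) = z"
      using yz(2) finite_supp by (auto simp: convex_hull_int_to_real)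
    obtain \<theta> where \<theta>: "0 < \<theta>" "\<theta> < 1" "x = (1 - \<theta>) *\<^sub>R y + \<theta> *\<^sub>R z" using x(2) by (auto simp: in_segment)
    have "u a = 0 \<and> v a = 0" if a: "a \<in> lsupp f" "a \<notin> charsupp" for a
    proof -
      have "(1 - \<theta>) * u a + \<theta> * v a = 0"
      proof (rule charsupp_coefficients[OF x(1) _ _ _ a])
        show "(\<Sum>a\<in>lsupp f. (1 - \<theta>) * u a + \<theta> * v a) = 1"
          using u(2) v(2) by (simp add: sum.distrib sum_distrib_left[symmetric])
        show "(\<Sum>a\<in>lsupp f. ((1 - \<theta>) * u a + \<theta> * v a) *\<^sub>R int_to_real a) = x"
          unfolding \<theta>(3) u(3)[symmetric] v(3)[symmetric]
          by (simp add: scaleR_left_distrib sum.distrib scaleR_sum_right)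
      qed (use u v \<theta> in auto)
      moreover have "(1 - \<theta>) * u a \<ge> 0" "\<theta> * v a \<ge> 0" using u(1) v(1) a \<theta> by auto
      ultimately show ?thesis using \<theta> by (simp add: add_nonneg_eq_0_iff)
    qed
    then show "y \<in> ?T" "z \<in> ?T" using in_T[OF u(2,3,1)] in_T[OF v(2,3,1)] by auto
  qed (rule convex_convex_hull)
  then show ?thesis using ne by (simp add: faces_def)
qed

text \<open>Passing to the hull adds no exponents of \<open>f\<close>:
  \<open>charsupp_coefficients\<close>, applied to the weight concentrated at one exponent of the
  hull, places that exponent in \<open>charsupp\<close>.\<close>

lemma trunc_charsupp:
  "trunc f (convex hull (int_to_real ` charsupp)) = (\<lambda>a. if a \<in> charsupp then f a else 0)"
proof
  fix a
  let ?T = "convex hull (int_to_real ` charsupp)"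
  have "f a = 0" if "int_to_real a \<in> ?T" "a \<notin> charsupp"
  proof (rule ccontr)
    assume "f a \<noteq> 0"
    then have a: "a \<in> lsupp f" by (simp add: lsupp_def)
    have "(if a = a then 1 else 0 :: real) = 0"
      by (rule charsupp_coefficients[OF that(1) _ _ _ a that(2), where u="\<lambda>x. if x = a then 1 else 0"])
         (use a finite_supp in \<open>auto simp: if_distribR if_distrib[of "\<lambda>x. x *\<^sub>R _"] cong: if_cong\<close>)
    then show False by simp
  qed
  then show "trunc f ?T a = (if a \<in> charsupp then f a else 0)"
    by (auto simp: trunc_def hull_inc)
qed

text \<open>Extended to the whole lattice, the character is evaluation at a torus point
  \<open>p\<close>, and the factor \<open>X b\<close> turns \<open>a - b\<close> into
  \<open>a\<close>. The hypotheses then say that the truncation and its logarithmic derivatives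
  along all \<open>orth i\<close> vanish at \<open>p\<close>.\<close>

lemma character_point_in_Lset:
  assumes f0: "(\<Sum>a\<in>lsupp f. f a * \<phi> (a - b)) = 0"
    and th: "\<And>i. (\<Sum>a\<in>lsupp f. f a * of_int (idot (orth i) a) * \<phi> (a - b)) = 0"
    and t: "\<And>j. \<phi> (q j) = t1 $ j"
  shows "t1 \<in> Lset f q"
proof -
  obtain X where X: "X 0 = 1" "\<And>a b. X (a + b) = X a * X b" "\<And>m. m \<in> Mon b \<Longrightarrow> \<phi> m \<noteq> 0 \<Longrightarrow> X m = \<phi> m"
    using character_extension[OF monoid_algebra_Mon ch] by metis
  define p where "p = (\<chi> i. X (axis i 1))"
  have p: "p \<in> torus" "\<And>\<alpha>. lmono p \<alpha> = X \<alpha>"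
    using character_eq_lmono[OF X(1,2)] by (auto simp: p_def)
  let ?h = "trunc f (convex hull (int_to_real ` charsupp))"
  have supp: "lsupp ?h = charsupp" unfolding trunc_charsupp by (auto simp: lsupp_def charsupp_def)
  have fin: "finite charsupp" using finite_supp by (simp add: charsupp_def)
  have sum_eq: "(\<Sum>a\<in>charsupp. f a * g a * X a) = X b * (\<Sum>a\<in>lsupp f. f a * g a * \<phi> (a - b))" for g
  proof -
    have "(\<Sum>a\<in>lsupp f. f a * g a * \<phi> (a - b)) = (\<Sum>a\<in>charsupp. f a * g a * \<phi> (a - b))"
      by (rule sum.mono_neutral_right) (use finite_supp in \<open>auto simp: charsupp_def\<close>)
    moreover have "X b * \<phi> (a - b) = X a" if "a \<in> charsupp" for a
      using X(2)[of b "a - b"] X(3)[OF Mon_gen(1)] that by (auto simp: charsupp_def)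
    ultimately show ?thesis by (auto simp: sum_distrib_left mult_ac intro!: sum.cong)
  qed
  have "leval ?h p = (\<Sum>a\<in>charsupp. ?h a * lmono p a)" by (simp only: leval_def supp)
  also have "\<dots> = (\<Sum>a\<in>charsupp. f a * 1 * X a)" by (rule sum.cong) (simp_all add: trunc_charsupp p)
  finally have "leval ?h p = 0" using sum_eq[of "\<lambda>_. 1"] f0 by simp
  then have Z: "p \<in> Ztor ?h" using p by (simp add: Ztor_def)
  have euler: "p $ i * leval (lpderiv i ?h) p = (\<Sum>a\<in>charsupp. f a * of_int (a $ i) * X a)" for i
    using leval_lpderiv[of ?h p i] p fin unfolding supp unfolding trunc_charsupp by simp
  have orth0: "(\<Sum>a\<in>charsupp. f a * of_int (idot (orth i) a) * X a) = 0" for i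
    using sum_eq[of "\<lambda>a. of_int (idot (orth i) a)"] th by simp
  have "rank_deficient ?h q p"
    unfolding rank_deficient_def
  proof (intro exI conjI allI)
    \<comment> \<open>The witness for the dependence of the rows: by the definition of
      \<open>orth i\<close>, a vanishing derivative along it expresses \<open>D\<close> times the
      \<open>i\<close>-th entry of the gradient row through the \<open>q l $ i\<close>, with the
      derivatives along \<open>w l\<close> as coefficients. The coefficient \<open>D\<close> makes
      the dependence nontrivial.\<close>
    show "complex_of_int D \<noteq> 0 \<or> (\<exists>j. - (\<Sum>a\<in>charsupp. f a * of_int (idot (w j) a) * X a) \<noteq> 0)" using D_nonzero by simp
    fix i
    have "0 = (\<Sum>a\<in>charsupp. f a * (of_int D * of_int (a $ i) - (\<Sum>l\<in>UNIV. of_int (q l $ i) * of_int (idot (w l) a))) * X a)"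
      using orth0[of i] by (simp add: idot_orth)
    also have "\<dots> = of_int D * (\<Sum>a\<in>charsupp. f a * of_int (a $ i) * X a) -
        (\<Sum>a\<in>charsupp. \<Sum>l\<in>UNIV. (f a * of_int (idot (w l) a) * X a) * of_int (q l $ i))"
      by (simp add: sum_subtractf sum_distrib_left sum_distrib_right algebra_simps)
    also have "\<dots> = of_int D * (p $ i * leval (lpderiv i ?h) p) +
        (\<Sum>j\<in>UNIV. - (\<Sum>a\<in>charsupp. f a * of_int (idot (w j) a) * X a) * of_int (q j $ i))"
      by (subst sum.swap) (simp add: euler sum_negf sum_distrib_right)
    finally show "of_int D * (p $ i * leval (lpderiv i ?h) p) +
        (\<Sum>j\<in>UNIV. - (\<Sum>a\<in>charsupp. f a * of_int (idot (w j) a) * X a) * of_int (q j $ i)) = 0" by simp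
  qed
  moreover have "monomap q p = t1"
  proof -
    have "X (q j) = t1 $ j" for j
    proof -
      \<comment> \<open>\<open>\<phi>\<close> cannot vanish at \<open>q j\<close>, because
        \<open>- q j\<close> is in the monoid as well; so the extension agrees with it
        there.\<close>
      have "\<phi> (q j) * \<phi> (- q j) = 1" using ch Mon_gen(2,3)[where b=b and j=j] by (metis add.right_inverse)
      then have "\<phi> (q j) \<noteq> 0" by auto
      then show ?thesis using X(3)[OF Mon_gen(2)] t by simp
    qed
    then show ?thesis by (simp add: monomap_def vec_eq_iff p)
  qed
  ultimately show ?thesis using Z charsupp_hull_face unfolding Lset_def by blast
qed

end

end

section \<open>Elimination outside of the discriminant\<close>

text \<open>Elimination without division: the solution formula holds on the whole of
  \<open>T\<close>, and \<open>h\<close> is a determinant-like factor that is nonzero at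
  \<open>t1\<close>, where the matrix is diagonal. As \<open>u\<close> and \<open>v\<close> are
  quantified after \<open>h\<close> and \<open>E\<close>, the same data serve every base
  exponent.\<close>

lemma holo_linear_elimination:
  fixes A :: "'k \<Rightarrow> 'k \<Rightarrow> complex^'r::finite \<Rightarrow> complex"
  assumes "finite W" "\<And>x y. x \<in> W \<Longrightarrow> y \<in> W \<Longrightarrow> holo_on T (A x y)"
    and "\<And>x. x \<in> W \<Longrightarrow> A x x t1 \<noteq> 0" "\<And>x y. x \<in> W \<Longrightarrow> y \<in> W \<Longrightarrow> x \<noteq> y \<Longrightarrow> A x y t1 = 0"
  shows "\<exists>h E. holo_on T h \<and> h t1 \<noteq> 0 \<and> (\<forall>x\<in>W. \<forall>y\<in>W. holo_on T (E x y)) \<and>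
    (\<forall>t\<in>T. \<forall>u v. (\<forall>x\<in>W. (\<Sum>y\<in>W. A x y t * u y) = v x) \<longrightarrow> (\<forall>x\<in>W. h t * u x = (\<Sum>y\<in>W. E x y t * v y)))"
  using assms
proof (induction W arbitrary: A rule: finite_induct)
  case empty
  then show ?case by (auto intro!: exI[of _ "\<lambda>t. 1"])
next
  case (insert w W)
  note hA = insert.prems(1)
  \<comment> \<open>Cross-multiplication with the pivot row removes the unknown \<open>w\<close>; at
    \<open>t1\<close> the reduced matrix is again diagonal with nonzero diagonal.\<close>
  define A' where "A' = (\<lambda>x y t. A w w t * A x y t - A x w t * A w y t)"
  have "\<exists>h E. holo_on T h \<and> h t1 \<noteq> 0 \<and> (\<forall>x\<in>W. \<forall>y\<in>W. holo_on T (E x y)) \<and>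
    (\<forall>t\<in>T. \<forall>u v. (\<forall>x\<in>W. (\<Sum>y\<in>W. A' x y t * u y) = v x) \<longrightarrow> (\<forall>x\<in>W. h t * u x = (\<Sum>y\<in>W. E x y t * v y)))"
  proof (rule insert.IH)
    fix x y assume xy: "x \<in> W" "y \<in> W"
    show "holo_on T (A' x y)" unfolding A'_def using hA xy by (intro holo_on_diff holo_on_mult) auto
    have "w \<noteq> x" "w \<noteq> y" using xy insert.hyps by auto
    then have 0: "A x w t1 = 0" using insert.prems(3)[of x w] xy by auto
    then show "A' x x t1 \<noteq> 0" unfolding A'_def using insert.prems(2) xy by simp
    assume "x \<noteq> y"
    then show "A' x y t1 = 0" unfolding A'_def using insert.prems(3)[of x y] xy 0 by simp
  qed
  then obtain h E where h: "holo_on T h" "h t1 \<noteq> 0" and E': "\<forall>x\<in>W. \<forall>y\<in>W. holo_on T (E x y)"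
    and sol': "\<forall>t\<in>T. \<forall>u v. (\<forall>x\<in>W. (\<Sum>y\<in>W. A' x y t * u y) = v x) \<longrightarrow> (\<forall>x\<in>W. h t * u x = (\<Sum>y\<in>W. E x y t * v y))"
    by (elim exE conjE) (rule that)
  have E: "holo_on T (E x y)" if "x \<in> W" "y \<in> W" for x y using E' that by blast
  have sol: "h t * u x = (\<Sum>y\<in>W. E x y t * v y)"
    if t: "t \<in> T" and eq: "\<And>x. x \<in> W \<Longrightarrow> (\<Sum>y\<in>W. A' x y t * u y) = v x" and x: "x \<in> W" for t u v x
    using sol'[rule_format, OF t _ x, of u v] eq by simp
  define H where "H = (\<lambda>x t. \<Sum>y\<in>W. E x y t * A y w t)"
  \<comment> \<open>Back substitution. The rows of the old unknowns are multiplied by the pivot, so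
    that all rows share the denominator \<open>h t * A w w t\<close>.\<close>
  define E' where "E' = (\<lambda>x y t. if x = w
      then (if y = w then h t + (\<Sum>z\<in>W. A w z t * H z t) else - (\<Sum>z\<in>W. A w z t * (A w w t * E z y t)))
      else A w w t * (if y = w then - H x t else A w w t * E x y t))"
  have hH: "holo_on T (H x)" if "x \<in> W" for x
    unfolding H_def using that hA by (intro holo_on_sum holo_on_mult E) auto
  show ?case
  proof (intro exI[of _ "\<lambda>t. h t * A w w t"] exI[of _ E'] conjI ballI allI impI)
    show "holo_on T (\<lambda>t. h t * A w w t)" using h hA by auto
    show "h t1 * A w w t1 \<noteq> 0" using h insert.prems(2) by simp
    fix x y assume xy: "x \<in> insert w W" "y \<in> insert w W"
    have W: "z \<in> insert w W" if "z \<in> W" for z using that by simp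
    have w: "w \<in> insert w W" by simp
    have minus: "holo_on T (\<lambda>t. - k t)" if "holo_on T k" for k
      using holo_on_diff[OF holo_on_const[of T 0] that] by simp
    show "holo_on T (E' x y)"
    proof (cases "x = w"; cases "y = w")
      assume "x = w" "y = w"
      then show ?thesis unfolding E'_def by (simp, intro holo_on_add h holo_on_sum holo_on_mult hA[OF w W] hH)
    next
      assume "x = w" "y \<noteq> w"
      then show ?thesis using xy unfolding E'_def
        by (simp, intro minus holo_on_sum holo_on_mult hA[OF w W] hA[OF w w] E) auto
    next
      assume "x \<noteq> w" "y = w"
      then show ?thesis using xy unfolding E'_def by (simp, intro minus holo_on_mult hA[OF w w] hH) auto
    next
      assume "x \<noteq> w" "y \<noteq> w"
      then show ?thesis using xy unfolding E'_def by (simp, intro holo_on_mult hA[OF w w] E) auto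
    qed
  next
    fix t u v x assume t: "t \<in> T" and eq: "\<forall>x\<in>insert w W. (\<Sum>y\<in>insert w W. A x y t * u y) = v x" and x: "x \<in> insert w W"
    have eqs: "A x w t * u w + (\<Sum>y\<in>W. A x y t * u y) = v x" if "x \<in> insert w W" for x
      using bspec[OF eq that] insert.hyps by simp
    have u: "h t * u x = A w w t * (\<Sum>y\<in>W. E x y t * v y) - H x t * v w" if x: "x \<in> W" for x
    proof -
      have "h t * u x = (\<Sum>y\<in>W. E x y t * (A w w t * v y - A y w t * v w))"
      proof (rule sol[OF t _ x])
        fix z assume z: "z \<in> W"
        have "(\<Sum>y\<in>W. A' z y t * u y) = A w w t * (\<Sum>y\<in>W. A z y t * u y) - A z w t * (\<Sum>y\<in>W. A w y t * u y)"
          by (simp add: A'_def left_diff_distrib sum_subtractf sum_distrib_left mult.assoc)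
        also have "\<dots> = A w w t * (v z - A z w t * u w) - A z w t * (v w - A w w t * u w)"
        proof -
          have "(\<Sum>y\<in>W. A z y t * u y) = v z - A z w t * u w" "(\<Sum>y\<in>W. A w y t * u y) = v w - A w w t * u w"
            using eqs[of z] eqs[of w] z by (simp_all add: eq_diff_eq add.commute)
          then show ?thesis by simp
        qed
        finally show "(\<Sum>y\<in>W. A' z y t * u y) = A w w t * v z - A z w t * v w" by (simp add: algebra_simps)
      qed
      then show ?thesis by (simp add: H_def right_diff_distrib sum_subtractf sum_distrib_left sum_distrib_right mult_ac)
    qed
    have sum_E': "(\<Sum>y\<in>insert w W. E' x y t * v y) = E' x w t * v w + (\<Sum>y\<in>W. E' x y t * v y)" for x
      using insert.hyps by simp
    show "h t * A w w t * u x = (\<Sum>y\<in>insert w W. E' x y t * v y)"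
    proof (cases "x = w")
      case False
      then have xW: "x \<in> W" using x by simp
      have "(\<Sum>y\<in>W. E' x y t * v y) = (\<Sum>y\<in>W. A w w t * (A w w t * E x y t) * v y)"
        by (rule sum.cong) (use False insert.hyps in \<open>auto simp: E'_def\<close>)
      then have "(\<Sum>y\<in>insert w W. E' x y t * v y) = A w w t * (A w w t * (\<Sum>y\<in>W. E x y t * v y) - H x t * v w)"
        unfolding sum_E' using False by (simp add: E'_def sum_distrib_left right_diff_distrib mult_ac)
      also have "\<dots> = A w w t * (h t * u x)" unfolding u[OF xW] ..
      finally show ?thesis by (simp add: mult_ac)
    next
      case True
      have "(\<Sum>y\<in>W. E' w y t * v y) = (\<Sum>y\<in>W. \<Sum>z\<in>W. - (A w z t * (A w w t * E z y t) * v y))"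
        by (rule sum.cong) (use insert.hyps in \<open>auto simp: E'_def sum_distrib_right sum_negf\<close>)
      also have "\<dots> = - (\<Sum>z\<in>W. A w z t * (A w w t * (\<Sum>y\<in>W. E z y t * v y)))"
        by (subst sum.swap) (simp add: sum_distrib_left sum_negf mult_ac)
      finally have "(\<Sum>y\<in>insert w W. E' w y t * v y) =
          h t * v w - (\<Sum>z\<in>W. A w z t * (A w w t * (\<Sum>y\<in>W. E z y t * v y) - H z t * v w))"
        unfolding sum_E' by (simp add: E'_def right_diff_distrib sum_subtractf sum_distrib_left distrib_left mult_ac)
      also have "\<dots> = h t * v w - (\<Sum>z\<in>W. A w z t * (h t * u z))" by (simp add: u)
      also have "\<dots> = h t * (v w - (\<Sum>z\<in>W. A w z t * u z))" by (simp add: right_diff_distrib sum_distrib_left mult_ac)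
      also have "v w - (\<Sum>z\<in>W. A w z t * u z) = A w w t * u w" using eqs[of w] by (simp add: algebra_simps)
      finally show ?thesis using True by (simp add: mult_ac)
    qed
  qed
qed

lemma holo_on_if:
  "(c \<Longrightarrow> holo_on U \<phi>) \<Longrightarrow> (\<not> c \<Longrightarrow> holo_on U \<psi>) \<Longrightarrow> holo_on U (\<lambda>t. if c then \<phi> t else \<psi> t)"
  by (cases c) simp_all

lemma holo_on_uminus [intro]: "holo_on U \<phi> \<Longrightarrow> holo_on U (\<lambda>t. - \<phi> t)"
  using holo_on_diff[OF holo_on_const[of U 0]] by fastforce

lemma lin_sum: "lin \<phi> (\<Sum>i\<in>I. s i) = (\<Sum>i\<in>I. lin \<phi> (s i))"
  by (induction I rule: infinite_finite_induct) (auto simp: lin_add)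

lemma lin_cmult: "lin (\<lambda>k. c * \<phi> k) s = c * lin \<phi> s"
  by (simp add: lin_def sum_distrib_left mult_ac)

context diagonal
begin

text \<open>\<open>P\<close> and \<open>R\<close> stand for the families of diagonals of \<open>z^m / f\<close> and \<open>z^m / f^2\<close>.\<close>

definition rel :: "complex^'r \<Rightarrow> (int^'n \<Rightarrow> complex) \<Rightarrow> (int^'n \<Rightarrow> complex) \<Rightarrow> bool" where
  "rel t P R \<longleftrightarrow> (\<forall>m j. P (m + q j) = t $ j * P m \<and> R (m + q j) = t $ j * R m) \<and>
    (\<forall>m. (\<Sum>a\<in>lsupp f. f a * R (m + a)) = P m) \<and>
    (\<forall>m i. of_int (idot (orth i) m) * P m = (\<Sum>a\<in>lsupp f. f a * of_int (idot (orth i) a) * R (m + a)))"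

section \<open>Levels of exponents and the ideal of reducible elements\<close>

text \<open>Sums of \<open>k\<close> exponents with repetition, as they arise in multiplying out
  \<open>f ^ k\<close>. The relations couple \<open>P\<close> at one level with \<open>R\<close> at
  the next, matching the denominators \<open>f\<close> and \<open>f^2\<close>.\<close>

definition Om :: "nat \<Rightarrow> (int^'n) set" where
  "Om k = {(\<Sum>a\<in>lsupp f. int (c a) *s a) | c. (\<Sum>a\<in>lsupp f. c a) = k}"

lemma Om_add: "x \<in> Om j \<Longrightarrow> y \<in> Om k \<Longrightarrow> x + y \<in> Om (j + k)"
proof -
  assume "x \<in> Om j" "y \<in> Om k"
  then obtain c d where c: "x = (\<Sum>a\<in>lsupp f. int (c a) *s a)" "(\<Sum>a\<in>lsupp f. c a) = j"
    and d: "y = (\<Sum>a\<in>lsupp f. int (d a) *s a)" "(\<Sum>a\<in>lsupp f. d a) = k" unfolding Om_def by blast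
  have "x + y = (\<Sum>a\<in>lsupp f. int (c a + d a) *s a)"
    by (simp add: c d sum.distrib vector_sadd_rdistrib)
  moreover have "(\<Sum>a\<in>lsupp f. c a + d a) = j + k" by (simp add: c d sum.distrib)
  ultimately show ?thesis unfolding Om_def by (intro CollectI exI[of _ "\<lambda>a. c a + d a"]) simp
qed

lemma Om_zero: "0 \<in> Om 0"
  unfolding Om_def by (auto intro!: exI[of _ "\<lambda>_. 0"])

lemma Om_supp: "a \<in> lsupp f \<Longrightarrow> a \<in> Om (Suc 0)"
proof -
  assume a: "a \<in> lsupp f"
  let ?c = "\<lambda>x. if x = a then 1 else (0::nat)"
  have "int (?c x) *s x = (if x = a then a else 0)" for x by (simp add: vec_eq_iff)
  then have "(\<Sum>x\<in>lsupp f. int (?c x) *s x) = a" using a finite_supp by simp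
  moreover have "(\<Sum>x\<in>lsupp f. ?c x) = Suc 0" using a finite_supp by simp
  ultimately show ?thesis unfolding Om_def by (intro CollectI exI[of _ ?c]) simp
qed

lemma finite_Om: "finite (Om k)"
proof -
  have "Om k \<subseteq> (\<lambda>c. \<Sum>a\<in>lsupp f. int (c a) *s a) ` (lsupp f \<rightarrow>\<^sub>E {..k})"
  proof
    fix x assume "x \<in> Om k"
    then obtain c where c: "x = (\<Sum>a\<in>lsupp f. int (c a) *s a)" "(\<Sum>a\<in>lsupp f. c a) = k" unfolding Om_def by blast
    have "c a \<le> k" if "a \<in> lsupp f" for a
      unfolding c(2)[symmetric] using that finite_supp by (intro member_le_sum) auto
    then have "restrict c (lsupp f) \<in> lsupp f \<rightarrow>\<^sub>E {..k}" by auto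
    moreover have "x = (\<Sum>a\<in>lsupp f. int (restrict c (lsupp f) a) *s a)" unfolding c(1) by (rule sum.cong) auto
    ultimately show "x \<in> (\<lambda>c. \<Sum>a\<in>lsupp f. int (c a) *s a) ` (lsupp f \<rightarrow>\<^sub>E {..k})" by blast
  qed
  then show ?thesis by (rule finite_subset) (intro finite_imageI finite_PiE finite_supp finite_atMost)
qed

text \<open>Among \<open>card (lsupp f) * N + 1\<close> summands some exponent occurs more than
  \<open>N\<close> times. The inequality is delivered along with it so that the natural subtraction
  \<open>card (lsupp f) * N - N\<close> is a true difference.\<close>

lemma Om_pigeonhole:
  assumes "x \<in> Om (Suc (card (lsupp f) * N))"
  obtains b y where "b \<in> lsupp f" "y \<in> Om (card (lsupp f) * N - N)" "x = int (Suc N) *s b + y" "N \<le> card (lsupp f) * N"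
proof -
  let ?K = "Suc (card (lsupp f) * N)"
  obtain c where c: "x = (\<Sum>a\<in>lsupp f. int (c a) *s a)" "(\<Sum>a\<in>lsupp f. c a) = ?K" using assms unfolding Om_def by blast
  have "\<exists>b\<in>lsupp f. c b > N"
  proof (rule ccontr)
    assume "\<not> ?thesis"
    then have "(\<Sum>a\<in>lsupp f. c a) \<le> (\<Sum>a\<in>lsupp f. N)" by (intro sum_mono) auto
    then show False using c(2) by simp
  qed
  then obtain b where b: "b \<in> lsupp f" "c b > N" by blast
  let ?d = "\<lambda>a. if a = b then c b - Suc N else c a"
  have "x = int (c b) *s b + (\<Sum>a\<in>lsupp f - {b}. int (c a) *s a)"
    unfolding c(1) using b finite_supp by (simp add: sum.remove)
  also have "int (c b) *s b = int (Suc N) *s b + int (?d b) *s b"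
    using b(2) by (simp add: vector_sadd_rdistrib[symmetric])
  also have "(\<Sum>a\<in>lsupp f - {b}. int (c a) *s a) = (\<Sum>a\<in>lsupp f - {b}. int (?d a) *s a)" by (rule sum.cong) auto
  finally have "x = int (Suc N) *s b + (int (?d b) *s b + (\<Sum>a\<in>lsupp f - {b}. int (?d a) *s a))" by (simp only: add.assoc)
  then have x: "x = int (Suc N) *s b + (\<Sum>a\<in>lsupp f. int (?d a) *s a)"
    by (subst sum.remove[OF finite_supp b(1)])
  have "(\<Sum>a\<in>lsupp f - {b}. ?d a) = (\<Sum>a\<in>lsupp f - {b}. c a)" by (rule sum.cong) auto
  then have "(\<Sum>a\<in>lsupp f. ?d a) + Suc N = ?K"
    using c(2) b by (simp add: sum.remove[OF finite_supp b(1)])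
  then have "(\<Sum>a\<in>lsupp f. ?d a) + N = card (lsupp f) * N" by (simp only: add_Suc_right nat.inject)
  then have d: "(\<Sum>a\<in>lsupp f. ?d a) = card (lsupp f) * N - N" "N \<le> card (lsupp f) * N"
    by (metis add_diff_cancel_right', metis le_add2)
  have "(\<Sum>a\<in>lsupp f. int (?d a) *s a) \<in> Om (card (lsupp f) * N - N)"
    unfolding Om_def by (intro CollectI exI[of _ ?d] conjI refl d(1))
  then show thesis by (rule that[OF b(1) _ x d(2)])
qed

text \<open>Functionals of \<open>(P, R)\<close> at the base exponent \<open>g\<close>: the coefficients of \<open>R\<close> vanish at \<open>t1\<close>
  and, unlike those of \<open>P\<close>, must not depend on \<open>g\<close>.\<close>

inductive Red :: "complex^'r \<Rightarrow> nat \<Rightarrow> (int^'n \<Rightarrow> complex^'r \<Rightarrow> (int^'n \<Rightarrow> complex) \<Rightarrow> (int^'n \<Rightarrow> complex) \<Rightarrow> complex) \<Rightarrow> bool"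
  for t1 N where
  zero: "Red t1 N (\<lambda>g t P R. 0)"
| add: "Red t1 N F \<Longrightarrow> Red t1 N G \<Longrightarrow> Red t1 N (\<lambda>g t P R. F g t P R + G g t P R)"
| P: "y \<in> Om N \<Longrightarrow> (\<And>g. holo_on torus (B g)) \<Longrightarrow> Red t1 N (\<lambda>g t P R. B g t * P (g + y))"
| R: "y \<in> Om (Suc N) \<Longrightarrow> holo_on torus C \<Longrightarrow> C t1 = 0 \<Longrightarrow> Red t1 N (\<lambda>g t P R. C t * R (g + y))"

lemma Red_mult:
  assumes "Red t1 N F" "holo_on torus h" shows "Red t1 N (\<lambda>g t P R. h t * F g t P R)"
  using assms(1)
proof induction
  case zero
  then show ?case using Red.zero by simp
next
  case (add F G)
  from Red.add[OF add.IH] show ?case by (simp add: distrib_left)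
next
  case (P y B)
  then have "Red t1 N (\<lambda>g t P R. (h t * B g t) * P (g + y))" using assms(2) by (intro Red.P) auto
  then show ?case by (simp add: mult.assoc)
next
  case (R y C)
  then have "Red t1 N (\<lambda>g t P R. (h t * C t) * R (g + y))" using assms(2) by (intro Red.R) auto
  then show ?case by (simp add: mult.assoc)
qed

text \<open>A coefficient of \<open>P\<close> may depend on the base and is shifted along with it; a
  coefficient of \<open>R\<close> does not see the shift.\<close>

lemma Red_shift:
  assumes "Red t1 N F" "z \<in> Om k" shows "Red t1 (k + N) (\<lambda>g. F (g + z))"
  using assms(1)
proof induction
  case zero
  show ?case by (rule Red.zero)
next
  case (add F G)
  from Red.add[OF add.IH] show ?case by simp
next
  case (P y B)
  then have "Red t1 (k + N) (\<lambda>g t P R. B (g + z) t * P (g + (z + y)))" using assms(2) by (intro Red.P Om_add) auto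
  then show ?case by (simp add: add.assoc)
next
  case (R y C)
  then have "Red t1 (k + N) (\<lambda>g t P R. C t * R (g + (z + y)))"
    using Om_add[OF assms(2) R(1)] by (intro Red.R) auto
  then show ?case by (simp add: add.assoc)
qed

definition normal_form :: "complex^'r \<Rightarrow> nat \<Rightarrow> (int^'n \<Rightarrow> int^'n \<Rightarrow> complex^'r \<Rightarrow> complex) \<Rightarrow> (int^'n \<Rightarrow> complex^'r \<Rightarrow> complex) \<Rightarrow>
    (int^'n \<Rightarrow> complex^'r \<Rightarrow> (int^'n \<Rightarrow> complex) \<Rightarrow> (int^'n \<Rightarrow> complex) \<Rightarrow> complex) \<Rightarrow> bool" where
  "normal_form t1 N B C F \<longleftrightarrow> (\<forall>y g. holo_on torus (B y g)) \<and> (\<forall>y. holo_on torus (C y) \<and> C y t1 = 0) \<and>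
    (\<forall>g t P R. F g t P R = (\<Sum>y\<in>Om N. B y g t * P (g + y)) + (\<Sum>y\<in>Om (Suc N). C y t * R (g + y)))"

lemma Red_normal_form:
  assumes "Red t1 N F" shows "\<exists>B C. normal_form t1 N B C F"
  unfolding normal_form_def
  using assms
proof induction
  case zero
  show ?case by (intro exI[of _ "\<lambda>y g t. 0"] exI[of _ "\<lambda>y t. 0"]) auto
next
  case (add F G)
  from add.IH(1) obtain B C where 1: "\<And>y g. holo_on torus (B y g)" "\<And>y. holo_on torus (C y) \<and> C y t1 = 0"
    "\<And>g t P R. F g t P R = (\<Sum>y\<in>Om N. B y g t * P (g + y)) + (\<Sum>y\<in>Om (Suc N). C y t * R (g + y))" by blast
  from add.IH(2) obtain B' C' where 2: "\<And>y g. holo_on torus (B' y g)" "\<And>y. holo_on torus (C' y) \<and> C' y t1 = 0"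
    "\<And>g t P R. G g t P R = (\<Sum>y\<in>Om N. B' y g t * P (g + y)) + (\<Sum>y\<in>Om (Suc N). C' y t * R (g + y))" by blast
  show ?case
    by (intro exI[of _ "\<lambda>y g t. B y g t + B' y g t"] exI[of _ "\<lambda>y t. C y t + C' y t"])
       (auto intro!: holo_on_add simp: 1 2 distrib_right sum.distrib)
next
  case (P y B)
  have "(\<Sum>y'\<in>Om N. (if y' = y then B g t else 0) * P (g + y')) = B g t * P (g + y)" for g t P
  proof -
    have "(\<Sum>y'\<in>Om N. (if y' = y then B g t else 0) * P (g + y')) = (\<Sum>y'\<in>Om N. if y' = y then B g t * P (g + y) else 0)"
      by (rule sum.cong) auto
    then show ?thesis using P finite_Om by simp
  qed
  then show ?case using P
    by (intro exI[of _ "\<lambda>y' g t. if y' = y then B g t else 0"] exI[of _ "\<lambda>y t. 0"]) (auto intro!: holo_on_if)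
next
  case (R y C)
  have "(\<Sum>y'\<in>Om (Suc N). (if y' = y then C t else 0) * R (g + y')) = C t * R (g + y)" for g t R
  proof -
    have "(\<Sum>y'\<in>Om (Suc N). (if y' = y then C t else 0) * R (g + y')) = (\<Sum>y'\<in>Om (Suc N). if y' = y then C t * R (g + y) else 0)"
      by (rule sum.cong) auto
    then show ?thesis using R finite_Om by simp
  qed
  then show ?case using R
    by (intro exI[of _ "\<lambda>y g t. 0"] exI[of _ "\<lambda>y' t. if y' = y then C t else 0"]) (auto intro!: holo_on_if)
qed

text \<open>The shift by \<open>Suc N\<close> copies of \<open>b\<close> homogenises: it absorbs the
  \<open>- b\<close> in differences \<open>a - b\<close> and leaves sums of exponents. The number
  \<open>Suc N\<close> is the level of \<open>R\<close> in \<open>Red\<close>.\<close>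

definition reduces :: "complex^'r \<Rightarrow> int^'n \<Rightarrow> nat \<Rightarrow> (int^'n \<Rightarrow>\<^sub>0 complex) \<Rightarrow>
    (int^'n \<Rightarrow> complex^'r \<Rightarrow> (int^'n \<Rightarrow> complex) \<Rightarrow> (int^'n \<Rightarrow> complex) \<Rightarrow> complex) \<Rightarrow> bool" where
  "reduces t1 b N s F \<longleftrightarrow> Red t1 N F \<and> (\<forall>t\<in>torus. \<forall>P R g. rel t P R \<longrightarrow>
     lin (\<lambda>k. R (g + int (Suc N) *s b + k)) s = F g t P R)"

text \<open>Moving the base from \<open>g\<close> to \<open>g + b\<close> supplies one more copy of
  \<open>b\<close> and costs one level.\<close>

lemma reduces_raise:
  assumes b: "b \<in> lsupp f" and "\<exists>F. reduces t1 b N s F" "N \<le> N'"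
  shows "\<exists>F. reduces t1 b N' s F"
  using assms(3,2)
proof (induction N' rule: dec_induct)
  case (step n)
  then obtain F where F: "reduces t1 b n s F" by blast
  have eq: "g + int (Suc (Suc n)) *s b = (g + b) + int (Suc n) *s b" for g
    by (simp add: vec_eq_iff algebra_simps)
  have "reduces t1 b (Suc n) s (\<lambda>g. F (g + b))"
    unfolding reduces_def
  proof (intro conjI ballI allI impI)
    show "Red t1 (Suc n) (\<lambda>g. F (g + b))" using Red_shift[of t1 n F b "Suc 0"] Om_supp[OF b] F by (simp add: reduces_def)
    fix t P R g assume "t \<in> torus" "rel t P R"
    then show "lin (\<lambda>k. R (g + int (Suc (Suc n)) *s b + k)) s = F (g + b) t P R"
      using F unfolding eq reduces_def by blast
  qed
  then show ?case by blast
qed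

text \<open>No level is fixed: multiplication by \<open>a - b\<close> raises the level, so the union
  over all levels is what becomes an ideal.\<close>

definition Jideal :: "complex^'r \<Rightarrow> int^'n \<Rightarrow> (int^'n \<Rightarrow>\<^sub>0 complex) set" where
  "Jideal t1 b = {s. Poly_Mapping.keys s \<subseteq> Mon b \<and> (\<exists>N F. reduces t1 b N s F)}"

text \<open>Each generator of the monoid acts on functionals: \<open>a - b\<close> moves the base
  from \<open>g\<close> to \<open>g + a\<close> one level up, while \<open>q j\<close> and
  \<open>- q j\<close> multiply by \<open>t $ j\<close> and its inverse, both holomorphic on the
  torus. Sums need a common level, which \<open>reduces_raise\<close> provides.\<close>

lemma ideal_Jideal:
  assumes b: "b \<in> lsupp f"
  shows "monoid_algebra.is_ideal (Mon b) (Jideal t1 b)"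
proof -
  interpret monoid_algebra "Mon b" by (rule monoid_algebra_Mon)
  have alg: "s \<in> alg" if "s \<in> Jideal t1 b" for s using that by (auto simp: Jideal_def alg_def)
  have JI: "s \<in> Jideal t1 b" if "s \<in> alg" "reduces t1 b N s F" for s N F using that by (auto simp: Jideal_def alg_def)
  have add: "s + s' \<in> Jideal t1 b" if ss: "s \<in> Jideal t1 b" "s' \<in> Jideal t1 b" for s s'
  proof -
    obtain N F N' F' where "reduces t1 b N s F" "reduces t1 b N' s' F'" using ss by (auto simp: Jideal_def)
    then obtain G G' where G: "reduces t1 b (max N N') s G" "reduces t1 b (max N N') s' G'"
      using reduces_raise[OF b, of t1 N s "max N N'"] reduces_raise[OF b, of t1 N' s' "max N N'"] by auto
    have "reduces t1 b (max N N') (s + s') (\<lambda>g t P R. G g t P R + G' g t P R)"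
      using G Red.add unfolding reduces_def by (auto simp: lin_add)
    then show ?thesis by (rule JI[OF alg_add[OF alg[OF ss(1)] alg[OF ss(2)]]])
  qed
  have mult_cst: "cst c * s \<in> Jideal t1 b" if s: "s \<in> Jideal t1 b" for s c
  proof -
    obtain N F where F: "reduces t1 b N s F" using s by (auto simp: Jideal_def)
    have "reduces t1 b N (cst c * s) (\<lambda>g t P R. c * F g t P R)"
      using F Red_mult[of t1 N F "\<lambda>t. c"] unfolding reduces_def by (auto simp: lin_single_mult)
    then show ?thesis by (rule JI[OF alg_mult[OF alg_single[OF zero_Mon] alg[OF s]]])
  qed
  have mult_supp: "Poly_Mapping.single (a - b) 1 * s \<in> Jideal t1 b" if a: "a \<in> lsupp f" and s: "s \<in> Jideal t1 b" for s a
  proof -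
    obtain N F where F: "reduces t1 b N s F" using s by (auto simp: Jideal_def)
    have eq: "g + int (Suc (Suc N)) *s b + (a - b + k) = (g + a) + int (Suc N) *s b + k" for g k
      by (simp add: vec_eq_iff algebra_simps)
    have "reduces t1 b (Suc N) (Poly_Mapping.single (a - b) 1 * s) (\<lambda>g. F (g + a))"
      unfolding reduces_def
    proof (intro conjI ballI allI impI)
      show "Red t1 (Suc N) (\<lambda>g. F (g + a))" using Red_shift[of t1 N F a "Suc 0"] Om_supp[OF a] F by (simp add: reduces_def)
      fix t P R g assume "t \<in> torus" "rel t P R"
      then show "lin (\<lambda>k. R (g + int (Suc (Suc N)) *s b + k)) (Poly_Mapping.single (a - b) 1 * s) = F (g + a) t P R"
        using F unfolding lin_single_mult eq reduces_def by simp
    qed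
    then show ?thesis by (rule JI[OF alg_mult[OF alg_single[OF Mon_gen(1)[OF a]] alg[OF s]]])
  qed
  have mult_plus: "Poly_Mapping.single (q j) 1 * s \<in> Jideal t1 b" if s: "s \<in> Jideal t1 b" for s j
  proof -
    obtain N F where F: "reduces t1 b N s F" using s by (auto simp: Jideal_def)
    have eq: "R (g + x + (q j + k)) = t $ j * R (g + x + k)" if "rel t P R" for t P R g x k
    proof -
      have "R (g + x + (q j + k)) = R ((g + x + k) + q j)" by (simp add: add_ac)
      also have "\<dots> = t $ j * R (g + x + k)" using that unfolding rel_def by blast
      finally show ?thesis .
    qed
    have "reduces t1 b N (Poly_Mapping.single (q j) 1 * s) (\<lambda>g t P R. t $ j * F g t P R)"
      unfolding reduces_def
    proof (intro conjI ballI allI impI)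
      show "Red t1 N (\<lambda>g t P R. t $ j * F g t P R)" using F by (intro Red_mult) (auto simp: reduces_def)
      fix t P R g assume "t \<in> torus" "rel t P R"
      then show "lin (\<lambda>k. R (g + int (Suc N) *s b + k)) (Poly_Mapping.single (q j) 1 * s) = t $ j * F g t P R"
        using F unfolding lin_single_mult eq[OF \<open>rel t P R\<close>] lin_cmult reduces_def by simp
    qed
    then show ?thesis by (rule JI[OF alg_mult[OF alg_single[OF Mon_gen(2)] alg[OF s]]])
  qed
  have mult_minus: "Poly_Mapping.single (- q j) 1 * s \<in> Jideal t1 b" if s: "s \<in> Jideal t1 b" for s j
  proof -
    obtain N F where F: "reduces t1 b N s F" using s by (auto simp: Jideal_def)
    have eq: "R (g + x + (- q j + k)) = inverse (t $ j) * R (g + x + k)" if "t \<in> torus" "rel t P R" for t P R g x k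
    proof -
      have "R (g + x + k) = R ((g + x + (- q j + k)) + q j)" by (simp add: add_ac)
      also have "\<dots> = t $ j * R (g + x + (- q j + k))" using that(2) unfolding rel_def by blast
      finally show ?thesis using that(1) by (simp add: torus_def field_simps)
    qed
    have "reduces t1 b N (Poly_Mapping.single (- q j) 1 * s) (\<lambda>g t P R. inverse (t $ j) * F g t P R)"
      unfolding reduces_def
    proof (intro conjI ballI allI impI)
      show "Red t1 N (\<lambda>g t P R. inverse (t $ j) * F g t P R)"
        using F by (intro Red_mult holo_on_inverse) (auto simp: reduces_def torus_def)
      fix t P R g assume "t \<in> torus" "rel t P R"
      then show "lin (\<lambda>k. R (g + int (Suc N) *s b + k)) (Poly_Mapping.single (- q j) 1 * s) = inverse (t $ j) * F g t P R"
        using F unfolding lin_single_mult eq[OF \<open>t \<in> torus\<close> \<open>rel t P R\<close>] lin_cmult reduces_def by simp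
    qed
    then show ?thesis by (rule JI[OF alg_mult[OF alg_single[OF Mon_gen(3)] alg[OF s]]])
  qed
  have "Poly_Mapping.single m c * s \<in> Jideal t1 b" if "m \<in> Mon b" and s: "s \<in> Jideal t1 b" for m c s
    using that(1)
  proof induction
    case zero
    then show ?case using mult_cst[OF s] by simp
  next
    case (supp m a)
    have "Poly_Mapping.single (m + (a - b)) c * s = Poly_Mapping.single (a - b) 1 * (Poly_Mapping.single m c * s)"
      by (simp add: mult.assoc[symmetric] mult_single add.commute)
    then show ?case using mult_supp[OF supp(2,3)] by simp
  next
    case (plus m j)
    have "Poly_Mapping.single (m + q j) c * s = Poly_Mapping.single (q j) 1 * (Poly_Mapping.single m c * s)"
      by (simp add: mult.assoc[symmetric] mult_single add.commute)
    then show ?case using mult_plus[OF plus(2)] by simp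
  next
    case (minus m j)
    have "Poly_Mapping.single (m - q j) c * s = Poly_Mapping.single (- q j) 1 * (Poly_Mapping.single m c * s)"
      by (simp add: mult.assoc[symmetric] mult_single)
    then show ?case using mult_minus[OF minus(2)] by simp
  qed
  moreover have "0 \<in> Jideal t1 b"
    using JI[OF alg_zero, of 0 "\<lambda>g t P R. 0"] Red.zero by (simp add: reduces_def)
  ultimately show ?thesis using add alg unfolding is_ideal_def by blast
qed

text \<open>The three groups of relations in \<open>rel\<close> place three kinds of elements into
  the ideal at level 0. A character killing them would put \<open>t1\<close> into
  \<open>Lset f q\<close>, so the ideal cannot be proper.\<close>

lemma one_in_Jideal:
  assumes b: "b \<in> lsupp f" and t1: "t1 \<notin> Lset f q"
  shows "1 \<in> Jideal t1 b"
proof (rule ccontr)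
  assume "1 \<notin> Jideal t1 b"
  interpret monoid_algebra "Mon b" by (rule monoid_algebra_Mon)
  obtain \<phi> where ch: "\<phi> 0 = 1" "\<And>a b'. a \<in> Mon b \<Longrightarrow> b' \<in> Mon b \<Longrightarrow> \<phi> (a + b') = \<phi> a * \<phi> b'"
    and kill: "\<And>s. s \<in> Jideal t1 b \<Longrightarrow> lin \<phi> s = 0"
    using character_exists[OF ideal_Jideal[OF b] \<open>1 \<notin> Jideal t1 b\<close>] by metis
  have JI: "s \<in> Jideal t1 b" if "s \<in> alg" "reduces t1 b N s F" for s N F using that by (auto simp: Jideal_def alg_def)
  have alg_sum: "(\<Sum>a\<in>lsupp f. Poly_Mapping.single (a - b) (u a)) \<in> alg" for u
  proof -
    have "(\<Sum>a\<in>A. Poly_Mapping.single (a - b) (u a)) \<in> alg" if "finite A" "A \<subseteq> lsupp f" for A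
      using that by (induction A) (auto intro!: alg_add alg_single Mon_gen)
    then show ?thesis using finite_supp by blast
  qed
  have lin_f: "lin \<psi> (\<Sum>a\<in>lsupp f. Poly_Mapping.single (a - b) (u a)) = (\<Sum>a\<in>lsupp f. u a * \<psi> (a - b))" for \<psi> u
    by (simp add: lin_sum)
  have eqb: "g + int (Suc 0) *s b + (a - b) = g + a" for g a by (simp add: vec_eq_iff)
  have "(\<Sum>a\<in>lsupp f. Poly_Mapping.single (a - b) (f a)) \<in> Jideal t1 b"
  proof (rule JI[OF alg_sum])
    show "reduces t1 b 0 (\<Sum>a\<in>lsupp f. Poly_Mapping.single (a - b) (f a)) (\<lambda>g t P R. 1 * P (g + 0))"
      unfolding reduces_def lin_f eqb by (intro conjI Red.P Om_zero) (auto simp: rel_def)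
  qed
  from kill[OF this] have f0: "(\<Sum>a\<in>lsupp f. f a * \<phi> (a - b)) = 0" by (simp add: lin_f)
  have th: "(\<Sum>a\<in>lsupp f. f a * of_int (idot (orth i) a) * \<phi> (a - b)) = 0" for i
  proof -
    \<comment> \<open>The functional is \<open>idot (orth i) g * P g\<close>, whose coefficient
      varies with \<open>g\<close>: the reason why coefficients of \<open>P\<close> may depend on
      the base.\<close>
    have "(\<Sum>a\<in>lsupp f. Poly_Mapping.single (a - b) (f a * of_int (idot (orth i) a))) \<in> Jideal t1 b"
    proof (rule JI[OF alg_sum])
      show "reduces t1 b 0 (\<Sum>a\<in>lsupp f. Poly_Mapping.single (a - b) (f a * of_int (idot (orth i) a)))
          (\<lambda>g t P R. of_int (idot (orth i) g) * P (g + 0))"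
        unfolding reduces_def lin_f eqb by (intro conjI Red.P Om_zero) (auto simp: rel_def)
    qed
    from kill[OF this] show ?thesis by (simp add: lin_f)
  qed
  have tj: "\<phi> (q j) = t1 $ j" for j
  proof -
    \<comment> \<open>This element acts as multiplication by \<open>t $ j - t1 $ j\<close>, which
      vanishes at \<open>t1\<close>; of the three kinds it is the one that leaves a term in
      \<open>R\<close>.\<close>
    have "Poly_Mapping.single (q j) 1 - Poly_Mapping.single 0 (t1 $ j) \<in> Jideal t1 b"
    proof (rule JI)
      show "Poly_Mapping.single (q j) 1 - Poly_Mapping.single 0 (t1 $ j) \<in> alg"
        by (intro alg_diff alg_single Mon_gen zero_Mon)
      show "reduces t1 b 0 (Poly_Mapping.single (q j) 1 - Poly_Mapping.single 0 (t1 $ j))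
          (\<lambda>g t P R. (t $ j - t1 $ j) * R (g + b))"
        unfolding reduces_def lin_minus
        by (intro conjI Red.R Om_supp b) (auto simp: rel_def left_diff_distrib)
    qed
    from kill[OF this] show ?thesis by (simp add: lin_minus ch)
  qed
  have "t1 \<in> Lset f q"
    by (rule character_point_in_Lset[OF b ch f0 th tj])
  then show False using t1 by simp
qed

text \<open>There is one denominator \<open>h\<close> for all bases \<open>g\<close>, so its zeros
  restrict the extension of infinitely many functions in the same way; only the numerators depend on
  \<open>g\<close>.\<close>

definition elim_data :: "(complex^'r \<Rightarrow> complex) \<Rightarrow> (int^'n \<Rightarrow> int^'n \<Rightarrow> int^'n \<Rightarrow> complex^'r \<Rightarrow> complex) \<Rightarrow> nat \<Rightarrow> bool" where
  "elim_data h E K \<longleftrightarrow> holo_on torus h \<and> (\<forall>g x y. holo_on torus (E g x y)) \<and>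
    (\<forall>t\<in>torus. \<forall>P R. rel t P R \<longrightarrow> (\<forall>g. \<forall>x\<in>Om (Suc K). h t * R (g + x) = (\<Sum>y\<in>Om K. E g x y t * P (g + y))))"

lemma elimination_outside_Lset:
  assumes "t1 \<notin> Lset f q"
  obtains h E K where "elim_data h E K" "h t1 \<noteq> 0"
proof -
  have "\<exists>N. \<exists>F. reduces t1 b N 1 F" if "b \<in> lsupp f" for b
    using one_in_Jideal[OF that assms] by (auto simp: Jideal_def)
  then obtain Nf where Nf: "\<And>b. b \<in> lsupp f \<Longrightarrow> \<exists>F. reduces t1 b (Nf b) 1 F" by metis
  \<comment> \<open>A level common to all \<open>b\<close>: the sum dominates each summand.\<close>
  define N where "N = (\<Sum>b\<in>lsupp f. Nf b)"
  have "\<exists>F. reduces t1 b N 1 F" if "b \<in> lsupp f" for b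
    unfolding N_def using reduces_raise[OF that Nf[OF that]] member_le_sum[OF that _ finite_supp, of Nf] by auto
  then obtain F where F: "\<And>b. b \<in> lsupp f \<Longrightarrow> reduces t1 b N 1 (F b)" by metis
  \<comment> \<open>With this \<open>K\<close>, a sum of \<open>K + 1\<close> exponents contains
    some exponent \<open>N + 1\<close> times, so that the unit relation with that base
    applies.\<close>
  define K where "K = card (lsupp f) * N"
  have "\<exists>G. Red t1 K G \<and> (\<forall>t\<in>torus. \<forall>P R g. rel t P R \<longrightarrow> R (g + x) = G g t P R)" if x: "x \<in> Om (Suc K)" for x
  proof -
    obtain b y where b: "b \<in> lsupp f" and y: "y \<in> Om (K - N)" "x = int (Suc N) *s b + y" and le: "N \<le> K"
      using Om_pigeonhole[of x N] x unfolding K_def by metis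
    have red: "Red t1 N (F b)" and eq: "\<And>t P R g. t \<in> torus \<Longrightarrow> rel t P R \<Longrightarrow> R (g + int (Suc N) *s b) = F b g t P R"
      using F[OF b] unfolding reduces_def lin_one by auto
    have "Red t1 K (\<lambda>g. F b (g + y))" using Red_shift[OF red y(1)] le by simp
    moreover have "R (g + x) = F b (g + y) t P R" if "t \<in> torus" "rel t P R" for t P R g
      using eq[OF that, of "g + y"] unfolding y(2) by (simp only: add_ac)
    ultimately show ?thesis by (intro exI[of _ "\<lambda>g. F b (g + y)"]) blast
  qed
  then obtain G where G: "\<And>x. x \<in> Om (Suc K) \<Longrightarrow> Red t1 K (G x)"
    "\<And>x t P R g. x \<in> Om (Suc K) \<Longrightarrow> t \<in> torus \<Longrightarrow> rel t P R \<Longrightarrow> R (g + x) = G x g t P R" by metis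
  have "\<exists>B C. normal_form t1 K B C (G x)" if "x \<in> Om (Suc K)" for x
    by (rule Red_normal_form[OF G(1)[OF that]])
  then obtain B C where nf: "\<And>x. x \<in> Om (Suc K) \<Longrightarrow> normal_form t1 K (B x) (C x) (G x)" by metis
  have BC: "holo_on torus (B x y g)" "holo_on torus (C x y)" "C x y t1 = 0"
    "G x g t P R = (\<Sum>y\<in>Om K. B x y g t * P (g + y)) + (\<Sum>y\<in>Om (Suc K). C x y t * R (g + y))"
    if "x \<in> Om (Suc K)" for x y g t P R
    using nf[OF that] unfolding normal_form_def by simp_all
  let ?W = "Om (Suc K)"
  \<comment> \<open>Each \<open>R (g + x)\<close> is rewritten through the \<open>R (g + y)\<close>
    of the same level with coefficients \<open>C\<close> vanishing at \<open>t1\<close>; moving them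
    to the left gives a matrix that is the identity at \<open>t1\<close>.\<close>
  define A where "A = (\<lambda>x y t. (if x = y then 1 else 0) - C x y t)"
  have "\<exists>h E. holo_on torus h \<and> h t1 \<noteq> 0 \<and> (\<forall>x\<in>?W. \<forall>y\<in>?W. holo_on torus (E x y)) \<and>
    (\<forall>t\<in>torus. \<forall>u v. (\<forall>x\<in>?W. (\<Sum>y\<in>?W. A x y t * u y) = v x) \<longrightarrow> (\<forall>x\<in>?W. h t * u x = (\<Sum>y\<in>?W. E x y t * v y)))"
    by (rule holo_linear_elimination) (auto simp: A_def finite_Om BC intro!: holo_on_diff holo_on_uminus)
  then obtain h E where h: "holo_on torus h" "h t1 \<noteq> 0" and E': "\<forall>x\<in>?W. \<forall>y\<in>?W. holo_on torus (E x y)"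
    and sol': "\<forall>t\<in>torus. \<forall>u v. (\<forall>x\<in>?W. (\<Sum>y\<in>?W. A x y t * u y) = v x) \<longrightarrow>
        (\<forall>x\<in>?W. h t * u x = (\<Sum>y\<in>?W. E x y t * v y))"
    by (elim exE conjE) (rule that)
  have E: "holo_on torus (E x y)" if "x \<in> ?W" "y \<in> ?W" for x y using E' that by blast
  have sol: "h t * u x = (\<Sum>y\<in>?W. E x y t * v y)"
    if t: "t \<in> torus" and eq: "\<And>x. x \<in> ?W \<Longrightarrow> (\<Sum>y\<in>?W. A x y t * u y) = v x" and x: "x \<in> ?W" for t u v x
    using sol'[rule_format, OF t _ x, of u v] eq by simp
  define EE where "EE = (\<lambda>g x y t. if x \<in> ?W then \<Sum>z\<in>?W. E x z t * B z y g t else 0)"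
  show thesis
  proof (rule that[of h EE K, OF _ h(2)])
    show "elim_data h EE K"
      unfolding elim_data_def
    proof (intro conjI allI ballI impI h(1))
      fix g x y
      show "holo_on torus (EE g x y)"
        by (cases "x \<in> ?W") (auto simp: EE_def intro!: holo_on_sum holo_on_mult E BC)
    next
      fix t P R g x assume t: "t \<in> torus" and rel: "rel t P R" and x: "x \<in> ?W"
      have "(\<Sum>y\<in>?W. A z y t * R (g + y)) = (\<Sum>y\<in>Om K. B z y g t * P (g + y))" if z: "z \<in> ?W" for z
      proof -
        have "(\<Sum>y\<in>?W. A z y t * R (g + y)) = (\<Sum>y\<in>?W. if z = y then R (g + y) else 0) - (\<Sum>y\<in>?W. C z y t * R (g + y))"
          unfolding sum_subtractf[symmetric] by (rule sum.cong) (auto simp: A_def algebra_simps)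
        also have "(\<Sum>y\<in>?W. if z = y then R (g + y) else 0) = R (g + z)" using z finite_Om by simp
        also have "\<dots> = (\<Sum>y\<in>Om K. B z y g t * P (g + y)) + (\<Sum>y\<in>?W. C z y t * R (g + y))"
          using G(2)[OF z t rel] BC(4)[OF z] by simp
        finally show ?thesis by simp
      qed
      then have "h t * R (g + x) = (\<Sum>z\<in>?W. E x z t * (\<Sum>y\<in>Om K. B z y g t * P (g + y)))"
        by (intro sol[OF t _ x])
      also have "\<dots> = (\<Sum>y\<in>Om K. \<Sum>z\<in>?W. E x z t * B z y g t * P (g + y))"
        unfolding sum_distrib_left by (subst sum.swap) (simp add: mult.assoc)
      also have "\<dots> = (\<Sum>y\<in>Om K. EE g x y t * P (g + y))"
        using x by (simp add: EE_def sum_distrib_right)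
      finally show "h t * R (g + x) = (\<Sum>y\<in>Om K. EE g x y t * P (g + y))" .
    qed
  qed
qed

end

section \<open>Continuation of families of diagonals\<close>

lemma open_torus: "open (torus :: (complex^'r::finite) set)"
proof -
  have "open (\<Inter>i. {z :: complex^'r. z $ i \<noteq> 0})"
  proof (rule open_INT)
    show "\<forall>i\<in>UNIV. open {z :: complex^'r. z $ i \<noteq> 0}"
      by (intro ballI open_Collect_neq continuous_intros)
  qed simp
  moreover have "(\<Inter>i. {z :: complex^'r. z $ i \<noteq> 0}) = torus" by (auto simp: torus_def)
  ultimately show ?thesis by simp
qed

context diagonal
begin

text \<open>Logarithmic differentiation of \<open>z^m / f\<close> along \<open>w l\<close>,
  averaged. The divisor \<open>t $ l * D\<close> appears because a change of \<open>t $ l\<close>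
  corresponds to a step along \<open>w l\<close> scaled by its inverse.\<close>

definition euler_deriv :: "complex^'r \<Rightarrow> (int^'n \<Rightarrow> complex) \<Rightarrow> (int^'n \<Rightarrow> complex) \<Rightarrow> int^'n \<Rightarrow> complex^'r \<Rightarrow> complex" where
  "euler_deriv t P R m x = (\<Sum>l\<in>UNIV. x $ l / (t $ l * of_int D) *
     (of_int (idot (w l) m) * P m - (\<Sum>a\<in>lsupp f. f a * of_int (idot (w l) a) * R (m + a))))"

text \<open>A differential equation is imposed on the \<open>P\<close> component only; the
  \<open>R\<close> component is recovered from it by elimination.\<close>

definition family :: "(complex^'r) set \<Rightarrow> (complex^'r \<Rightarrow> (int^'n \<Rightarrow> complex) \<times> (int^'n \<Rightarrow> complex)) \<Rightarrow> bool" where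
  "family U \<Phi> \<longleftrightarrow> U \<subseteq> torus \<and> (\<forall>m. holo_on U (\<lambda>t. fst (\<Phi> t) m) \<and> holo_on U (\<lambda>t. snd (\<Phi> t) m)) \<and>
    (\<forall>t\<in>U. rel t (fst (\<Phi> t)) (snd (\<Phi> t))) \<and>
    (\<forall>t\<in>U. \<forall>m. ((\<lambda>t. fst (\<Phi> t) m) has_derivative euler_deriv t (fst (\<Phi> t)) (snd (\<Phi> t)) m) (at t))"

lemma family_subset: "family U \<Phi> \<Longrightarrow> V \<subseteq> U \<Longrightarrow> family V \<Phi>"
  unfolding family_def by (meson holo_on_subset order_trans subsetD)

lemma familyD:
  assumes "family U \<Phi>"
  shows "U \<subseteq> torus" "holo_on U (\<lambda>t. fst (\<Phi> t) m)" "holo_on U (\<lambda>t. snd (\<Phi> t) m)"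
    and "t \<in> U \<Longrightarrow> rel t (fst (\<Phi> t)) (snd (\<Phi> t))"
    and "t \<in> U \<Longrightarrow> ((\<lambda>t. fst (\<Phi> t) m) has_derivative euler_deriv t (fst (\<Phi> t)) (snd (\<Phi> t)) m) (at t)"
  using assms unfolding family_def by blast+

lemma Om_nonempty: "lsupp f \<noteq> {} \<Longrightarrow> Om k \<noteq> {}"
proof (induction k)
  case 0
  then show ?case using Om_zero by blast
next
  case (Suc k)
  then show ?case using Om_add[of _ k _ "Suc 0"] Om_supp by fastforce
qed

text \<open>For each base \<open>g\<close>, eliminating \<open>R\<close> from the derivatives closes
  the finitely many \<open>P (g + i)\<close> into a linear system with poles only at zeros of
  \<open>h\<close> and of the coordinates. The ball avoids these, hence serves every
  \<open>g\<close>. The identities that define a family are holomorphic and spread from the small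
  ball around \<open>t2\<close>.\<close>

lemma family_extension:
  assumes ne: "lsupp f \<noteq> {}" and el: "elim_data h E K" and B: "cball t1 \<epsilon> \<subseteq> torus" "\<And>t. t \<in> cball t1 \<epsilon> \<Longrightarrow> h t \<noteq> 0"
    and t2: "t2 \<in> ball t1 \<epsilon>" and \<delta>: "\<delta> > 0" and fam: "family (ball t2 \<delta>) \<Phi>"
  obtains \<Psi> \<rho> where "family (ball t1 \<epsilon>) \<Psi>" "\<rho> > 0" "\<rho> \<le> \<delta>" "\<And>t. t \<in> ball t2 \<rho> \<Longrightarrow> \<Psi> t = \<Phi> t"
proof -
  let ?B = "ball t1 \<epsilon>"
  have BT: "?B \<subseteq> torus" using B(1) ball_subset_cball by blast
  obtain \<rho> where \<rho>: "\<rho> > 0" "\<rho> \<le> \<delta>" "ball t2 \<rho> \<subseteq> ?B"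
  proof -
    obtain e where "e > 0" "ball t2 e \<subseteq> ?B" using open_contains_ball[of ?B] t2 by blast
    then show ?thesis using \<delta> that[of "min e \<delta>"] by (auto simp: subset_eq)
  qed
  let ?V = "ball t2 \<rho>"
  have V\<delta>: "?V \<subseteq> ball t2 \<delta>" using \<rho>(2) by auto
  have famV: "family ?V \<Phi>" by (rule family_subset[OF fam V\<delta>])
  have t2V: "t2 \<in> ?V" using \<rho>(1) by simp
  have VT: "?V \<subseteq> torus" using \<rho>(3) BT by blast
  have h: "holo_on torus h" and E: "\<And>g x y. holo_on torus (E g x y)"
    and elim: "\<And>t P R g x. t \<in> torus \<Longrightarrow> rel t P R \<Longrightarrow> x \<in> Om (Suc K) \<Longrightarrow> h t * R (g + x) = (\<Sum>y\<in>Om K. E g x y t * P (g + y))"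
    using el unfolding elim_data_def by blast+
  have ident: "\<phi> t = \<psi> t" if "holo_on ?B \<phi>" "holo_on ?B \<psi>" "\<And>t. t \<in> ?V \<Longrightarrow> \<phi> t = \<psi> t" "t \<in> ?B" for \<phi> \<psi> t
  proof (rule holo_eq_on_convex[OF open_ball convex_ball that(1,2) t2 _ that(4)])
    have "\<forall>\<^sub>F t in nhds t2. t \<in> ?V" using t2V by (intro eventually_nhds_in_open) auto
    then show "\<forall>\<^sub>F t in nhds t2. \<phi> t = \<psi> t" by eventually_elim (rule that(3))
  qed
  \<comment> \<open>The coefficients obtained by substituting the elimination formula for
    \<open>R\<close> into \<open>euler_deriv\<close>.\<close>
  define A where "A = (\<lambda>g i j l t. ((if i = j then of_int (idot (w l) (g + i)) else 0) -
     (\<Sum>a\<in>lsupp f. f a * of_int (idot (w l) a) * (E g (i + a) j t / h t))) / (t $ l * of_int D))"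
  have hA: "holo_on (cball t1 \<epsilon>) (A g i j l)" for g i j l
  proof -
    have "t $ l \<noteq> 0" if "t \<in> cball t1 \<epsilon>" for t using that B(1) by (auto simp: torus_def)
    then show ?thesis unfolding A_def using D_nonzero B
      by (intro holo_on_divide holo_on_diff holo_on_sum holo_on_mult holo_on_const holo_on_coord
          holo_on_subset[OF E B(1)] holo_on_subset[OF h B(1)]) auto
  qed
  have "\<exists>Y. \<forall>i\<in>Om K. holo_on ?B (Y i) \<and> (\<forall>\<^sub>F t in nhds t2. Y i t = fst (\<Phi> t) (g + i))" for g
  proof (rule pfaff_extension[OF finite_Om hA[of g] t2 \<rho>(1)])
    fix i t assume i: "i \<in> Om K" and t: "t \<in> ?V"
    let ?P = "fst (\<Phi> t)" and ?R = "snd (\<Phi> t)"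
    have tB: "t \<in> cball t1 \<epsilon>" using t \<rho>(3) by auto
    have R: "?R (g + i + a) = (\<Sum>j\<in>Om K. (E g (i + a) j t / h t) * ?P (g + j))" if a: "a \<in> lsupp f" for a
    proof -
      have "i + a \<in> Om (Suc K)" using Om_add[OF i Om_supp[OF a]] by simp
      then have "h t * ?R (g + (i + a)) = (\<Sum>j\<in>Om K. E g (i + a) j t * ?P (g + j))"
        using elim[OF _ familyD(4)[OF famV t]] t VT by blast
      then have "?R (g + (i + a)) = (\<Sum>j\<in>Om K. E g (i + a) j t * ?P (g + j)) / h t"
        using B(2)[OF tB] by (simp add: field_simps)
      then show ?thesis by (simp add: sum_divide_distrib add.assoc)
    qed
    have coeff: "(\<Sum>j\<in>Om K. A g i j l t * ?P (g + j)) = (of_int (idot (w l) (g + i)) * ?P (g + i) -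
        (\<Sum>a\<in>lsupp f. f a * of_int (idot (w l) a) * ?R (g + i + a))) / (t $ l * of_int D)" for l
    proof -
      have "(\<Sum>a\<in>lsupp f. f a * of_int (idot (w l) a) * ?R (g + i + a)) =
          (\<Sum>a\<in>lsupp f. \<Sum>j\<in>Om K. f a * of_int (idot (w l) a) * (E g (i + a) j t / h t) * ?P (g + j))"
        by (rule sum.cong) (simp_all only: R sum_distrib_left mult.assoc)
      also have "\<dots> = (\<Sum>j\<in>Om K. (\<Sum>a\<in>lsupp f. f a * of_int (idot (w l) a) * (E g (i + a) j t / h t)) * ?P (g + j))"
        by (subst sum.swap) (simp only: sum_distrib_right)
      finally have 1: "(\<Sum>a\<in>lsupp f. f a * of_int (idot (w l) a) * ?R (g + i + a)) = \<dots>" .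
      have "(\<Sum>j\<in>Om K. (if i = j then of_int (idot (w l) (g + i)) else 0) * ?P (g + j)) =
          (\<Sum>j\<in>Om K. if i = j then of_int (idot (w l) (g + i)) * ?P (g + i) else 0)"
        by (rule sum.cong) auto
      then have 2: "(\<Sum>j\<in>Om K. (if i = j then of_int (idot (w l) (g + i)) else 0) * ?P (g + j)) =
          of_int (idot (w l) (g + i)) * ?P (g + i)" using i finite_Om by simp
      show ?thesis unfolding A_def 1 2[symmetric]
        by (simp only: times_divide_eq_left sum_divide_distrib[symmetric] left_diff_distrib sum_subtractf)
    qed
    have eq: "euler_deriv t ?P ?R (g + i) = (\<lambda>x. \<Sum>l\<in>UNIV. \<Sum>j\<in>Om K. x $ l * A g i j l t * ?P (g + j))"
    proof
      fix x :: "complex^'r"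
      show "euler_deriv t ?P ?R (g + i) x = (\<Sum>l\<in>UNIV. \<Sum>j\<in>Om K. x $ l * A g i j l t * ?P (g + j))"
        unfolding euler_deriv_def mult.assoc sum_distrib_left[symmetric] coeff[unfolded mult.assoc] by simp
    qed
    show "((\<lambda>t. fst (\<Phi> t) (g + i)) has_derivative (\<lambda>x. \<Sum>l\<in>UNIV. \<Sum>j\<in>Om K. x $ l * A g i j l t * ?P (g + j))) (at t)"
      using familyD(5)[OF famV t, of "g + i"] unfolding eq .
  qed
  then obtain Y where Y: "\<And>g i. i \<in> Om K \<Longrightarrow> holo_on ?B (Y g i)"
    "\<And>g i. i \<in> Om K \<Longrightarrow> \<forall>\<^sub>F t in nhds t2. Y g i t = fst (\<Phi> t) (g + i)" by metis
  obtain i0 where i0: "i0 \<in> Om K" using Om_nonempty[OF ne] by blast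
  obtain x0 where x0: "x0 \<in> Om (Suc K)" using Om_nonempty[OF ne] by blast
  \<comment> \<open>The member with exponent \<open>m\<close> is taken from the system with base
    \<open>m - i0\<close>, for one fixed \<open>i0\<close>. It only has to continue the given germ,
    so different systems are never compared; \<open>R\<close> is then defined by the elimination
    formula, again with one fixed shift \<open>x0\<close>.\<close>
  define P where "P = (\<lambda>m t. Y (m - i0) i0 t)"
  define R where "R = (\<lambda>m t. (\<Sum>y\<in>Om K. E (m - x0) x0 y t * P (m - x0 + y) t) / h t)"
  have hP: "holo_on ?B (P m)" for m unfolding P_def by (rule Y(1)[OF i0])
  have hR: "holo_on ?B (R m)" for m unfolding R_def
    by (intro holo_on_divide holo_on_sum holo_on_mult hP holo_on_subset[OF E BT] holo_on_subset[OF h BT]) (use B(2) in auto)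
  have PV: "P m t = fst (\<Phi> t) m" if "t \<in> ?V" for m t
  proof (rule holo_eq_on_convex[OF open_ball convex_ball holo_on_subset[OF hP \<rho>(3)] familyD(2)[OF famV] t2V _ that])
    show "\<forall>\<^sub>F t in nhds t2. P m t = fst (\<Phi> t) m" using Y(2)[OF i0, of "m - i0"] unfolding P_def by simp
  qed
  have RV: "R m t = snd (\<Phi> t) m" if t: "t \<in> ?V" for m t
  proof -
    have "t \<in> torus" using t VT by blast
    have "h t * snd (\<Phi> t) (m - x0 + x0) = (\<Sum>y\<in>Om K. E (m - x0) x0 y t * fst (\<Phi> t) (m - x0 + y))"
      by (rule elim[OF \<open>t \<in> torus\<close> familyD(4)[OF famV t] x0])
    moreover have "h t \<noteq> 0" using B(2) t \<rho>(3) by auto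
    ultimately show ?thesis unfolding R_def PV[OF t] by (simp add: field_simps)
  qed
  define \<Psi> where "\<Psi> = (\<lambda>t. (\<lambda>m. P m t, \<lambda>m. R m t))"
  have \<Psi>V: "\<Psi> t = \<Phi> t" if "t \<in> ?V" for t
    using PV[OF that] RV[OF that] by (simp add: \<Psi>_def prod_eq_iff fun_eq_iff)
  have relV: "rel t (\<lambda>m. P m t) (\<lambda>m. R m t)" if "t \<in> ?V" for t
    using familyD(4)[OF famV that] PV[OF that] RV[OF that] by simp
  have "family ?B \<Psi>"
    unfolding family_def \<Psi>_def fst_conv snd_conv
  proof (intro conjI allI ballI)
    fix t assume t: "t \<in> ?B"
    show "rel t (\<lambda>m. P m t) (\<lambda>m. R m t)"
      unfolding rel_def
    proof (intro conjI allI)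
      fix m j i
      show "P (m + q j) t = t $ j * P m t"
        by (rule ident[OF hP _ _ t]) (use relV in \<open>auto simp: rel_def intro!: holo_on_mult hP\<close>)
      show "R (m + q j) t = t $ j * R m t"
        by (rule ident[OF hR _ _ t]) (use relV in \<open>auto simp: rel_def intro!: holo_on_mult hR\<close>)
      show "(\<Sum>a\<in>lsupp f. f a * R (m + a) t) = P m t"
        by (rule ident[where \<phi>="\<lambda>t. \<Sum>a\<in>lsupp f. f a * R (m + a) t" and \<psi>="P m"])
           (use relV t hP in \<open>auto simp: rel_def intro!: holo_on_sum holo_on_mult hR\<close>)
      show "of_int (idot (orth i) m) * P m t = (\<Sum>a\<in>lsupp f. f a * of_int (idot (orth i) a) * R (m + a) t)"
        by (rule ident[where \<phi>="\<lambda>t. of_int (idot (orth i) m) * P m t" and \<psi>="\<lambda>t. \<Sum>a\<in>lsupp f. f a * of_int (idot (orth i) a) * R (m + a) t"])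
           (use relV t in \<open>auto simp: rel_def intro!: holo_on_sum holo_on_mult hR hP\<close>)
    qed
    fix m
    have "dderiv (P m) t = euler_deriv t (\<lambda>m. P m t) (\<lambda>m. R m t) m"
    proof
      fix x
      show "dderiv (P m) t x = euler_deriv t (\<lambda>m. P m t) (\<lambda>m. R m t) m x"
      proof (rule ident[where \<phi>="\<lambda>t. dderiv (P m) t x" and \<psi>="\<lambda>t. euler_deriv t (\<lambda>m. P m t) (\<lambda>m. R m t) m x"])
        show "holo_on ?B (\<lambda>t. dderiv (P m) t x)" by (rule holo_on_dderiv[OF open_ball hP])
        have "t $ l \<noteq> 0" if "t \<in> ?B" for t :: "complex^'r" and l using that BT by (auto simp: torus_def)
        then show "holo_on ?B (\<lambda>t. euler_deriv t (\<lambda>m. P m t) (\<lambda>m. R m t) m x)"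
          unfolding euler_deriv_def using D_nonzero
          by (intro holo_on_sum holo_on_mult holo_on_divide holo_on_diff hP hR) auto
        show "t \<in> ?B" by (rule t)
        fix t assume t: "t \<in> ?V"
        have "dderiv (P m) t = dderiv (\<lambda>t. fst (\<Phi> t) m) t"
          by (rule dderiv_cong[OF familyD(2)[OF famV] open_ball PV t])
        also have "\<dots> = euler_deriv t (fst (\<Phi> t)) (snd (\<Phi> t)) m" by (rule dderiv_eqI[OF familyD(5)[OF famV t]])
        finally show "dderiv (P m) t x = euler_deriv t (\<lambda>m. P m t) (\<lambda>m. R m t) m x"
          using PV[OF t] RV[OF t] by simp
      qed
    qed
    then show "((\<lambda>t. P m t) has_derivative euler_deriv t (\<lambda>m. P m t) (\<lambda>m. R m t) m) (at t)"
      using holo_on_has_derivative[OF hP t, of m] by simp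
  qed (use BT hP hR in auto)
  then show thesis by (rule that[OF _ \<rho>(1,2) \<Psi>V])
qed

text \<open>One \<open>\<epsilon>\<close> serves two kinds of extension. The second keeps an
  identity between the family and a function \<open>d\<close>, and is used with \<open>d\<close> the
  diagonal inside its domain of convergence; the first continues the family alone, beyond that
  domain.\<close>

lemma family_local_extension:
  fixes M :: "(int^'n) set" and g :: "int^'n \<Rightarrow> complex"
  assumes ne: "lsupp f \<noteq> {}" and el: "elim_data h E K" and t1: "t1 \<in> torus" "h t1 \<noteq> 0"
    and G: "open G" "t1 \<in> G" "holo_on G d"
  defines "Adm \<equiv> \<lambda>U \<Phi>. family U \<Phi> \<and> (\<forall>t\<in>U. (\<Sum>m\<in>M. g m * fst (\<Phi> t) m) = d t)"
  shows "\<exists>\<epsilon>>0. ball t1 \<epsilon> \<subseteq> G \<and> (\<forall>t\<in>ball t1 \<epsilon>. \<forall>\<Phi>.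
    ((\<exists>\<delta>>0. family (ball t \<delta>) \<Phi>) \<longrightarrow> (\<exists>\<Psi>. family (ball t1 \<epsilon>) \<Psi> \<and> (\<forall>\<^sub>F w in nhds t. \<Psi> w = \<Phi> w))) \<and>
    ((\<exists>\<delta>>0. Adm (ball t \<delta>) \<Phi>) \<longrightarrow> (\<exists>\<Psi>. Adm (ball t1 \<epsilon>) \<Psi> \<and> (\<forall>\<^sub>F w in nhds t. \<Psi> w = \<Phi> w))))"
proof -
  have h: "holo_on torus h" using el by (simp add: elim_data_def)
  have "open {t \<in> torus. h t \<noteq> 0}"
  proof -
    have "open (torus \<inter> h -` (- {0}))"
      by (rule continuous_open_preimage[OF holo_on_continuous[OF h] open_torus]) auto
    moreover have "torus \<inter> h -` (- {0}) = {t \<in> torus. h t \<noteq> 0}" by auto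
    ultimately show ?thesis by simp
  qed
  then have "open ({t \<in> torus. h t \<noteq> 0} \<inter> G)" using G(1) by (rule open_Int)
  moreover have "t1 \<in> {t \<in> torus. h t \<noteq> 0} \<inter> G" using t1 G by simp
  ultimately obtain \<epsilon> where \<epsilon>: "\<epsilon> > 0" "cball t1 \<epsilon> \<subseteq> {t \<in> torus. h t \<noteq> 0} \<inter> G"
    using open_contains_cball by blast
  have B: "cball t1 \<epsilon> \<subseteq> torus" "\<And>t. t \<in> cball t1 \<epsilon> \<Longrightarrow> h t \<noteq> 0" using \<epsilon>(2) by auto
  have BG: "ball t1 \<epsilon> \<subseteq> G" using \<epsilon>(2) by auto
  have near: "\<forall>\<^sub>F w in nhds t. \<Psi> w = \<Phi> w" if "\<rho> > 0" "\<And>w. w \<in> ball t \<rho> \<Longrightarrow> \<Psi> w = \<Phi> w"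
    for t \<rho> and \<Psi> \<Phi> :: "complex^'r \<Rightarrow> (int^'n \<Rightarrow> complex) \<times> (int^'n \<Rightarrow> complex)"
  proof -
    have "\<forall>\<^sub>F w in nhds t. w \<in> ball t \<rho>" using that(1) by (intro eventually_nhds_in_open) auto
    then show ?thesis by eventually_elim (rule that(2))
  qed
  show ?thesis
  proof (intro exI[of _ \<epsilon>] conjI ballI allI impI)
    fix t \<Phi> assume t: "t \<in> ball t1 \<epsilon>" and "\<exists>\<delta>>0. family (ball t \<delta>) \<Phi>"
    then obtain \<delta> where \<delta>: "\<delta> > 0" "family (ball t \<delta>) \<Phi>" by blast
    from family_extension[OF ne el B t this] near
    show "\<exists>\<Psi>. family (ball t1 \<epsilon>) \<Psi> \<and> (\<forall>\<^sub>F w in nhds t. \<Psi> w = \<Phi> w)" by metis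
  next
    fix t \<Phi> assume t: "t \<in> ball t1 \<epsilon>" and "\<exists>\<delta>>0. Adm (ball t \<delta>) \<Phi>"
    then obtain \<delta> where \<delta>: "\<delta> > 0" "family (ball t \<delta>) \<Phi>" and d: "\<And>s. s \<in> ball t \<delta> \<Longrightarrow> (\<Sum>m\<in>M. g m * fst (\<Phi> s) m) = d s"
      unfolding Adm_def by blast
    obtain \<Psi> \<rho> where \<Psi>: "family (ball t1 \<epsilon>) \<Psi>" "\<rho> > 0" "\<rho> \<le> \<delta>" "\<And>s. s \<in> ball t \<rho> \<Longrightarrow> \<Psi> s = \<Phi> s"
      using family_extension[OF ne el B t \<delta>] by metis
    have ev: "\<forall>\<^sub>F w in nhds t. w \<in> ball t \<rho>" using \<Psi>(2) by (intro eventually_nhds_in_open) auto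
    have "(\<Sum>m\<in>M. g m * fst (\<Psi> s) m) = d s" if s: "s \<in> ball t1 \<epsilon>" for s
    proof (rule holo_eq_on_convex[OF open_ball convex_ball _ holo_on_subset[OF G(3) BG] t _ s])
      show "holo_on (ball t1 \<epsilon>) (\<lambda>s. \<Sum>m\<in>M. g m * fst (\<Psi> s) m)"
        by (intro holo_on_sum holo_on_mult holo_on_const familyD(2)[OF \<Psi>(1)])
      show "\<forall>\<^sub>F s in nhds t. (\<Sum>m\<in>M. g m * fst (\<Psi> s) m) = d s"
        using ev by eventually_elim (use \<Psi>(3,4) d in auto)
    qed
    then have "Adm (ball t1 \<epsilon>) \<Psi>" using \<Psi>(1) by (simp add: Adm_def)
    then show "\<exists>\<Psi>. Adm (ball t1 \<epsilon>) \<Psi> \<and> (\<forall>\<^sub>F w in nhds t. \<Psi> w = \<Phi> w)"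
      using near[of \<rho> t \<Psi> \<Phi>] \<Psi>(2,4) by blast
  qed (use \<epsilon>(1) BG in auto)
qed

end

section \<open>Averaging over compact tori\<close>

text \<open>Logarithmic coordinates: the Laurent monomial \<open>z^m\<close> at \<open>z = exp \<xi>\<close> is \<open>exp (cdot m \<xi>)\<close>.\<close>

definition cdot :: "int^'n::finite \<Rightarrow> complex^'n \<Rightarrow> complex" where
  "cdot m x = (\<Sum>i\<in>UNIV. of_int (m $ i) * x $ i)"

definition cvec :: "int^'n::finite \<Rightarrow> complex^'n" where
  "cvec v = (\<chi> i. of_int (v $ i))"

definition expv :: "complex^'n::finite \<Rightarrow> complex^'n" where
  "expv \<xi> = (\<chi> i. exp (\<xi> $ i))"

definition Re_vec :: "complex^'n::finite \<Rightarrow> real^'n" where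
  "Re_vec \<xi> = (\<chi> i. Re (\<xi> $ i))"

lemma cdot_add_right: "cdot m (x + y) = cdot m x + cdot m y"
  by (simp add: cdot_def algebra_simps sum.distrib)

lemma cdot_add_left: "cdot (m + n) x = cdot m x + cdot n x"
  by (simp add: cdot_def algebra_simps sum.distrib)

lemma cdot_cscale: "cdot m (c *s x) = c * cdot m x"
  by (simp add: cdot_def sum_distrib_left mult_ac)

lemma cdot_sum_right: "cdot m (\<Sum>l\<in>A. x l) = (\<Sum>l\<in>A. cdot m (x l))"
proof (induction A rule: infinite_finite_induct)
  case (insert l A)
  then show ?case by (simp add: cdot_add_right)
qed (simp_all add: cdot_def)

lemma cdot_cvec: "cdot m (cvec v) = of_int (idot m v)"
  by (simp add: cdot_def cvec_def idot_def)

lemma expv_torus [simp]: "expv \<xi> \<in> torus" by (simp add: expv_def torus_def)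

lemma LogMap_expv: "LogMap (expv \<xi>) = Re_vec \<xi>" by (simp add: LogMap_def expv_def Re_vec_def)

lemma lmono_expv: "lmono (expv \<xi>) m = exp (cdot m \<xi>)"
  by (simp add: lmono_def expv_def cdot_def exp_sum exp_power_int mult.commute)

lemma bounded_linear_cdot: "bounded_linear (cdot m)"
proof -
  have "bounded_linear (\<lambda>x. \<Sum>i\<in>UNIV. of_int (m $ i) * x $ i :: complex)"
    by (intro bounded_linear_sum bounded_linear_compose[OF bounded_linear_mult_right bounded_linear_vec_nth])
  then show ?thesis by (simp add: cdot_def[abs_def])
qed

lemma holo_on_exp_cdot: "holo_on U (\<lambda>\<xi>. exp (cdot m \<xi>))"
proof (rule holo_onI)
  show "((\<lambda>\<xi>. exp (cdot m \<xi>)) has_derivative (\<lambda>x. exp (cdot m \<xi>) * cdot m x)) (at \<xi>)" for \<xi>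
    by (rule has_derivative_compose_field[OF bounded_linear_imp_has_derivative[OF bounded_linear_cdot] DERIV_exp])
qed (simp add: cdot_cscale)

text \<open>The average over the circle subgroup of the compact torus given by the integer vector
  \<open>v\<close>, in logarithmic coordinates. It kills the monomials with
  \<open>idot v \<alpha> \<noteq> 0\<close>; averaging over several \<open>v\<close> in turn leaves
  the exponents orthogonal to all of them.\<close>

definition tmean :: "int^'n::finite \<Rightarrow> (complex^'n \<Rightarrow> complex) \<Rightarrow> complex^'n \<Rightarrow> complex" where
  "tmean v G \<xi> = integral {0..1} (\<lambda>s. G (\<xi> + (2 * of_real pi * \<i> * of_real s) *s cvec v))"

locale tube =
  fixes T :: "(complex^'n::finite) set"
  assumes open_T: "open T" and shift_T: "\<xi> \<in> T \<Longrightarrow> \<xi> + (2 * of_real pi * \<i> * of_real s) *s cvec v \<in> T"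
begin

text \<open>Holomorphic functions on the tube that descend to its image in the complex
  torus.\<close>

definition periodic_holo :: "(complex^'n \<Rightarrow> complex) \<Rightarrow> bool" where
  "periodic_holo G \<longleftrightarrow> holo_on T G \<and> (\<forall>\<xi>\<in>T. \<forall>v. G (\<xi> + (2 * of_real pi * \<i>) *s cvec v) = G \<xi>)"

lemma tmean_cong: "\<xi> \<in> T \<Longrightarrow> (\<And>\<xi>. \<xi> \<in> T \<Longrightarrow> G \<xi> = G' \<xi>) \<Longrightarrow> tmean v G \<xi> = tmean v G' \<xi>"
  unfolding tmean_def by (intro integral_cong) (simp add: shift_T)

lemma continuous_on_shift:
  assumes "continuous_on T G" "\<xi> \<in> T"
  shows "continuous_on {0..1} (\<lambda>s. G (\<xi> + (2 * of_real pi * \<i> * of_real s) *s cvec v))"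
proof (rule continuous_on_compose2[OF assms(1)])
  show "continuous_on {0..1} (\<lambda>s. \<xi> + (2 * of_real pi * \<i> * of_real s) *s cvec v)"
    by (intro continuous_on_add continuous_on_const continuous_on_cscale continuous_on_mult continuous_on_of_real continuous_on_id)
qed (use shift_T[OF assms(2)] in auto)

lemma tmean_add:
  "continuous_on T G \<Longrightarrow> continuous_on T G' \<Longrightarrow> \<xi> \<in> T \<Longrightarrow> tmean v (\<lambda>\<xi>. G \<xi> + G' \<xi>) \<xi> = tmean v G \<xi> + tmean v G' \<xi>"
  unfolding tmean_def by (intro integral_add integrable_continuous_interval continuous_on_shift)

lemma tmean_invariant_mult:
  assumes "\<xi> \<in> T" "\<And>\<xi> s. \<xi> \<in> T \<Longrightarrow> h (\<xi> + (2 * of_real pi * \<i> * of_real s) *s cvec v) = h \<xi>"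
  shows "tmean v (\<lambda>\<xi>. h \<xi> * G \<xi>) \<xi> = h \<xi> * tmean v G \<xi>"
  unfolding tmean_def using assms by simp

lemma holo_tmean:
  assumes "holo_on T G"
  shows "holo_on T (tmean v G)" and "\<xi> \<in> T \<Longrightarrow> dderiv (tmean v G) \<xi> x = tmean v (\<lambda>\<xi>. dderiv G \<xi> x) \<xi>"
proof -
  let ?F = "\<lambda>\<xi> s. G (\<xi> + (2 * of_real pi * \<i> * of_real s) *s cvec v)"
  have eq: "tmean v G = (\<lambda>\<xi>. integral {0..1} (?F \<xi>))" by (simp add: tmean_def[abs_def])
  have hF: "holo_on T (\<lambda>\<xi>. ?F \<xi> s)" for s
    by (rule holo_on_affine[OF assms bounded_linear_ident _ shift_T]) auto
  have cF: "continuous_on (T \<times> {0..1}) (\<lambda>(\<xi>, s). ?F \<xi> s)"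
    unfolding case_prod_beta
  proof (rule continuous_on_compose2[OF holo_on_continuous[OF assms]])
    show "continuous_on (T \<times> {0..1}) (\<lambda>y. fst y + (2 * of_real pi * \<i> * of_real (snd y)) *s cvec v)"
      by (intro continuous_on_add continuous_on_const continuous_on_cscale continuous_on_mult continuous_on_of_real
          continuous_on_fst continuous_on_snd continuous_on_id)
  qed (use shift_T in auto)
  have aff: "dderiv (\<lambda>\<xi>. ?F \<xi> s) \<xi> x = dderiv G (\<xi> + (2 * of_real pi * \<i> * of_real s) *s cvec v) x" if "\<xi> \<in> T" for s \<xi> x
    by (rule dderiv_affine[OF assms bounded_linear_ident _ shift_T that]) auto
  show "holo_on T (tmean v G)" unfolding eq by (rule holo_param_integral[OF open_T hF cF])
  assume \<xi>: "\<xi> \<in> T"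
  show "dderiv (tmean v G) \<xi> x = tmean v (\<lambda>\<xi>. dderiv G \<xi> x) \<xi>"
    unfolding eq dderiv_param_integral[OF open_T hF cF \<xi>] unfolding tmean_def aff[OF \<xi>] ..
qed

lemma periodic_holo_tmean:
  assumes "periodic_holo G" shows "periodic_holo (tmean v G)"
  unfolding periodic_holo_def
proof (intro conjI ballI allI)
  show "holo_on T (tmean v G)" using assms by (auto simp: periodic_holo_def intro: holo_tmean)
  fix \<xi> u assume \<xi>: "\<xi> \<in> T"
  have "G (\<xi> + (2 * of_real pi * \<i>) *s cvec u + (2 * of_real pi * \<i> * of_real s) *s cvec v) = G (\<xi> + (2 * of_real pi * \<i> * of_real s) *s cvec v)" for s
  proof -
    have "G ((\<xi> + (2 * of_real pi * \<i> * of_real s) *s cvec v) + (2 * of_real pi * \<i>) *s cvec u) = G (\<xi> + (2 * of_real pi * \<i> * of_real s) *s cvec v)"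
      using assms shift_T[OF \<xi>] by (simp only: periodic_holo_def)
    then show ?thesis by (simp only: add_ac)
  qed
  then show "tmean v G (\<xi> + (2 * of_real pi * \<i>) *s cvec u) = tmean v G \<xi>" by (simp only: tmean_def)
qed

text \<open>Integration by parts on a circle: the derivative along \<open>v\<close> is integrated
  over the closed orbit in that direction, and the values at both ends agree by periodicity.\<close>

lemma dderiv_tmean_direction:
  assumes "periodic_holo G" "\<xi> \<in> T"
  shows "dderiv (tmean v G) \<xi> (cvec v) = 0"
proof -
  have h: "holo_on T G" using assms by (simp add: periodic_holo_def)
  let ?p = "\<lambda>s. \<xi> + (2 * of_real pi * \<i> * of_real s) *s cvec v"
  have int: "((\<lambda>s. 2 * of_real pi * \<i> * dderiv G (?p s) (cvec v)) has_integral (G (?p 1) - G (?p 0))) {0..1}"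
  proof (rule fundamental_theorem_of_calculus)
    fix s :: real assume "s \<in> {0..1}"
    have "((\<lambda>z. G (\<xi> + z *s cvec v)) has_field_derivative dderiv G (\<xi> + (2 * of_real pi * \<i> * of_real s) *s cvec v) (cvec v)) (at (2 * of_real pi * \<i> * of_real s))"
      by (rule holo_on_line[OF h shift_T[OF assms(2)]])
    moreover have "((\<lambda>s. 2 * of_real pi * \<i> * of_real s) has_vector_derivative 2 * of_real pi * \<i>) (at s within {0..1})"
      by (auto intro!: derivative_eq_intros simp: has_vector_derivative_def scaleR_conv_of_real)
    ultimately have "(((\<lambda>z. G (\<xi> + z *s cvec v)) \<circ> (\<lambda>s. 2 * of_real pi * \<i> * of_real s)) has_vector_derivative
        2 * of_real pi * \<i> * dderiv G (?p s) (cvec v)) (at s within {0..1})"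
      using field_vector_diff_chain_within[OF _ has_field_derivative_at_within] by blast
    then show "((\<lambda>s. G (?p s)) has_vector_derivative 2 * of_real pi * \<i> * dderiv G (?p s) (cvec v)) (at s within {0..1})"
      by (simp add: o_def)
  qed simp
  have "G (?p 1) = G (?p 0)" using assms unfolding periodic_holo_def by simp
  with integral_unique[OF int]
  have "integral {0..1} (\<lambda>s. (2 * of_real pi * \<i>) * dderiv G (?p s) (cvec v)) = 0" by (simp only: diff_self)
  then have "(2 * of_real pi * \<i>) * integral {0..1} (\<lambda>s. dderiv G (?p s) (cvec v)) = 0" by (simp only: integral_mult_right)
  then have "integral {0..1} (\<lambda>s. dderiv G (?p s) (cvec v)) = 0" by simp
  then show ?thesis unfolding holo_tmean(2)[OF h assms(2)] tmean_def .
qed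

definition tmeans :: "(int^'n) list \<Rightarrow> (complex^'n \<Rightarrow> complex) \<Rightarrow> complex^'n \<Rightarrow> complex" where
  "tmeans vs G = foldr tmean vs G"

lemma tmeans_simps [simp]: "tmeans [] G = G" "tmeans (v # vs) G = tmean v (tmeans vs G)"
  by (simp_all add: tmeans_def)

lemma tmeans_cong: "\<xi> \<in> T \<Longrightarrow> (\<And>\<xi>. \<xi> \<in> T \<Longrightarrow> G \<xi> = G' \<xi>) \<Longrightarrow> tmeans vs G \<xi> = tmeans vs G' \<xi>"
  by (induction vs arbitrary: \<xi>) (auto intro: tmean_cong)

lemma periodic_holo_tmeans: "periodic_holo G \<Longrightarrow> periodic_holo (tmeans vs G)"
  by (induction vs) (auto intro: periodic_holo_tmean)

lemma holo_tmeans: "holo_on T G \<Longrightarrow> holo_on T (tmeans vs G)"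
  by (induction vs) (auto intro: holo_tmean)

lemma dderiv_tmeans: "holo_on T G \<Longrightarrow> \<xi> \<in> T \<Longrightarrow> dderiv (tmeans vs G) \<xi> x = tmeans vs (\<lambda>\<xi>. dderiv G \<xi> x) \<xi>"
proof (induction vs arbitrary: \<xi>)
  case (Cons v vs)
  have "dderiv (tmeans (v # vs) G) \<xi> x = tmean v (\<lambda>\<xi>. dderiv (tmeans vs G) \<xi> x) \<xi>"
    using holo_tmean(2)[OF holo_tmeans[OF Cons.prems(1)] Cons.prems(2)] by simp
  also have "\<dots> = tmean v (tmeans vs (\<lambda>\<xi>. dderiv G \<xi> x)) \<xi>"
    by (rule tmean_cong[OF Cons.prems(2) Cons.IH[OF Cons.prems(1)]])
  finally show ?case by simp
qed simp

lemma tmeans_add: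
  assumes "holo_on T G" "holo_on T G'"
  shows "\<xi> \<in> T \<Longrightarrow> tmeans vs (\<lambda>\<xi>. G \<xi> + G' \<xi>) \<xi> = tmeans vs G \<xi> + tmeans vs G' \<xi>"
proof (induction vs arbitrary: \<xi>)
  case (Cons v vs)
  have "tmeans (v # vs) (\<lambda>\<xi>. G \<xi> + G' \<xi>) \<xi> = tmean v (\<lambda>\<xi>. tmeans vs G \<xi> + tmeans vs G' \<xi>) \<xi>"
    using tmean_cong[OF Cons.prems Cons.IH] by simp
  also have "\<dots> = tmean v (tmeans vs G) \<xi> + tmean v (tmeans vs G') \<xi>"
    by (intro tmean_add holo_on_continuous holo_tmeans assms Cons.prems)
  finally show ?case by simp
qed simp

text \<open>Meant for the monomials \<open>z^(q j)\<close>, which are constant on the orbits of the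
  vectors \<open>orth i\<close>, and for constants.\<close>

lemma tmeans_invariant_mult:
  assumes "\<And>\<xi> s v. \<xi> \<in> T \<Longrightarrow> v \<in> set vs \<Longrightarrow> h (\<xi> + (2 * of_real pi * \<i> * of_real s) *s cvec v) = h \<xi>"
  shows "\<xi> \<in> T \<Longrightarrow> tmeans vs (\<lambda>\<xi>. h \<xi> * G \<xi>) \<xi> = h \<xi> * tmeans vs G \<xi>"
  using assms
proof (induction vs arbitrary: \<xi>)
  case (Cons v vs)
  have "tmeans (v # vs) (\<lambda>\<xi>. h \<xi> * G \<xi>) \<xi> = tmean v (\<lambda>\<xi>. h \<xi> * tmeans vs G \<xi>) \<xi>"
    using tmean_cong[OF Cons.prems(1) Cons.IH] Cons.prems(2) by simp
  also have "\<dots> = h \<xi> * tmean v (tmeans vs G) \<xi>"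
    using Cons.prems by (intro tmean_invariant_mult) auto
  finally show ?case by simp
qed simp

lemma tmeans_cmult: "\<xi> \<in> T \<Longrightarrow> tmeans vs (\<lambda>\<xi>. c * G \<xi>) \<xi> = c * tmeans vs G \<xi>"
  by (rule tmeans_invariant_mult) simp_all

lemma tmeans_zero: "\<xi> \<in> T \<Longrightarrow> tmeans vs (\<lambda>\<xi>. 0) \<xi> = 0"
  using tmeans_cmult[of \<xi> vs 0 "\<lambda>_. 0"] by simp

lemma tmeans_sum:
  assumes "\<And>i. i \<in> I \<Longrightarrow> holo_on T (G i)" "\<xi> \<in> T"
  shows "tmeans vs (\<lambda>\<xi>. \<Sum>i\<in>I. c i * G i \<xi>) \<xi> = (\<Sum>i\<in>I. c i * tmeans vs (G i) \<xi>)"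
  using assms
proof (induction I rule: infinite_finite_induct)
  case (insert i I)
  have "tmeans vs (\<lambda>\<xi>. c i * G i \<xi> + (\<Sum>i\<in>I. c i * G i \<xi>)) \<xi> =
      tmeans vs (\<lambda>\<xi>. c i * G i \<xi>) \<xi> + tmeans vs (\<lambda>\<xi>. \<Sum>i\<in>I. c i * G i \<xi>) \<xi>"
    using insert.prems by (intro tmeans_add holo_on_sum holo_on_mult holo_on_const) auto
  then show ?case using insert by (simp add: tmeans_cmult)
qed (auto simp: tmeans_zero)

lemma dderiv_tmeans_direction:
  assumes "periodic_holo G" "v \<in> set vs" "\<xi> \<in> T"
  shows "dderiv (tmeans vs G) \<xi> (cvec v) = 0"
  using assms(2,3)
proof (induction vs arbitrary: \<xi>)
  case (Cons u vs)
  have per: "periodic_holo (tmeans vs G)" by (rule periodic_holo_tmeans[OF assms(1)])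
  show ?case
  proof (cases "v = u")
    case True
    then show ?thesis using dderiv_tmean_direction[OF per Cons.prems(2)] by simp
  next
    case False
    then have v: "v \<in> set vs" using Cons.prems by simp
    have "dderiv (tmean u (tmeans vs G)) \<xi> (cvec v) = tmean u (\<lambda>\<xi>. dderiv (tmeans vs G) \<xi> (cvec v)) \<xi>"
      using per Cons.prems(2) by (intro holo_tmean) (auto simp: periodic_holo_def)
    also have "\<dots> = tmean u (\<lambda>\<xi>. 0) \<xi>" by (rule tmean_cong[OF Cons.prems(2) Cons.IH[OF v]])
    also have "\<dots> = 0" by (simp add: tmean_def)
    finally show ?thesis by simp
  qed
qed simp

lemma integral_exp_int: "integral {0..1} (\<lambda>s. exp (2 * of_real pi * \<i> * of_real s * of_int k)) = (if k = 0 then 1 else 0)"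
proof (cases "k = 0")
  case False
  let ?c = "2 * of_real pi * \<i> * of_int k"
  have c: "?c \<noteq> 0" using False by simp
  have "((\<lambda>s. exp (2 * of_real pi * \<i> * of_real s * of_int k)) has_integral (exp (?c * of_real 1) / ?c - exp (?c * of_real 0) / ?c)) {0..1}"
  proof (rule fundamental_theorem_of_calculus)
    fix s :: real
    have "((\<lambda>z. exp (?c * z) / ?c) has_field_derivative exp (?c * of_real s)) (at (of_real s))"
      using c by (auto intro!: derivative_eq_intros)
    from has_vector_derivative_real_field[OF this]
    show "((\<lambda>s. exp (?c * of_real s) / ?c) has_vector_derivative exp (2 * of_real pi * \<i> * of_real s * of_int k)) (at s within {0..1})"
      by (simp add: mult_ac)
  qed simp
  moreover have "exp ?c = 1"
  proof -
    have "exp ?c = exp (of_int (2 * k) * (of_real pi * \<i>))" by (simp add: mult_ac)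
    also have "\<dots> = 1" by (subst exp_eq_1) (auto intro!: exI[of _ k])
    finally show ?thesis .
  qed
  ultimately show ?thesis using False by (simp add: integral_unique)
qed simp

text \<open>An imaginary shift leaves the norms of the terms unchanged, so the series converges
  uniformly on the orbit and may be integrated term by term; orthogonality of characters retains the
  exponents with \<open>idot v \<alpha> = 0\<close>.\<close>

lemma tmean_has_sum:
  assumes sum: "\<And>\<xi>. \<xi> \<in> T \<Longrightarrow> (\<lambda>\<alpha>. norm (c \<alpha> * exp (cdot \<alpha> \<xi>))) summable_on S"
    and G: "\<And>\<xi>. \<xi> \<in> T \<Longrightarrow> ((\<lambda>\<alpha>. c \<alpha> * exp (cdot \<alpha> \<xi>)) has_sum G \<xi>) S" and \<xi>: "\<xi> \<in> T"
  shows "((\<lambda>\<alpha>. c \<alpha> * exp (cdot \<alpha> \<xi>)) has_sum tmean v G \<xi>) {\<alpha>\<in>S. idot v \<alpha> = 0}"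
proof -
  let ?p = "\<lambda>s. \<xi> + (2 * of_real pi * \<i> * of_real s) *s cvec v"
  have trm: "exp (cdot \<alpha> (?p s)) = exp (cdot \<alpha> \<xi>) * exp (2 * of_real pi * \<i> * of_real s * of_int (idot v \<alpha>))" for \<alpha> s
    by (simp add: cdot_add_right cdot_cscale cdot_cvec exp_add idot_commute)
  have nrm: "norm (exp (2 * of_real pi * \<i> * of_real s * of_int k)) = 1" for s k by (simp add: norm_exp_eq_Re)
  have "uniform_limit {0..1} (\<lambda>X s. \<Sum>\<alpha>\<in>X. c \<alpha> * exp (cdot \<alpha> (?p s))) (\<lambda>s. \<Sum>\<^sub>\<infinity>\<alpha>\<in>S. c \<alpha> * exp (cdot \<alpha> (?p s))) (finite_subsets_at_top S)"
  proof (rule Weierstrass_m_test_general)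
    show "norm (c \<alpha> * exp (cdot \<alpha> (?p s))) \<le> norm (c \<alpha> * exp (cdot \<alpha> \<xi>))" for \<alpha> s
      unfolding trm norm_mult nrm by simp
  qed (rule sum[OF \<xi>])
  moreover have "(\<Sum>\<^sub>\<infinity>\<alpha>\<in>S. c \<alpha> * exp (cdot \<alpha> (?p s))) = G (?p s)" for s
    by (rule infsumI[OF G[OF shift_T[OF \<xi>]]])
  ultimately have ul: "uniform_limit {0..1} (\<lambda>X s. \<Sum>\<alpha>\<in>X. c \<alpha> * exp (cdot \<alpha> (?p s))) (\<lambda>s. G (?p s)) (finite_subsets_at_top S)"
    by simp
  have cont: "continuous_on {0..1} (\<lambda>s. exp (2 * of_real pi * \<i> * of_real s * of_int k))" for k
    by (intro continuous_intros)
  have contX: "continuous_on {0..1} (\<lambda>s. \<Sum>\<alpha>\<in>X. c \<alpha> * exp (cdot \<alpha> (?p s)))" for X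
    unfolding trm by (intro continuous_on_sum continuous_on_mult continuous_on_const cont)
  obtain I J where IJ: "\<And>X. ((\<lambda>s. \<Sum>\<alpha>\<in>X. c \<alpha> * exp (cdot \<alpha> (?p s))) has_integral I X) {0..1}"
    "((\<lambda>s. G (?p s)) has_integral J) {0..1}" "(I \<longlongrightarrow> J) (finite_subsets_at_top S)"
    using uniform_limit_integral[OF ul contX finite_subsets_at_top_neq_bot] by blast
  have J: "J = tmean v G \<xi>" using integral_unique[OF IJ(2)] by (simp add: tmean_def)
  let ?g = "\<lambda>\<alpha>. if idot v \<alpha> = 0 then c \<alpha> * exp (cdot \<alpha> \<xi>) else 0"
  have I: "I X = (\<Sum>\<alpha>\<in>X. ?g \<alpha>)" if "finite X" for X
  proof -
    have "I X = (\<Sum>\<alpha>\<in>X. integral {0..1} (\<lambda>s. c \<alpha> * exp (cdot \<alpha> \<xi>) * exp (2 * of_real pi * \<i> * of_real s * of_int (idot v \<alpha>))))"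
      unfolding integral_unique[OF IJ(1), symmetric] trm mult.assoc[symmetric]
      by (rule integral_sum[OF that])
         (intro integrable_continuous_interval continuous_on_mult continuous_on_const cont)
    also have "\<dots> = (\<Sum>\<alpha>\<in>X. ?g \<alpha>)"
      by (rule sum.cong) (simp_all only: integral_mult_right integral_exp_int, simp)
    finally show ?thesis .
  qed
  have "(?g has_sum J) S"
    unfolding has_sum_def
  proof (rule Lim_transform_eventually[OF IJ(3)])
    show "\<forall>\<^sub>F X in finite_subsets_at_top S. I X = sum ?g X"
      by (rule eventually_finite_subsets_at_top_weakI) (rule I)
  qed
  moreover have "(?g has_sum J) S \<longleftrightarrow> ((\<lambda>\<alpha>. c \<alpha> * exp (cdot \<alpha> \<xi>)) has_sum J) {\<alpha>\<in>S. idot v \<alpha> = 0}"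
    by (rule has_sum_cong_neutral) auto
  ultimately show ?thesis by (simp add: J)
qed

lemma tmeans_has_sum:
  assumes sum: "\<And>\<xi>. \<xi> \<in> T \<Longrightarrow> (\<lambda>\<alpha>. norm (c \<alpha> * exp (cdot \<alpha> \<xi>))) summable_on UNIV"
    and G: "\<And>\<xi>. \<xi> \<in> T \<Longrightarrow> ((\<lambda>\<alpha>. c \<alpha> * exp (cdot \<alpha> \<xi>)) has_sum G \<xi>) UNIV"
  shows "\<xi> \<in> T \<Longrightarrow> ((\<lambda>\<alpha>. c \<alpha> * exp (cdot \<alpha> \<xi>)) has_sum tmeans vs G \<xi>) {\<alpha>. \<forall>v\<in>set vs. idot v \<alpha> = 0}"
proof (induction vs arbitrary: \<xi>)
  case Nil
  then show ?case using G by simp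
next
  case (Cons v vs)
  have "((\<lambda>\<alpha>. c \<alpha> * exp (cdot \<alpha> \<xi>)) has_sum tmean v (tmeans vs G) \<xi>) {\<alpha> \<in> {\<alpha>. \<forall>v\<in>set vs. idot v \<alpha> = 0}. idot v \<alpha> = 0}"
    by (rule tmean_has_sum[OF summable_on_subset[OF sum] Cons.IH Cons.prems]) auto
  moreover have "{\<alpha> \<in> {\<alpha>. \<forall>v\<in>set vs. idot v \<alpha> = 0}. idot v \<alpha> = 0} = {\<alpha>. \<forall>v\<in>set (v # vs). idot v \<alpha> = 0}" by auto
  ultimately show ?case by simp
qed

end

section \<open>The initial family\<close>

lemma leval_expv: "finite (lsupp h) \<Longrightarrow> leval h (expv \<xi>) = (\<Sum>a\<in>lsupp h. h a * exp (cdot a \<xi>))"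
  by (simp add: leval_def lmono_expv)

lemma continuous_on_Re_vec: "continuous_on S Re_vec"
  unfolding Re_vec_def by (intro continuous_intros)

lemma Re_vec_imaginary_shift: "Re_vec (\<xi> + (2 * of_real pi * \<i> * of_real s) *s cvec v) = Re_vec \<xi>"
  by (simp add: Re_vec_def cvec_def vec_eq_iff)

lemma cdot_lat_comb: "cdot (lat_comb q k) \<xi> = (\<Sum>j\<in>UNIV. of_int (k $ j) * cdot (q j) \<xi>)"
proof -
  have "cdot (lat_comb q k) \<xi> = (\<Sum>i\<in>UNIV. \<Sum>j\<in>UNIV. of_int (k $ j) * (of_int (q j $ i) * \<xi> $ i))"
    by (simp add: cdot_def lat_comb_def sum_distrib_right mult.assoc)
  also have "\<dots> = (\<Sum>j\<in>UNIV. of_int (k $ j) * cdot (q j) \<xi>)"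
    by (subst sum.swap) (simp add: cdot_def sum_distrib_left)
  finally show ?thesis .
qed

lemma exp_cdot_lat_comb: "exp (cdot (lat_comb q k) \<xi>) = lmono (monomap q (expv \<xi>)) k"
proof -
  have "lmono (monomap q (expv \<xi>)) k = (\<Prod>j\<in>UNIV. exp (cdot (q j) \<xi>) powi (k $ j))"
    by (subst lmono_def) (simp only: monomap_def vec_lambda_beta lmono_expv)
  then show ?thesis by (simp add: cdot_lat_comb exp_sum exp_power_int)
qed

context diagonal
begin

lemma inj_lat_comb: "inj (lat_comb q)"
proof (rule injI)
  fix k k' assume eq: "lat_comb q k = lat_comb q k'"
  have "idot (w l) (lat_comb q k) = D * k $ l" for k l
  proof -
    have "idot (w l) (lat_comb q k) = (\<Sum>j\<in>UNIV. k $ j * idot (q j) (w l))"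
      unfolding lat_comb_def idot_commute[of "w l"] by (rule idot_sum_left)
    also have "\<dots> = (\<Sum>j\<in>UNIV. if j = l then D * k $ l else 0)"
      by (rule sum.cong) (auto simp: idot_commute[of "q _"] dual)
    finally show ?thesis by simp
  qed
  then show "k = k'" using eq D_nonzero by (metis mult_cancel_left vec_eq_iff)
qed

text \<open>A local section of \<open>\<xi> \<mapsto> monomap q (expv \<xi>)\<close> through
  \<open>\<xi>0\<close>. The logarithm is taken of the quotient by the value at
  \<open>\<xi>0\<close>, so that near the base point the principal branch is evaluated near
  1.\<close>

definition log_section :: "complex^'n \<Rightarrow> complex^'r \<Rightarrow> complex^'n" where
  "log_section \<xi>0 t = \<xi>0 + (\<Sum>l\<in>UNIV. (Ln (t $ l / exp (cdot (q l) \<xi>0)) / of_int D) *s cvec (w l))"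

lemma exp_cdot_log_section:
  assumes "t \<in> torus" shows "exp (cdot (q j) (log_section \<xi>0 t)) = t $ j"
proof -
  have "cdot (q j) (log_section \<xi>0 t) = cdot (q j) \<xi>0 +
      (\<Sum>l\<in>UNIV. if l = j then Ln (t $ j / exp (cdot (q j) \<xi>0)) else 0)"
    unfolding log_section_def cdot_add_right cdot_sum_right cdot_cscale cdot_cvec
    using D_nonzero by (intro arg_cong2[where f="(+)"] refl sum.cong) (auto simp: idot_commute[of "q _"] dual)
  then have "cdot (q j) (log_section \<xi>0 t) = cdot (q j) \<xi>0 + Ln (t $ j / exp (cdot (q j) \<xi>0))" by simp
  moreover have "t $ j / exp (cdot (q j) \<xi>0) \<noteq> 0" using assms by (simp add: torus_def)
  ultimately show ?thesis by (simp add: exp_add)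
qed

lemma has_derivative_log_section:
  assumes "\<And>l. Re (t $ l / exp (cdot (q l) \<xi>0)) > 0"
  shows "(log_section \<xi>0 has_derivative (\<lambda>x. \<Sum>l\<in>UNIV. (x $ l / (t $ l * of_int D)) *s cvec (w l))) (at t)"
proof -
  have "((\<lambda>t. (Ln (t $ l / exp (cdot (q l) \<xi>0)) / of_int D) *s cvec (w l)) has_derivative
      (\<lambda>x. (x $ l / (t $ l * of_int D)) *s cvec (w l))) (at t)" for l
  proof -
    let ?c = "exp (cdot (q l) \<xi>0)"
    have nz: "t $ l / ?c \<notin> \<real>\<^sub>\<le>\<^sub>0" using assms[of l] by (auto simp: complex_nonpos_Reals_iff)
    have "((\<lambda>t. t $ l / ?c) has_derivative (\<lambda>x. x $ l / ?c)) (at t)"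
      by (intro bounded_linear_imp_has_derivative bounded_linear_compose[OF bounded_linear_divide bounded_linear_vec_nth])
    from has_derivative_compose_field[OF this, OF DERIV_cdivide[OF has_field_derivative_Ln[OF nz], of "of_int D"]]
    have "((\<lambda>t. Ln (t $ l / ?c) / of_int D) has_derivative (\<lambda>x. inverse (t $ l / ?c) / of_int D * (x $ l / ?c))) (at t)" .
    moreover have "(\<lambda>x. inverse (t $ l / ?c) / of_int D * (x $ l / ?c)) = (\<lambda>x. x $ l / (t $ l * of_int D))"
      by (rule ext) (simp add: field_simps)
    ultimately have "((\<lambda>t. Ln (t $ l / ?c) / of_int D) has_derivative (\<lambda>x. x $ l / (t $ l * of_int D))) (at t)" by simp
    then show ?thesis by (rule bounded_linear.has_derivative[OF bounded_linear_cscale])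
  qed
  from has_derivative_add[OF has_derivative_const[of \<xi>0] has_derivative_sum[OF this]]
  show ?thesis unfolding log_section_def[abs_def] by simp
qed

text \<open>The averages are functions on the tube over \<open>E\<close>; composition with a local
  section makes them functions of \<open>t\<close>. Summability is part of the conclusion because it
  shows that a neighbourhood of \<open>t0\<close> lies in the domain of convergence of the
  diagonal.\<close>

lemma initial_family:
  assumes E: "open E" and nz': "\<forall>z\<in>torus. LogMap z \<in> E \<longrightarrow> leval f z \<noteq> 0"
    and lau: "laurent_expansion_on c g f E" and g: "finite (lsupp g)"
    and sat': "\<forall>\<alpha>. (\<forall>i. idot (orth i) \<alpha> = 0) \<longrightarrow> (\<exists>k. \<alpha> = lat_comb q k)"
    and \<xi>0: "Re_vec \<xi>0 \<in> E" and t0: "t0 = monomap q (expv \<xi>0)"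
  shows "\<exists>\<delta> \<Phi>. \<delta> > 0 \<and> family (ball t0 \<delta>) \<Phi> \<and>
    (\<forall>t\<in>ball t0 \<delta>. (\<Sum>m\<in>lsupp g. g m * fst (\<Phi> t) m) = diag c q t) \<and>
    (\<forall>t\<in>ball t0 \<delta>. (\<lambda>k. norm (diag_coef c q k * lmono t k)) summable_on UNIV)"
proof -
  define T where "T = {\<xi>. Re_vec \<xi> \<in> E}"
  have oT: "open T" using open_vimage[OF E continuous_on_Re_vec] by (simp add: T_def vimage_def)
  interpret tube T
  proof
    show "\<xi> + (2 * of_real pi * \<i> * of_real s) *s cvec v \<in> T" if "\<xi> \<in> T" for \<xi> s v
      using that by (simp only: T_def mem_Collect_eq Re_vec_imaginary_shift)
  qed (rule oT)
  define fe where "fe = (\<lambda>\<xi>. \<Sum>a\<in>lsupp f. f a * exp (cdot a \<xi>))"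
  have fe: "fe \<xi> = leval f (expv \<xi>)" for \<xi> by (simp add: fe_def leval_expv[OF finite_supp])
  have fe_nz: "fe \<xi> \<noteq> 0" if "\<xi> \<in> T" for \<xi>
    unfolding fe using that nz' by (auto simp: T_def LogMap_expv)
  define p where "p = (\<lambda>m \<xi>. exp (cdot m \<xi>) / fe \<xi>)"
  define r where "r = (\<lambda>m \<xi>. exp (cdot m \<xi>) / (fe \<xi> * fe \<xi>))"
  have hfe: "holo_on T fe" unfolding fe_def by (intro holo_on_sum holo_on_mult holo_on_const holo_on_exp_cdot)
  have hp: "holo_on T (p m)" for m unfolding p_def by (intro holo_on_divide holo_on_exp_cdot hfe fe_nz)
  have hr: "holo_on T (r m)" for m unfolding r_def
    by (intro holo_on_divide holo_on_exp_cdot holo_on_mult hfe) (use fe_nz in auto)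
  have per_exp: "exp (cdot m (\<xi> + (2 * of_real pi * \<i>) *s cvec v)) = exp (cdot m \<xi>)" for m \<xi> v
  proof -
    have "exp (2 * of_real pi * \<i> * of_int (idot m v)) = 1"
      by (subst exp_eq_1) (auto intro!: exI[of _ "idot m v"])
    then show ?thesis by (simp add: cdot_add_right cdot_cscale cdot_cvec exp_add)
  qed
  have per_p: "periodic_holo (p m)" for m
    unfolding periodic_holo_def using hp by (simp add: p_def fe_def per_exp)
  have inv_q: "exp (cdot (q j) (\<xi> + (2 * of_real pi * \<i> * of_real s) *s cvec v)) = exp (cdot (q j) \<xi>)"
    if "v \<in> range orth" for j \<xi> s v
  proof -
    have "idot (q j) v = 0" using that by (auto simp: idot_commute[of "q j"])
    then show ?thesis by (simp add: cdot_add_right cdot_cscale cdot_cvec)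
  qed
  \<comment> \<open>The \<open>orth i\<close> span the orthogonal complement but may be dependent;
    averaging repeatedly in dependent directions does no harm.\<close>
  obtain vs where vs: "set vs = range orth" using finite_list[of "range orth"] by auto
  define P where "P = (\<lambda>m. tmeans vs (p m))"
  define R where "R = (\<lambda>m. tmeans vs (r m))"
  have hP: "holo_on T (P m)" and hR: "holo_on T (R m)" for m
    by (simp_all add: P_def R_def holo_tmeans hp hr)
  have Pq: "P (m + q j) \<xi> = exp (cdot (q j) \<xi>) * P m \<xi>" and Rq: "R (m + q j) \<xi> = exp (cdot (q j) \<xi>) * R m \<xi>" if \<xi>: "\<xi> \<in> T" for m j \<xi>
  proof -
    have 1: "p (m + q j) = (\<lambda>\<xi>. exp (cdot (q j) \<xi>) * p m \<xi>)" "r (m + q j) = (\<lambda>\<xi>. exp (cdot (q j) \<xi>) * r m \<xi>)"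
      by (simp_all add: p_def r_def cdot_add_left exp_add fun_eq_iff)
    show "P (m + q j) \<xi> = exp (cdot (q j) \<xi>) * P m \<xi>" "R (m + q j) \<xi> = exp (cdot (q j) \<xi>) * R m \<xi>"
      unfolding P_def R_def 1 by (rule tmeans_invariant_mult[OF inv_q \<xi>], simp add: vs)+
  qed
  have shift_sum: "(\<Sum>a\<in>lsupp f. f a * r (m + a) \<xi>) = p m \<xi>" if "\<xi> \<in> T" for m \<xi>
  proof -
    have "(\<Sum>a\<in>lsupp f. f a * r (m + a) \<xi>) = exp (cdot m \<xi>) * fe \<xi> / (fe \<xi> * fe \<xi>)"
      by (simp add: r_def cdot_add_left exp_add fe_def sum_distrib_left sum_divide_distrib mult_ac)
    then show ?thesis using fe_nz[OF that] by (simp add: p_def)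
  qed
  have RP: "(\<Sum>a\<in>lsupp f. f a * R (m + a) \<xi>) = P m \<xi>" if \<xi>: "\<xi> \<in> T" for m \<xi>
  proof -
    have "(\<Sum>a\<in>lsupp f. f a * R (m + a) \<xi>) = tmeans vs (\<lambda>\<xi>. \<Sum>a\<in>lsupp f. f a * r (m + a) \<xi>) \<xi>"
      unfolding R_def by (rule tmeans_sum[OF hr \<xi>, symmetric])
    also have "\<dots> = P m \<xi>" unfolding P_def by (rule tmeans_cong[OF \<xi> shift_sum])
    finally show ?thesis .
  qed
  \<comment> \<open>The derivative of \<open>z^m / f\<close> stays in the span of the
    \<open>p\<close> and \<open>r\<close>: differentiating the denominator puts \<open>f^2\<close>
    below and the exponents of \<open>f\<close> above.\<close>
  have dp: "dderiv (p m) \<xi> x = cdot m x * p m \<xi> + (\<Sum>a\<in>lsupp f. - (f a * cdot a x) * r (m + a) \<xi>)" if \<xi>: "\<xi> \<in> T" for m \<xi> x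
  proof -
    have e: "((\<lambda>\<xi>. exp (cdot m \<xi>)) has_derivative (\<lambda>x. exp (cdot m \<xi>) * cdot m x)) (at \<xi>)" for m
      by (rule has_derivative_compose_field[OF bounded_linear_imp_has_derivative[OF bounded_linear_cdot] DERIV_exp])
    have dfe: "(fe has_derivative (\<lambda>x. \<Sum>a\<in>lsupp f. f a * (exp (cdot a \<xi>) * cdot a x))) (at \<xi>)"
      unfolding fe_def by (intro has_derivative_sum has_derivative_mult_right e)
    have "dderiv (p m) \<xi> x = (exp (cdot m \<xi>) * cdot m x * fe \<xi> - exp (cdot m \<xi>) * (\<Sum>a\<in>lsupp f. f a * (exp (cdot a \<xi>) * cdot a x))) / (fe \<xi> * fe \<xi>)"
      unfolding p_def by (subst dderiv_eqI[OF has_derivative_divide'[OF e dfe fe_nz[OF \<xi>]]]) simp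
    also have "\<dots> = cdot m x * (exp (cdot m \<xi>) * fe \<xi> / (fe \<xi> * fe \<xi>)) +
        - (exp (cdot m \<xi>) * (\<Sum>a\<in>lsupp f. f a * (exp (cdot a \<xi>) * cdot a x)) / (fe \<xi> * fe \<xi>))"
      by (simp add: diff_divide_distrib mult_ac)
    also have "exp (cdot m \<xi>) * fe \<xi> / (fe \<xi> * fe \<xi>) = p m \<xi>" using fe_nz[OF \<xi>] by (simp add: p_def)
    also have "- (exp (cdot m \<xi>) * (\<Sum>a\<in>lsupp f. f a * (exp (cdot a \<xi>) * cdot a x)) / (fe \<xi> * fe \<xi>)) =
        (\<Sum>a\<in>lsupp f. - (f a * cdot a x) * r (m + a) \<xi>)"
      unfolding sum_distrib_left sum_divide_distrib sum_negf[symmetric]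
      by (rule sum.cong) (simp_all add: r_def cdot_add_left exp_add)
    finally show ?thesis .
  qed
  have dP: "dderiv (P m) \<xi> x = cdot m x * P m \<xi> - (\<Sum>a\<in>lsupp f. f a * cdot a x * R (m + a) \<xi>)" if \<xi>: "\<xi> \<in> T" for m \<xi> x
  proof -
    have "dderiv (P m) \<xi> x = tmeans vs (\<lambda>\<xi>. dderiv (p m) \<xi> x) \<xi>" unfolding P_def by (rule dderiv_tmeans[OF hp \<xi>])
    also have "\<dots> = tmeans vs (\<lambda>\<xi>. cdot m x * p m \<xi> + (\<Sum>a\<in>lsupp f. - (f a * cdot a x) * r (m + a) \<xi>)) \<xi>"
      by (rule tmeans_cong[OF \<xi> dp])
    also have "\<dots> = tmeans vs (\<lambda>\<xi>. cdot m x * p m \<xi>) \<xi> + tmeans vs (\<lambda>\<xi>. \<Sum>a\<in>lsupp f. - (f a * cdot a x) * r (m + a) \<xi>) \<xi>"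
      by (intro tmeans_add holo_on_mult holo_on_sum holo_on_const hp hr \<xi>)
    also have "\<dots> = cdot m x * P m \<xi> + (\<Sum>a\<in>lsupp f. - (f a * cdot a x) * R (m + a) \<xi>)"
      unfolding P_def R_def tmeans_cmult[OF \<xi>] tmeans_sum[OF hr \<xi>] ..
    finally show ?thesis by (simp add: sum_negf)
  qed
  have orthP: "of_int (idot (orth i) m) * P m \<xi> = (\<Sum>a\<in>lsupp f. f a * of_int (idot (orth i) a) * R (m + a) \<xi>)" if \<xi>: "\<xi> \<in> T" for m i \<xi>
  proof -
    \<comment> \<open>The vanishing derivative along \<open>orth i\<close>, inserted into
      \<open>dP\<close>, is the last clause of \<open>rel\<close>.\<close>
    have "dderiv (P m) \<xi> (cvec (orth i)) = 0" unfolding P_def by (rule dderiv_tmeans_direction[OF per_p _ \<xi>]) (simp add: vs)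
    then show ?thesis unfolding dP[OF \<xi>] cdot_cvec by (simp add: idot_commute[of "orth i"])
  qed
  have t0_nth: "t0 $ l = exp (cdot (q l) \<xi>0)" for l by (simp add: t0 monomap_def lmono_expv)
  let ?\<psi> = "log_section \<xi>0"
  \<comment> \<open>Quotients in the open right half-plane avoid the branch cut of
    \<open>Ln\<close>.\<close>
  define U where "U = (\<Inter>l. {t. Re (t $ l / exp (cdot (q l) \<xi>0)) > 0})"
  have oU: "open U" unfolding U_def
    by (intro open_INT finite ballI open_Collect_less continuous_intros) auto
  have UT: "t \<in> torus" if "t \<in> U" for t
  proof -
    have "t $ l \<noteq> 0" for l
    proof
      assume "t $ l = 0"
      moreover have "Re (t $ l / exp (cdot (q l) \<xi>0)) > 0" using that by (auto simp: U_def)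
      ultimately show False by simp
    qed
    then show ?thesis by (simp add: torus_def)
  qed
  have d\<psi>: "(?\<psi> has_derivative (\<lambda>x. \<Sum>l\<in>UNIV. (x $ l / (t $ l * of_int D)) *s cvec (w l))) (at t)" if "t \<in> U" for t
    using that by (intro has_derivative_log_section) (auto simp: U_def)
  have "continuous_on U ?\<psi>"
    by (intro continuous_at_imp_continuous_on ballI) (rule has_derivative_continuous[OF d\<psi>])
  then have "open (U \<inter> ?\<psi> -` T)" using oU open_T by (rule continuous_open_preimage)
  moreover have "t0 \<in> U \<inter> ?\<psi> -` T" using \<xi>0 by (simp add: U_def t0_nth log_section_def T_def)
  ultimately obtain \<delta> where \<delta>: "\<delta> > 0" "ball t0 \<delta> \<subseteq> U \<inter> ?\<psi> -` T" using open_contains_ball by blast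
  have B: "t \<in> U" "t \<in> torus" "?\<psi> t \<in> T" if "t \<in> ball t0 \<delta>" for t using \<delta>(2) that UT by auto
  have chain: "((\<lambda>t. G (?\<psi> t)) has_derivative (\<lambda>x. dderiv G (?\<psi> t) (\<Sum>l\<in>UNIV. (x $ l / (t $ l * of_int D)) *s cvec (w l)))) (at t)"
    if "holo_on T G" "t \<in> ball t0 \<delta>" for G t
    using has_derivative_compose[OF d\<psi>[OF B(1)[OF that(2)]] holo_on_has_derivative[OF that(1) B(3)[OF that(2)]]] .
  have hcomp: "holo_on (ball t0 \<delta>) (\<lambda>t. G (?\<psi> t))" if "holo_on T G" for G
  proof (rule holo_onI[OF chain[OF that]])
    fix t cc x assume t: "t \<in> ball t0 \<delta>"
    have "(\<Sum>l\<in>UNIV. ((cc *s x) $ l / (t $ l * of_int D)) *s cvec (w l)) = cc *s (\<Sum>l\<in>UNIV. (x $ l / (t $ l * of_int D)) *s cvec (w l))"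
      by (simp add: vec_eq_iff sum_distrib_left mult_ac)
    then show "dderiv G (?\<psi> t) (\<Sum>l\<in>UNIV. ((cc *s x) $ l / (t $ l * of_int D)) *s cvec (w l)) =
        cc * dderiv G (?\<psi> t) (\<Sum>l\<in>UNIV. (x $ l / (t $ l * of_int D)) *s cvec (w l))"
      using holo_on_dderiv_cscale[OF that B(3)[OF t]] by simp
  qed
  define \<Phi> where "\<Phi> = (\<lambda>t. (\<lambda>m. P m (?\<psi> t), \<lambda>m. R m (?\<psi> t)))"
  have fam: "family (ball t0 \<delta>) \<Phi>"
    unfolding family_def \<Phi>_def fst_conv snd_conv
  proof (intro conjI allI ballI)
    show "ball t0 \<delta> \<subseteq> torus" using B(2) by blast
    show "holo_on (ball t0 \<delta>) (\<lambda>t. P m (?\<psi> t))" "holo_on (ball t0 \<delta>) (\<lambda>t. R m (?\<psi> t))" for m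
      by (rule hcomp[OF hP], rule hcomp[OF hR])
    fix t assume t: "t \<in> ball t0 \<delta>"
    note \<psi>T = B(3)[OF t]
    show "rel t (\<lambda>m. P m (?\<psi> t)) (\<lambda>m. R m (?\<psi> t))"
      unfolding rel_def using Pq[OF \<psi>T] Rq[OF \<psi>T] RP[OF \<psi>T] orthP[OF \<psi>T] exp_cdot_log_section[OF B(2)[OF t]] by simp
    fix m
    have "dderiv (P m) (?\<psi> t) (\<Sum>l\<in>UNIV. (x $ l / (t $ l * of_int D)) *s cvec (w l)) =
        euler_deriv t (\<lambda>m. P m (?\<psi> t)) (\<lambda>m. R m (?\<psi> t)) m x" for x
    proof -
      define k where "k = (\<lambda>l. x $ l / (t $ l * of_int D))"
      have cd: "cdot m (\<Sum>l\<in>UNIV. k l *s cvec (w l)) = (\<Sum>l\<in>UNIV. k l * of_int (idot (w l) m))" for m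
        by (simp add: cdot_sum_right cdot_cscale cdot_cvec idot_commute[of m])
      have "dderiv (P m) (?\<psi> t) (\<Sum>l\<in>UNIV. k l *s cvec (w l)) = (\<Sum>l\<in>UNIV. k l * of_int (idot (w l) m)) * P m (?\<psi> t) -
          (\<Sum>a\<in>lsupp f. f a * (\<Sum>l\<in>UNIV. k l * of_int (idot (w l) a)) * R (m + a) (?\<psi> t))"
        unfolding dP[OF \<psi>T] cd ..
      also have "(\<Sum>a\<in>lsupp f. f a * (\<Sum>l\<in>UNIV. k l * of_int (idot (w l) a)) * R (m + a) (?\<psi> t)) =
          (\<Sum>a\<in>lsupp f. \<Sum>l\<in>UNIV. k l * (f a * of_int (idot (w l) a) * R (m + a) (?\<psi> t)))"
        by (simp add: sum_distrib_left sum_distrib_right mult_ac)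
      also have "\<dots> = (\<Sum>l\<in>UNIV. k l * (\<Sum>a\<in>lsupp f. f a * of_int (idot (w l) a) * R (m + a) (?\<psi> t)))"
        by (subst sum.swap) (simp add: sum_distrib_left)
      also have "(\<Sum>l\<in>UNIV. k l * of_int (idot (w l) m)) * P m (?\<psi> t) - \<dots> =
          (\<Sum>l\<in>UNIV. k l * (of_int (idot (w l) m) * P m (?\<psi> t) - (\<Sum>a\<in>lsupp f. f a * of_int (idot (w l) a) * R (m + a) (?\<psi> t))))"
        by (simp add: right_diff_distrib sum_subtractf sum_distrib_right mult.assoc)
      finally show ?thesis unfolding euler_deriv_def k_def .
    qed
    then have "(\<lambda>x. dderiv (P m) (?\<psi> t) (\<Sum>l\<in>UNIV. (x $ l / (t $ l * of_int D)) *s cvec (w l))) =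
        euler_deriv t (\<lambda>m. P m (?\<psi> t)) (\<lambda>m. R m (?\<psi> t)) m" by (rule ext)
    with chain[OF hP t, of m]
    show "((\<lambda>t. P m (?\<psi> t)) has_derivative euler_deriv t (\<lambda>m. P m (?\<psi> t)) (\<lambda>m. R m (?\<psi> t)) m) (at t)" by simp
  qed
  have sums: "(\<lambda>\<alpha>. norm (c \<alpha> * exp (cdot \<alpha> \<xi>))) summable_on UNIV"
    "((\<lambda>\<alpha>. c \<alpha> * exp (cdot \<alpha> \<xi>)) has_sum (leval g (expv \<xi>) / leval f (expv \<xi>))) UNIV" if "\<xi> \<in> T" for \<xi>
    using lau that unfolding laurent_expansion_on_def T_def
    by (auto simp: LogMap_expv lmono_expv dest!: bspec[of _ _ "expv \<xi>"])
  \<comment> \<open>The exponents that survive averaging are those of the diagonal; saturation of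
    the lattice enters here, through \<open>sat'\<close>.\<close>
  have orth_set: "{\<alpha>. \<forall>v\<in>set vs. idot v \<alpha> = 0} = range (lat_comb q)"
  proof -
    have "idot (orth i) (lat_comb q k) = 0" for i k
    proof -
      have "idot (orth i) (lat_comb q k) = (\<Sum>j\<in>UNIV. k $ j * idot (q j) (orth i))"
        unfolding lat_comb_def idot_commute[of "orth i"] by (rule idot_sum_left)
      then show ?thesis by (simp add: idot_commute[of "q _"])
    qed
    moreover have "\<alpha> \<in> range (lat_comb q)" if "\<forall>v\<in>set vs. idot v \<alpha> = 0" for \<alpha>
      using spec[OF sat', of \<alpha>] that by (auto simp: vs)
    ultimately show ?thesis by (auto simp: vs)
  qed
  have mm: "monomap q (expv (?\<psi> t)) = t" if "t \<in> ball t0 \<delta>" for t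
    using exp_cdot_log_section[OF B(2)[OF that]] by (simp add: monomap_def lmono_expv vec_eq_iff)
  have diag_term: "c (lat_comb q k) * exp (cdot (lat_comb q k) (?\<psi> t)) = diag_coef c q k * lmono t k" if "t \<in> ball t0 \<delta>" for t k
    by (simp add: diag_coef_def exp_cdot_lat_comb mm[OF that])
  have sum_eq: "(\<Sum>m\<in>lsupp g. g m * fst (\<Phi> t) m) = diag c q t" if t: "t \<in> ball t0 \<delta>" for t
  proof -
    note \<psi>T = B(3)[OF t]
    have gp: "(\<Sum>m\<in>lsupp g. g m * p m \<xi>) = leval g (expv \<xi>) / leval f (expv \<xi>)" for \<xi>
      by (simp add: p_def fe leval_expv[OF g] sum_divide_distrib)
    have "(\<Sum>m\<in>lsupp g. g m * fst (\<Phi> t) m) = tmeans vs (\<lambda>\<xi>. \<Sum>m\<in>lsupp g. g m * p m \<xi>) (?\<psi> t)"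
      unfolding \<Phi>_def fst_conv P_def by (rule tmeans_sum[OF hp \<psi>T, symmetric])
    moreover have "((\<lambda>\<alpha>. c \<alpha> * exp (cdot \<alpha> (?\<psi> t))) has_sum tmeans vs (\<lambda>\<xi>. \<Sum>m\<in>lsupp g. g m * p m \<xi>) (?\<psi> t)) (range (lat_comb q))"
      unfolding gp orth_set[symmetric] by (rule tmeans_has_sum[OF sums \<psi>T])
    ultimately have "((\<lambda>\<alpha>. c \<alpha> * exp (cdot \<alpha> (?\<psi> t))) has_sum (\<Sum>m\<in>lsupp g. g m * fst (\<Phi> t) m)) (range (lat_comb q))" by simp
    then have "((\<lambda>\<alpha>. c \<alpha> * exp (cdot \<alpha> (?\<psi> t))) \<circ> lat_comb q has_sum (\<Sum>m\<in>lsupp g. g m * fst (\<Phi> t) m)) UNIV"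
      by (subst (asm) has_sum_reindex[OF inj_lat_comb])
    then have "((\<lambda>k. diag_coef c q k * lmono t k) has_sum (\<Sum>m\<in>lsupp g. g m * fst (\<Phi> t) m)) UNIV"
      by (simp add: o_def diag_term[OF t])
    then show ?thesis unfolding diag_def by (rule infsumI[symmetric])
  qed
  have summ: "(\<lambda>k. norm (diag_coef c q k * lmono t k)) summable_on UNIV" if t: "t \<in> ball t0 \<delta>" for t
  proof -
    have "(\<lambda>\<alpha>. norm (c \<alpha> * exp (cdot \<alpha> (?\<psi> t)))) summable_on range (lat_comb q)"
      by (rule summable_on_subset[OF sums(1)[OF B(3)[OF t]]]) simp
    then have "(\<lambda>\<alpha>. norm (c \<alpha> * exp (cdot \<alpha> (?\<psi> t)))) \<circ> lat_comb q summable_on UNIV"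
      by (subst (asm) summable_on_reindex[OF inj_lat_comb])
    then show ?thesis by (simp add: o_def diag_term[OF t] del: norm_mult)
  qed
  show ?thesis using \<delta>(1) fam sum_eq summ by (intro exI[of _ \<delta>] exI[of _ \<Phi>] conjI ballI)
qed

end

section \<open>Amoebas and domains of convergence\<close>

lemma expv_Ln: "z \<in> torus \<Longrightarrow> expv (\<chi> i. Ln (z $ i)) = z"
  by (simp add: expv_def torus_def vec_eq_iff)

text \<open>Arguments can be restricted to a compact cube of side \<open>2 * pi\<close>, and the
  amoeba is the projection along this cube of a closed set.\<close>

lemma closed_amoeba:
  assumes "finite (lsupp f)" shows "closed (amoeba f)"
proof -
  let ?\<xi> = "\<lambda>\<theta> x. (\<chi> i. of_real (x $ i) + \<i> * of_real (\<theta> $ i)) :: complex^'a"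
  let ?S = "cbox (\<chi> i. - pi) (\<chi> i. pi) :: (real^'a) set"
  let ?T = "{p :: (real^'a) \<times> (real^'a). (\<Sum>a\<in>lsupp f. f a * exp (\<Sum>i\<in>UNIV. of_int (a $ i) * (of_real (snd p $ i) + \<i> * of_real (fst p $ i)))) = 0}"
  have "closed ?T" by (intro closed_Collect_eq continuous_intros)
  then have "closed {x. \<exists>\<theta>. \<theta> \<in> ?S \<and> (\<theta>, x) \<in> ?T}" by (rule closed_compact_projection[OF compact_cbox])
  moreover have mem: "(\<theta>, x) \<in> ?T \<longleftrightarrow> leval f (expv (?\<xi> \<theta> x)) = 0" for \<theta> x
    by (simp add: leval_expv[OF assms] cdot_def)
  have "{x. \<exists>\<theta>. \<theta> \<in> ?S \<and> (\<theta>, x) \<in> ?T} = amoeba f"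
  proof (intro equalityI subsetI)
    fix x assume "x \<in> {x. \<exists>\<theta>. \<theta> \<in> ?S \<and> (\<theta>, x) \<in> ?T}"
    then obtain \<theta> where "leval f (expv (?\<xi> \<theta> x)) = 0" unfolding mem by blast
    moreover have "LogMap (expv (?\<xi> \<theta> x)) = x" by (simp add: LogMap_expv Re_vec_def vec_eq_iff)
    ultimately show "x \<in> amoeba f" unfolding amoeba_def Ztor_def by (intro image_eqI[of _ _ "expv (?\<xi> \<theta> x)"]) auto
  next
    fix x assume "x \<in> amoeba f"
    then obtain z where z: "z \<in> torus" "leval f z = 0" "x = LogMap z" by (auto simp: amoeba_def Ztor_def)
    let ?\<theta> = "\<chi> i. Im (Ln (z $ i))"
    have zi: "z $ i \<noteq> 0" for i using z(1) by (simp add: torus_def)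
    have "?\<xi> ?\<theta> x = (\<chi> i. Ln (z $ i))"
      unfolding vec_eq_iff using zi by (simp add: z(3) LogMap_def complex_eq_iff Re_Ln)
    then have "(?\<theta>, x) \<in> ?T" unfolding mem using z expv_Ln[OF z(1)] by simp
    moreover have "?\<theta> \<in> ?S" unfolding mem_box_cart
      using mpi_less_Im_Ln[OF zi] Im_Ln_le_pi[OF zi] by (auto intro: less_imp_le)
    ultimately show "x \<in> {x. \<exists>\<theta>. \<theta> \<in> ?S \<and> (\<theta>, x) \<in> ?T}" by blast
  qed
  ultimately show ?thesis by simp
qed

section \<open>Domains of convergence in logarithmic coordinates\<close>

definition log_domain :: "(int^'r::finite \<Rightarrow> complex) \<Rightarrow> (real^'r) set" where
  "log_domain d = {x. (\<lambda>k. norm (d k) * exp (\<Sum>j\<in>UNIV. of_int (k $ j) * x $ j)) summable_on UNIV}"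

lemma norm_lmono: "t \<in> torus \<Longrightarrow> norm (lmono t k) = exp (\<Sum>j\<in>UNIV. of_int (k $ j) * LogMap t $ j)"
proof -
  assume t: "t \<in> torus"
  have "norm (lmono t k) = Re (exp (of_real (\<Sum>j\<in>UNIV. of_int (k $ j) * LogMap t $ j)))"
  proof -
    have "norm (lmono (expv (\<chi> j. Ln (t $ j))) k) = exp (Re (cdot k (\<chi> j. Ln (t $ j))))"
      by (simp add: lmono_expv)
    moreover have "Re (Ln (t $ j)) = LogMap t $ j" for j using t by (simp add: LogMap_def torus_def)
    ultimately show ?thesis using t by (simp add: expv_Ln cdot_def Re_exp)
  qed
  then show ?thesis by (simp add: Re_exp)
qed

text \<open>The exponential at a convex combination is at most the larger, hence at most the sum, of
  those at the end points.\<close>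

lemma convex_log_domain: "convex (log_domain d)"
  unfolding convex_def
proof (intro ballI allI impI)
  fix x y and u v :: real assume xy: "x \<in> log_domain d" "y \<in> log_domain d" and uv: "0 \<le> u" "0 \<le> v" "u + v = 1"
  let ?e = "\<lambda>(x::real^'a) (k::int^'a). \<Sum>j\<in>UNIV. of_int (k $ j) * x $ j"
  have "(\<lambda>k. norm (d k) * exp (?e (u *\<^sub>R x + v *\<^sub>R y) k)) summable_on UNIV"
  proof (rule summable_on_comparison_test[OF summable_on_add])
    show "(\<lambda>k. norm (d k) * exp (?e x k)) summable_on UNIV" "(\<lambda>k. norm (d k) * exp (?e y k)) summable_on UNIV"
      using xy by (simp_all add: log_domain_def)
    fix k
    have "?e (u *\<^sub>R x + v *\<^sub>R y) k = u * ?e x k + v * ?e y k"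
      by (simp add: algebra_simps sum.distrib sum_distrib_left)
    also have "\<dots> \<le> u * max (?e x k) (?e y k) + v * max (?e x k) (?e y k)"
      using uv by (intro add_mono mult_left_mono) auto
    also have "\<dots> = max (?e x k) (?e y k)" using uv(3) by (simp add: distrib_right[symmetric])
    finally have "exp (?e (u *\<^sub>R x + v *\<^sub>R y) k) \<le> exp (max (?e x k) (?e y k))" by simp
    also have "\<dots> \<le> exp (?e x k) + exp (?e y k)" by (simp add: max_def add_increasing add_increasing2)
    finally have "exp (?e (u *\<^sub>R x + v *\<^sub>R y) k) \<le> exp (?e x k) + exp (?e y k)" .
    then show "norm (d k) * exp (?e (u *\<^sub>R x + v *\<^sub>R y) k) \<le> norm (d k) * exp (?e x k) + norm (d k) * exp (?e y k)"
      unfolding distrib_left[symmetric] by (rule mult_left_mono) simp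
  qed simp
  then show "u *\<^sub>R x + v *\<^sub>R y \<in> log_domain d" by (simp add: log_domain_def)
qed

lemma continuous_on_LogMap: "continuous_on torus LogMap"
  unfolding LogMap_def[abs_def] by (intro continuous_intros) (auto simp: torus_def)

text \<open>Absolute convergence depends on the moduli only. For the interiors to correspond one
  needs continuity of \<open>LogMap\<close> in one direction and continuous sections of it in the
  other.\<close>

lemma conv_domain_eq: "conv_domain d = {t \<in> torus. LogMap t \<in> interior (log_domain d)}"
proof -
  let ?S = "{t \<in> torus. (\<lambda>k. norm (d k * lmono t k)) summable_on UNIV}"
  have S: "?S = {t \<in> torus. LogMap t \<in> log_domain d}"
    by (auto simp: log_domain_def norm_mult norm_lmono)
  have "open (torus \<inter> LogMap -` interior (log_domain d))"
    by (rule continuous_open_preimage[OF continuous_on_LogMap open_torus open_interior])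
  moreover have "torus \<inter> LogMap -` interior (log_domain d) \<subseteq> ?S"
    unfolding S using interior_subset by blast
  ultimately have "torus \<inter> LogMap -` interior (log_domain d) \<subseteq> interior ?S"
    by (rule interior_maximal[rotated])
  then have 1: "{t \<in> torus. LogMap t \<in> interior (log_domain d)} \<subseteq> interior ?S" by auto
  have 2: "LogMap t \<in> interior (log_domain d)" if t: "t \<in> interior ?S" for t
  proof -
    have tT: "t \<in> torus" using t interior_subset by blast
    \<comment> \<open>A section of \<open>LogMap\<close> through \<open>t\<close>: the moduli are
      prescribed, the arguments are those of \<open>t\<close>.\<close>
    define \<sigma> where "\<sigma> = (\<lambda>x. (\<chi> i. t $ i * of_real (exp (x $ i - LogMap t $ i))) :: complex^'a)"
    have "continuous_on UNIV \<sigma>" unfolding \<sigma>_def by (intro continuous_intros)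
    then have "open (\<sigma> -` interior ?S)" by (intro open_vimage open_interior)
    moreover have "\<sigma> (LogMap t) = t" by (simp add: \<sigma>_def vec_eq_iff)
    moreover have "x \<in> log_domain d" if "x \<in> \<sigma> -` interior ?S" for x
    proof -
      have "\<sigma> x \<in> ?S" using that interior_subset by blast
      then have "LogMap (\<sigma> x) \<in> log_domain d" unfolding S by simp
      moreover have "LogMap (\<sigma> x) = x"
        using tT by (simp add: LogMap_def \<sigma>_def vec_eq_iff norm_mult torus_def ln_mult)
      ultimately show ?thesis by simp
    qed
    ultimately show ?thesis using t interior_maximal[of "\<sigma> -` interior ?S" "log_domain d"] by blast
  qed
  have 3: "t \<in> torus" if "t \<in> interior ?S" for t using that interior_subset by blast
  show ?thesis unfolding conv_domain_def using 1 2 3 by blast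
qed

lemma open_conv_domain: "open (conv_domain d)"
  by (simp add: conv_domain_def)

lemma conv_domain_torus: "conv_domain d \<subseteq> torus"
  by (auto simp: conv_domain_eq)

text \<open>Near \<open>t0\<close> each term is dominated by its value at a corner of a small cube
  around \<open>LogMap t0\<close>, selected by the signs of the exponent; the sum over all corners
  is a convergent majorant.\<close>

lemma holo_on_conv_domain: "holo_on (conv_domain d) (\<lambda>t. \<Sum>\<^sub>\<infinity>k. d k * lmono t k)"
proof (rule holo_on_locally)
  fix t0 assume "t0 \<in> conv_domain d"
  then have t0: "t0 \<in> torus" "LogMap t0 \<in> interior (log_domain d)" by (auto simp: conv_domain_eq)
  let ?x = "LogMap t0"
  obtain e where e: "e > 0" "cball ?x e \<subseteq> log_domain d"
    using t0(2) by (auto simp: mem_interior_cball)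
  \<comment> \<open>A corner differs from \<open>LogMap t0\<close> by \<eta> in every coordinate, so
    its distance is at most \<open>CARD('a) * \<eta> = e\<close>.\<close>
  define \<eta> where "\<eta> = e / real CARD('a)"
  have \<eta>: "\<eta> > 0" using e(1) by (simp add: \<eta>_def)
  define corner where "corner = (\<lambda>s :: 'a \<Rightarrow> bool. (\<chi> j. ?x $ j + (if s j then \<eta> else - \<eta>)) :: real^'a)"
  have corner: "corner s \<in> log_domain d" for s
  proof -
    have "norm (corner s - ?x) \<le> (\<Sum>j\<in>UNIV. \<bar>(corner s - ?x) $ j\<bar>)" by (rule norm_le_l1_cart)
    also have "\<dots> = real CARD('a) * \<eta>" using \<eta> by (simp add: corner_def if_distrib[of abs] cong: if_cong)
    also have "\<dots> = e" by (simp add: \<eta>_def)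
    finally show ?thesis using e(2) by (auto simp: dist_norm norm_minus_commute)
  qed
  let ?e = "\<lambda>(x::real^'a) (k::int^'a). \<Sum>j\<in>UNIV. of_int (k $ j) * x $ j"
  define M where "M = (\<lambda>k. \<Sum>s\<in>UNIV. norm (d k) * exp (?e (corner s) k))"
  have "M summable_on UNIV"
  proof -
    have "(\<lambda>k. \<Sum>s\<in>A. norm (d k) * exp (?e (corner s) k)) summable_on UNIV" if "finite A" for A
      using that by (induction A) (use corner in \<open>auto intro!: summable_on_add simp: log_domain_def\<close>)
    then show ?thesis unfolding M_def by simp
  qed
  define V where "V = torus \<inter> LogMap -` {x. \<forall>j. \<bar>x $ j - ?x $ j\<bar> < \<eta>}"
  have "open (\<Inter>j. {x :: real^'a. \<bar>x $ j - ?x $ j\<bar> < \<eta>})"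
    by (intro open_INT finite ballI open_Collect_less continuous_intros)
  then have "open {x :: real^'a. \<forall>j. \<bar>x $ j - ?x $ j\<bar> < \<eta>}" by (simp add: Collect_all_eq)
  then have oV: "open V" unfolding V_def by (rule continuous_open_preimage[OF continuous_on_LogMap open_torus])
  have t0V: "t0 \<in> V" using t0 \<eta> by (simp add: V_def)
  have bound: "norm (d k * lmono t k) \<le> M k" if t: "t \<in> V" for t k
  proof -
    define s where "s = (\<lambda>j. k $ j \<ge> 0)"
    have "?e (LogMap t) k \<le> ?e (corner s) k"
    proof (rule sum_mono)
      fix j
      have x: "\<bar>LogMap t $ j - ?x $ j\<bar> < \<eta>" using t by (simp add: V_def)
      show "of_int (k $ j) * LogMap t $ j \<le> of_int (k $ j) * corner s $ j"
      proof (cases "k $ j \<ge> 0")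
        case True
        then have "LogMap t $ j \<le> corner s $ j" using x by (simp add: corner_def s_def)
        then show ?thesis using True by (intro mult_left_mono) simp_all
      next
        case False
        then have "corner s $ j \<le> LogMap t $ j" using x by (simp add: corner_def s_def)
        then show ?thesis using False by (intro mult_left_mono_neg) simp_all
      qed
    qed
    then have "norm (d k * lmono t k) \<le> norm (d k) * exp (?e (corner s) k)"
      using t by (simp add: norm_mult norm_lmono V_def mult_left_mono)
    also have "\<dots> \<le> M k" unfolding M_def
      by (rule member_le_sum[where f="\<lambda>s. norm (d k) * exp (?e (corner s) k)"]) auto
    finally show ?thesis .
  qed
  have "uniform_limit V (\<lambda>X t. \<Sum>k\<in>X. d k * lmono t k) (\<lambda>t. \<Sum>\<^sub>\<infinity>k. d k * lmono t k) (finite_subsets_at_top UNIV)"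
    by (rule Weierstrass_m_test_general[OF bound \<open>M summable_on UNIV\<close>])
  \<comment> \<open>Enumerating the exponents replaces the net of finite partial sums by a sequence,
    the form in which \<open>holo_uniform_limit\<close> applies.\<close>
  moreover have "filterlim (\<lambda>n. {k :: int^'a. to_nat k \<le> n}) (finite_subsets_at_top UNIV) sequentially"
    unfolding filterlim_finite_subsets_at_top
  proof (intro allI impI)
    fix X :: "(int^'a) set" assume X: "finite X \<and> X \<subseteq> UNIV"
    have fin: "finite {k :: int^'a. to_nat k \<le> n}" for n
      using finite_vimageI[OF finite_atMost[of n] inj_to_nat] by (simp add: vimage_def)
    obtain N where "to_nat ` X \<subseteq> {..N}" using X finite_nat_set_iff_bounded_le[of "to_nat ` X"] by auto
    then show "\<forall>\<^sub>F n in sequentially. finite {k :: int^'a. to_nat k \<le> n} \<and> X \<subseteq> {k. to_nat k \<le> n} \<and> {k :: int^'a. to_nat k \<le> n} \<subseteq> UNIV"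
      using fin by (intro eventually_sequentiallyI[of N]) auto
  qed
  ultimately have "uniform_limit V (\<lambda>n t. \<Sum>k | to_nat k \<le> n. d k * lmono t k) (\<lambda>t. \<Sum>\<^sub>\<infinity>k. d k * lmono t k) sequentially"
    by (rule filterlim_compose)
  then have "holo_on V (\<lambda>t. \<Sum>\<^sub>\<infinity>k. d k * lmono t k)"
    by (rule holo_uniform_limit[OF oV _, rotated])
       (intro holo_on_sum holo_on_mult holo_on_const holo_on_subset[OF holo_on_lmono], auto simp: V_def)
  then show "\<exists>V. t0 \<in> V \<and> holo_on V (\<lambda>t. \<Sum>\<^sub>\<infinity>k. d k * lmono t k)" using t0V by blast
qed

lemma holo_on_expv:
  assumes "holo_on torus h" shows "holo_on UNIV (\<lambda>\<tau>. h (expv \<tau>))"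
proof -
  have *: "(expv has_derivative (\<lambda>x. \<chi> j. exp (\<tau> $ j) * x $ j)) (at \<tau>)" for \<tau> :: "complex^'a"
  proof -
    have "((\<lambda>\<tau>. exp (\<tau> $ j) *s axis j 1 :: complex^'a) has_derivative (\<lambda>x. (exp (\<tau> $ j) * x $ j) *s axis j 1)) (at \<tau>)" for j :: 'a
      by (rule bounded_linear.has_derivative[OF bounded_linear_cscale
          has_derivative_compose_field[OF bounded_linear_imp_has_derivative[OF bounded_linear_vec_nth] DERIV_exp]])
    then have "((\<lambda>\<tau>. \<Sum>j\<in>UNIV. exp (\<tau> $ j) *s axis j 1 :: complex^'a) has_derivative (\<lambda>x. \<Sum>j\<in>UNIV. (exp (\<tau> $ j) * x $ j) *s axis j 1)) (at \<tau>)"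
      by (intro has_derivative_sum)
    moreover have "(\<Sum>j\<in>UNIV. y j *s axis j 1) = (\<chi> j. y j)" for y :: "'a \<Rightarrow> complex"
      by (simp add: vec_eq_iff axis_def if_distrib cong: if_cong)
    ultimately show ?thesis by (simp add: expv_def[abs_def])
  qed
  show ?thesis
  proof (rule holo_onI)
    show "((\<lambda>\<tau>. h (expv \<tau>)) has_derivative (\<lambda>x. dderiv h (expv \<tau>) (\<chi> j. exp (\<tau> $ j) * x $ j))) (at \<tau>)" for \<tau>
      by (rule has_derivative_compose[OF * holo_on_has_derivative[OF assms expv_torus]])
    fix \<tau> c and x :: "complex^'a"
    have "(\<chi> j. exp (\<tau> $ j) * (c *s x) $ j) = c *s (\<chi> j. exp (\<tau> $ j) * x $ j)" by (simp add: vec_eq_iff)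
    then show "dderiv h (expv \<tau>) (\<chi> j. exp (\<tau> $ j) * (c *s x) $ j) = c * dderiv h (expv \<tau>) (\<chi> j. exp (\<tau> $ j) * x $ j)"
      by (simp add: holo_on_dderiv_cscale[OF assms expv_torus])
  qed
qed

section \<open>From a point over \<open>E\<close> to the starting point of the path\<close>

text \<open>The zeros of a nonzero entire function are countable, and so are their slopes
  \<open>Im z / Re z\<close>. Zeros on the imaginary axis get slope 0 by division by zero, which
  excludes at most one further value; the point with \<open>r = 0\<close> is covered by
  \<open>f 0 \<noteq> 0\<close>.\<close>

lemma exists_slope_avoiding_zeros:
  assumes "f holomorphic_on UNIV" "f 0 \<noteq> 0"
  obtains \<kappa> :: real where "\<And>r. f (of_real r * Complex 1 \<kappa>) \<noteq> 0"
proof -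
  have "countable {z \<in> UNIV. f z = 0}"
  proof (cases "f constant_on UNIV")
    case True
    then have "{z \<in> UNIV. f z = 0} = {}" using assms(2) by (auto simp: constant_on_def)
    then show ?thesis by simp
  next
    case False
    then show ?thesis by (intro holomorphic_countable_zeros assms(1)) auto
  qed
  then have "countable ((\<lambda>z. Im z / Re z) ` {z \<in> UNIV. f z = 0})" by (rule countable_image)
  then have "(\<lambda>z. Im z / Re z) ` {z \<in> UNIV. f z = 0} \<noteq> UNIV" using uncountable_UNIV_real by metis
  then obtain \<kappa> where \<kappa>: "\<kappa> \<notin> (\<lambda>z. Im z / Re z) ` {z \<in> UNIV. f z = 0}" by blast
  show thesis
  proof (rule that[of \<kappa>])
    fix r :: real
    show "f (of_real r * Complex 1 \<kappa>) \<noteq> 0"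
    proof
      assume 0: "f (of_real r * Complex 1 \<kappa>) = 0"
      then have "r \<noteq> 0" using assms(2) by auto
      then have "\<kappa> = Im (of_real r * Complex 1 \<kappa>) / Re (of_real r * Complex 1 \<kappa>)" by simp
      then show False using \<kappa> 0 by blast
    qed
  qed
qed

context diagonal
begin

text \<open>Logarithmic convexity of the domain of convergence provides a path to \<open>t0\<close>
  from a point over \<open>E\<close>; along it the diagonal is holomorphic, so the identity
  expressing it through the family persists.\<close>

lemma family_at_conv_domain:
  assumes ne: "lsupp f \<noteq> {}" and E: "open E" "E \<noteq> {}" and nz: "\<forall>z\<in>torus. LogMap z \<in> E \<longrightarrow> leval f z \<noteq> 0"
    and lau: "laurent_expansion_on c g f E" and g: "finite (lsupp g)"
    and sat: "\<forall>\<alpha>. (\<forall>i. idot (orth i) \<alpha> = 0) \<longrightarrow> (\<exists>k. \<alpha> = lat_comb q k)"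
    and t0: "t0 \<in> conv_domain (diag_coef c q)" "t0 \<notin> Lset f q"
  shows "\<exists>\<delta> \<Phi>. \<delta> > 0 \<and> family (ball t0 \<delta>) \<Phi> \<and>
    (\<forall>t\<in>ball t0 \<delta>. (\<Sum>m\<in>lsupp g. g m * fst (\<Phi> t) m) = diag c q t)"
proof -
  let ?dom = "conv_domain (diag_coef c q)"
  have t0T: "t0 \<in> torus" using t0(1) conv_domain_torus by blast
  \<comment> \<open>The elimination data found at \<open>t0\<close> serve along the whole path:
    \<open>h\<close> is holomorphic on all of the torus, and it is enough to avoid its zeros, even
    where the path might meet \<open>Lset f q\<close>.\<close>
  obtain h EE K where el: "elim_data h EE K" and "h t0 \<noteq> 0"
    by (rule elimination_outside_Lset[OF t0(2)])
  then have h: "holo_on torus h" "h t0 \<noteq> 0" by (simp_all add: elim_data_def)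
  obtain x where x: "x \<in> E" using E(2) by blast
  define \<tau>0 where "\<tau>0 = (\<chi> j. Ln (t0 $ j))"
  have ex\<tau>0: "expv \<tau>0 = t0" unfolding \<tau>0_def by (rule expv_Ln[OF t0T])
  \<comment> \<open>The difference between the logarithmic moduli of a point over \<open>x\<close>
    and those of \<open>t0\<close>. At the far end only moduli are prescribed, which leaves the
    arguments free for a tilt.\<close>
  define b where "b = (\<lambda>j. (\<Sum>i\<in>UNIV. of_int (q j $ i) * x $ i) - Re (\<tau>0 $ j))"
  define v :: "complex^'r" where "v = (\<chi> j. of_real (b j))"
  have "(\<lambda>z. h (expv (\<tau>0 + z *s v))) holomorphic_on UNIV"
    unfolding holomorphic_on_def field_differentiable_def
    using holo_on_line[OF holo_on_expv[OF h(1)] UNIV_I] by (blast intro: has_field_derivative_at_within)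
  moreover have "h (expv (\<tau>0 + 0 *s v)) \<noteq> 0" using h(2) ex\<tau>0 by simp
  ultimately obtain \<kappa> where \<kappa>: "\<And>r. h (expv (\<tau>0 + (of_real r * Complex 1 \<kappa>) *s v)) \<noteq> 0"
    by (rule exists_slope_avoiding_zeros) blast
  txt \<open>The slope \<open>\<kappa>\<close> tilts the segment in logarithmic coordinates away from the zeros of \<open>h\<close>; as it
    only rotates the coordinates, the path stays in the domain of convergence.\<close>
  define \<gamma> where "\<gamma> = (\<lambda>s. expv (\<tau>0 + (of_real (1 - s) * Complex 1 \<kappa>) *s v))"
  \<comment> \<open>A point of the tube over \<open>x\<close> mapped to the far end of the path: its
    real part is \<open>x\<close>, and imaginary shifts along the \<open>w l\<close> adjust the
    arguments of the image one by one.\<close>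
  define \<xi>0 where "\<xi>0 = (\<chi> i. of_real (x $ i)) + (\<Sum>l\<in>UNIV. (\<i> * of_real ((Im (\<tau>0 $ l) + \<kappa> * b l) / of_int D)) *s cvec (w l))"
  have Re\<xi>0: "Re_vec \<xi>0 = x"
    by (simp add: Re_vec_def \<xi>0_def vec_eq_iff cvec_def)
  have "cdot (q j) \<xi>0 = of_real (\<Sum>i\<in>UNIV. of_int (q j $ i) * x $ i) + \<i> * of_real (Im (\<tau>0 $ j) + \<kappa> * b j)" for j
  proof -
    have "cdot (q j) (\<Sum>l\<in>UNIV. (\<i> * of_real ((Im (\<tau>0 $ l) + \<kappa> * b l) / of_int D)) *s cvec (w l)) =
        (\<Sum>l\<in>UNIV. if l = j then \<i> * of_real (Im (\<tau>0 $ j) + \<kappa> * b j) else 0)"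
      unfolding cdot_sum_right cdot_cscale cdot_cvec
      using D_nonzero by (intro sum.cong) (auto simp: idot_commute[of "q _"] dual)
    then show ?thesis unfolding \<xi>0_def cdot_add_right by (simp add: cdot_def)
  qed
  then have "cdot (q j) \<xi>0 = (\<tau>0 + Complex 1 \<kappa> *s v) $ j" for j
    by (simp add: v_def b_def complex_eq_iff algebra_simps)
  then have \<gamma>0: "\<gamma> 0 = monomap q (expv \<xi>0)"
    by (simp add: \<gamma>_def monomap_def lmono_expv vec_eq_iff) (simp add: expv_def)
  have \<gamma>1: "\<gamma> 1 = t0" by (simp add: \<gamma>_def ex\<tau>0)
  have \<xi>0E: "Re_vec \<xi>0 \<in> E" using x Re\<xi>0 by simp
  from initial_family[OF E(1) nz lau g sat \<xi>0E \<gamma>0]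
  obtain \<delta>0 \<Phi>0 where \<Phi>0: "\<delta>0 > 0" "family (ball (\<gamma> 0) \<delta>0) \<Phi>0"
    "\<forall>t\<in>ball (\<gamma> 0) \<delta>0. (\<Sum>m\<in>lsupp g. g m * fst (\<Phi>0 t) m) = diag c q t"
    "\<forall>t\<in>ball (\<gamma> 0) \<delta>0. (\<lambda>k. norm (diag_coef c q k * lmono t k)) summable_on UNIV"
    by (elim exE conjE) (rule that)
  have "ball (\<gamma> 0) \<delta>0 \<subseteq> ?dom"
    unfolding conv_domain_def using familyD(1)[OF \<Phi>0(2)] \<Phi>0(4) by (intro interior_maximal) auto
  then have "\<gamma> 0 \<in> ?dom" using \<Phi>0(1) by auto
  have Log\<gamma>: "LogMap (\<gamma> s) = (\<chi> j. Re (\<tau>0 $ j) + (1 - s) * b j)" for s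
    by (simp add: \<gamma>_def LogMap_expv Re_vec_def v_def vec_eq_iff)
  have \<gamma>_dom: "\<gamma> s \<in> ?dom" if s: "s \<in> {0..1}" for s
  proof -
    have "LogMap (\<gamma> 0) \<in> interior (log_domain (diag_coef c q))" "LogMap (\<gamma> 1) \<in> interior (log_domain (diag_coef c q))"
      using \<open>\<gamma> 0 \<in> ?dom\<close> t0(1) \<gamma>1 by (auto simp: conv_domain_eq)
    then have "(1 - s) *\<^sub>R LogMap (\<gamma> 0) + s *\<^sub>R LogMap (\<gamma> 1) \<in> interior (log_domain (diag_coef c q))"
      using s by (intro convexD_alt[OF convex_interior[OF convex_log_domain]]) auto
    moreover have "(1 - s) *\<^sub>R LogMap (\<gamma> 0) + s *\<^sub>R LogMap (\<gamma> 1) = LogMap (\<gamma> s)"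
      unfolding Log\<gamma> vec_eq_iff by (simp add: algebra_simps)
    ultimately show ?thesis by (simp add: conv_domain_eq \<gamma>_def)
  qed
  \<comment> \<open>The identity with the diagonal is made part of admissibility, so that it is
    still available on arrival at \<open>t0\<close>.\<close>
  define Adm where "Adm = (\<lambda>U \<Phi>. family U \<Phi> \<and> (\<forall>t\<in>U. (\<Sum>m\<in>lsupp g. g m * fst (\<Phi> t) m) = diag c q t))"
  have hd: "holo_on ?dom (diag c q)" using holo_on_conv_domain[of "diag_coef c q"] by (simp add: diag_def[abs_def])
  have cont: "continuous_on {0..1} \<gamma>"
    unfolding \<gamma>_def expv_def by (intro continuous_intros)
  have ext: "\<forall>s\<in>{0..1}. \<exists>\<epsilon>>0. \<forall>t\<in>ball (\<gamma> s) \<epsilon>. \<forall>\<Phi>. (\<exists>\<delta>>0. Adm (ball t \<delta>) \<Phi>) \<longrightarrow>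
      (\<exists>\<Psi>. Adm (ball (\<gamma> s) \<epsilon>) \<Psi> \<and> (\<forall>\<^sub>F w in nhds t. \<Psi> w = \<Phi> w))"
  proof
    fix s :: real assume s: "s \<in> {0..1}"
    have "\<gamma> s \<in> torus" "h (\<gamma> s) \<noteq> 0" using \<kappa>[of "1 - s"] by (simp_all add: \<gamma>_def)
    from family_local_extension[OF ne el this open_conv_domain \<gamma>_dom[OF s] hd, where M="lsupp g" and g=g]
    show "\<exists>\<epsilon>>0. \<forall>t\<in>ball (\<gamma> s) \<epsilon>. \<forall>\<Phi>. (\<exists>\<delta>>0. Adm (ball t \<delta>) \<Phi>) \<longrightarrow>
      (\<exists>\<Psi>. Adm (ball (\<gamma> s) \<epsilon>) \<Psi> \<and> (\<forall>\<^sub>F w in nhds t. \<Psi> w = \<Phi> w))" unfolding Adm_def by blast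
  qed
  have sub: "\<forall>U V \<Phi>. Adm U \<Phi> \<longrightarrow> V \<subseteq> U \<longrightarrow> Adm V \<Phi>"
    using family_subset unfolding Adm_def by blast
  have init: "Adm (ball (\<gamma> 0) \<delta>0) \<Phi>0" using \<Phi>0 by (simp add: Adm_def)
  from continuation_along_path[OF cont ext sub \<Phi>0(1) init]
  obtain \<Phi> d where "\<forall>s\<in>{0..1}. d s > 0 \<and> Adm (ball (\<gamma> s) (d s)) (\<Phi> s)" by blast
  then have "d 1 > 0" "Adm (ball t0 (d 1)) (\<Phi> 1)" using \<gamma>1 by auto
  then show ?thesis unfolding Adm_def by blast
qed

text \<open>The family is what gets continued, with elimination data chosen afresh at each point of
  the path; the continuation of \<open>F\<close> is read off as the combination of the
  \<open>P m\<close> with the fixed coefficients \<open>g m\<close>.\<close>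

lemma continues_along_outside_Lset:
  assumes ne: "lsupp f \<noteq> {}" and \<gamma>: "path \<gamma>" "path_image \<gamma> \<subseteq> torus - Lset f q"
    and init: "\<delta> > 0" "family (ball (pathstart \<gamma>) \<delta>) \<Phi>0"
      "\<forall>t\<in>ball (pathstart \<gamma>) \<delta>. (\<Sum>m\<in>M. g m * fst (\<Phi>0 t) m) = F t"
  shows "continues_along F \<gamma>"
proof -
  have cont: "continuous_on {0..1} \<gamma>" using \<gamma>(1) by (simp add: path_def)
  have ext: "\<forall>s\<in>{0..1}. \<exists>\<epsilon>>0. \<forall>t\<in>ball (\<gamma> s) \<epsilon>. \<forall>\<Phi>. (\<exists>\<delta>>0. family (ball t \<delta>) \<Phi>) \<longrightarrow>
      (\<exists>\<Psi>. family (ball (\<gamma> s) \<epsilon>) \<Psi> \<and> (\<forall>\<^sub>F w in nhds t. \<Psi> w = \<Phi> w))"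
  proof
    fix s :: real assume s: "s \<in> {0..1}"
    have "\<gamma> s \<in> path_image \<gamma>" using s by (simp add: path_image_def)
    then have \<gamma>s: "\<gamma> s \<in> torus" "\<gamma> s \<notin> Lset f q" using \<gamma>(2) by blast+
    obtain h EE K where el: "elim_data h EE K" and h: "h (\<gamma> s) \<noteq> 0"
      by (rule elimination_outside_Lset[OF \<gamma>s(2)])
    from family_local_extension[OF ne el \<gamma>s(1) h open_torus \<gamma>s(1) holo_on_const[of _ 0], where M="{}" and g="\<lambda>_. 0"]
    show "\<exists>\<epsilon>>0. \<forall>t\<in>ball (\<gamma> s) \<epsilon>. \<forall>\<Phi>. (\<exists>\<delta>>0. family (ball t \<delta>) \<Phi>) \<longrightarrow>
      (\<exists>\<Psi>. family (ball (\<gamma> s) \<epsilon>) \<Psi> \<and> (\<forall>\<^sub>F w in nhds t. \<Psi> w = \<Phi> w))" by blast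
  qed
  have init': "family (ball (\<gamma> 0) \<delta>) \<Phi>0" using init(2) by (simp add: pathstart_def)
  have sub: "\<forall>U V \<Phi>. family U \<Phi> \<longrightarrow> V \<subseteq> U \<longrightarrow> family V \<Phi>" using family_subset by blast
  from continuation_along_path[OF cont ext sub init(1) init']
  obtain \<Phi> d where \<Phi>: "\<forall>s\<in>{0..1}. d s > 0 \<and> family (ball (\<gamma> s) (d s)) (\<Phi> s)"
    "\<forall>\<^sub>F t in nhds (\<gamma> 0). \<Phi> 0 t = \<Phi>0 t"
    "\<forall>s\<in>{0..1}. \<exists>e>0. \<forall>s'\<in>{0..1}. \<bar>s' - s\<bar> < e \<longrightarrow>
        \<gamma> s' \<in> ball (\<gamma> s) (d s) \<and> (\<forall>\<^sub>F t in nhds (\<gamma> s'). \<Phi> s' t = \<Phi> s t)"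
    by (elim exE conjE) (rule that)
  let ?\<phi> = "\<lambda>s t. \<Sum>m\<in>M. g m * fst (\<Phi> s t) m"
  show ?thesis
    unfolding continues_along_def
  proof (intro exI[of _ "\<lambda>s. ball (\<gamma> s) (d s)"] exI[of _ ?\<phi>] conjI ballI)
    fix s :: real assume s: "s \<in> {0..1}"
    show "open (ball (\<gamma> s) (d s))" by simp
    show "\<gamma> s \<in> ball (\<gamma> s) (d s)" using bspec[OF \<Phi>(1) s] by simp
    show "holo_on (ball (\<gamma> s) (d s)) (?\<phi> s)"
      using bspec[OF \<Phi>(1) s] by (intro holo_on_sum holo_on_mult holo_on_const familyD(2)) auto
    obtain e where e: "e > 0" "\<forall>s'\<in>{0..1}. \<bar>s' - s\<bar> < e \<longrightarrow>
        \<gamma> s' \<in> ball (\<gamma> s) (d s) \<and> (\<forall>\<^sub>F t in nhds (\<gamma> s'). \<Phi> s' t = \<Phi> s t)"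
      using bspec[OF \<Phi>(3) s] by blast
    show "\<exists>e>0. \<forall>s'\<in>{0..1}. \<bar>s' - s\<bar> < e \<longrightarrow>
        \<gamma> s' \<in> ball (\<gamma> s) (d s) \<and> (\<forall>\<^sub>F t in nhds (\<gamma> s'). ?\<phi> s' t = ?\<phi> s t)"
    proof (intro exI[of _ e] conjI ballI impI e(1))
      fix s' assume s': "s' \<in> {0..1}" "\<bar>s' - s\<bar> < e"
      show "\<gamma> s' \<in> ball (\<gamma> s) (d s)" using e(2) s' by blast
      have "\<forall>\<^sub>F t in nhds (\<gamma> s'). \<Phi> s' t = \<Phi> s t" using e(2) s' by blast
      then show "\<forall>\<^sub>F t in nhds (\<gamma> s'). ?\<phi> s' t = ?\<phi> s t" by eventually_elim simp
    qed
  next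
    have "\<forall>\<^sub>F t in nhds (\<gamma> 0). t \<in> ball (\<gamma> 0) \<delta>" using init(1) by (intro eventually_nhds_in_open) auto
    with \<Phi>(2) show "\<forall>\<^sub>F t in nhds (\<gamma> 0). ?\<phi> 0 t = F t"
      by eventually_elim (use init(3) in \<open>simp add: pathstart_def\<close>)
  qed
qed

end

theorem theorem1:
  fixes f g :: "'n::finite lpoly" and c :: "int^'n \<Rightarrow> complex"
    and E :: "(real^'n) set" and q :: "'r::finite \<Rightarrow> int^'n"
    and t0 :: "complex^'r" and \<gamma> :: "real \<Rightarrow> complex^'r"
  assumes "CARD('r) \<le> CARD('n)"
    and "is_lpoly f" and "nondegenerate f"
    and "is_lpoly g" and "lcoprime f g"
    and "E \<in> components (UNIV - amoeba f)"
    and "laurent_expansion_on c g f E"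
    and "saturated_rank q"
    and "t0 \<in> conv_domain (diag_coef c q)"
    and "path \<gamma>" and "pathstart \<gamma> = t0" and "path_image \<gamma> \<subseteq> torus - Lset f q"
  shows "continues_along (diag c q) \<gamma>"
proof -
  have fin: "finite (lsupp f)" "finite (lsupp g)" using assms by (auto simp: is_lpoly_def)
  obtain w D where w: "D \<noteq> 0" "\<And>l k. idot (w l) (q k) = (if l = k then D else 0)"
    using dual_vectors_exist[of q] assms(8) unfolding saturated_rank_def by metis
  interpret diagonal f q w D by unfold_locales (use fin w in auto)
  have "open (UNIV - amoeba f)" using closed_amoeba[OF fin(1)] by (simp add: Compl_eq_Diff_UNIV[symmetric] open_Compl)
  then have E: "open E" "E \<noteq> {}" "E \<subseteq> UNIV - amoeba f"
    using assms(6) open_components in_components_nonempty in_components_subset by blast+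
  have nz: "\<forall>z\<in>torus. LogMap z \<in> E \<longrightarrow> leval f z \<noteq> 0"
    using E(3) by (auto simp: amoeba_def Ztor_def)
  \<comment> \<open>With \<open>f = 0\<close> the value of \<open>f\<close> would vanish over every
    point of the nonempty set \<open>E\<close>, against \<open>nz\<close>.\<close>
  have ne: "lsupp f \<noteq> {}"
  proof
    assume "lsupp f = {}"
    moreover obtain x where "x \<in> E" using E(2) by blast
    ultimately show False using bspec[OF nz, of "expv (\<chi> i. of_real (x $ i))"]
      by (simp add: leval_def LogMap_expv Re_vec_def)
  qed
  \<comment> \<open>Orthogonality to every \<open>orth i\<close> writes \<open>D\<close> times
    \<alpha> as the combination of the \<open>q l\<close> with coefficients
    \<open>idot (w l) \<alpha>\<close>. So \<alpha> lies in their real span, and saturation gives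
    integer coefficients.\<close>
  have sat: "\<exists>k. \<alpha> = lat_comb q k" if orth: "\<forall>i. idot (orth i) \<alpha> = 0" for \<alpha>
  proof -
    have "D * \<alpha> $ i = (\<Sum>l\<in>UNIV. q l $ i * idot (w l) \<alpha>)" for i using spec[OF orth, of i] by (simp add: idot_orth)
    then have "real_of_int (D * \<alpha> $ i) = of_int (\<Sum>l\<in>UNIV. q l $ i * idot (w l) \<alpha>)" for i by simp
    then have "int_to_real \<alpha> = (\<Sum>l\<in>UNIV. (of_int (idot (w l) \<alpha>) / of_int D) *\<^sub>R int_to_real (q l))"
      using D_nonzero by (simp add: vec_eq_iff int_to_real_def sum_divide_distrib[symmetric] field_simps)
    also have "\<dots> \<in> span (range (\<lambda>j. int_to_real (q j)))"
      by (intro span_sum span_scale span_base) auto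
    finally show ?thesis using assms(8) by (auto simp: saturated_rank_def)
  qed
  have t0: "t0 \<notin> Lset f q" using assms(11,12) pathstart_in_path_image[of \<gamma>] by blast
  from sat have sat': "\<forall>\<alpha>. (\<forall>i. idot (orth i) \<alpha> = 0) \<longrightarrow> (\<exists>k. \<alpha> = lat_comb q k)" by blast
  from family_at_conv_domain[OF ne E(1,2) nz assms(7) fin(2) sat' assms(9) t0]
  obtain \<delta> \<Phi> where "\<delta> > 0" "family (ball t0 \<delta>) \<Phi>"
    "\<forall>t\<in>ball t0 \<delta>. (\<Sum>m\<in>lsupp g. g m * fst (\<Phi> t) m) = diag c q t" by blast
  then show ?thesis
    using continues_along_outside_Lset[OF ne assms(10,12), of \<delta> \<Phi>] assms(11) by blast
qed

end
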